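(* Let $\mathcal F=(F,<,+,\cdot,0,1,\ldots)$ be a definably complete expansion of an ordered field which enjoys the definable choice property, admits a good $(0+)$-pseudo-filter $\mathfrak D$, and has a good extended rank function $\operatorname{eRank}$. Let $G$ be a definable group and let $X$ be a definable $G$-set which is locally closed. Assume that the $G$-action on $X$ is definably proper. Then there exists a definable quotient $X\to X/G$, that is, a definable quotient of $X$ by the equivalence relation $\{(x,gx)\mid g\in G,\ x\in X\}$.
   Context: Let $\mathcal F=(F,<,\ldots)$ be an expansion of a dense linear order without endpoints. "Definable" means definable in $\mathcal F$ with parameters; a definable map is a map between definable sets whose graph is definable. $F$ carries the order topology, $F^n$ the product topology, and subsets of $F^n$ the relative topology. A definable subset of $F^n$ is called locally closed if it is so in $F^n$. $\mathcal F$ is definably complete if every definable subset of $F$ has both a supremum and an infimum in $F\cup\{\pm\infty\}$. A definable subset of $F^n$ is definably compact if it is closed and bounded in $F^n$. Definable choice property: (1) for every coordinate projection $\pi:F^{m+n}\to F^m$ and definable sets $X\subseteq F^m$, $Y\subseteq F^{m+n}$ with $\pi(Y)=X$, there is a definable map $\varphi:X\to Y$ with $\pi(\varphi(x))=x$ for all $x\in X$; (2) for every definable equivalence relation $E$ on a definable set $X$ (i.e. $E\subseteq X\times X$ is definable and is an equivalence relation) there is a definable subset $S\subseteq X$ meeting each equivalence class of $E$ in exactly one point. Good $(0+)$-pseudo-filter: let $\mathfrak D$ be a nonempty family of definable subsets of $(0,\infty)$ whose closure in $F$ contains $0$. For a definable set $D\subseteq(0,\infty)$ with $0$ in its closure and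 a definable map $f:D\to F^n$, the limit set $\operatorname{Lim}(f)$ is the set of $p\in F^n$ such that $f^{-1}(B)\cap I\neq\emptyset$ for every open box $B\subseteq F^n$ containing $p$ and every open interval $I$ containing $0$. $\mathfrak D$ is a good $(0+)$-pseudo-filter if: (a) each $D\in\mathfrak D$ is bounded in $F$ and $\operatorname{cl}_F(D)=D\cup\{0\}$; (b) for each $D\in\mathfrak D$ and definable $D_1,D_2$ with $D=D_1\cup D_2$, either $D_1$ or $D_2$ contains an element of $\mathfrak D$; (c) for $D\in\mathfrak D$ and a definable map $\gamma:D\to F^n$, there is $D'\in\mathfrak D$ with $D'\subseteq D$ such that $\gamma|_{D'}$ is continuous; furthermore, if $\operatorname{Lim}(\gamma)\ne\emptyset$, $D'$ can be taken so that $\operatorname{Lim}(\gamma|_{D'})$ is a singleton. Good extended rank function: for each $n\ge 0$, let $\operatorname{Def}(F^n)$ be the set of definable subsets of $F^n$. $\mathcal F$ has a good extended rank function if for each $n$ there is a map $\operatorname{eRank}_n:\operatorname{Def}(F^n)\to\mathcal E_n\cup\{-\infty\}$ such that: (a) $\mathcal E_n$ is a linearly ordered set with a smallest element and $-\infty$ is smaller than any element of $\mathcal E_n$; (b) $\operatorname{eRank}_n(X)=-\infty$ iff $X=\emptyset$; (c) there is no infinite strictly decreasing sequence in $\mathcal E_n$; (d) $\operatorname{eRank}_n(A\cup B)=\max\{\operatorname{eRank}_n(A),\operatorname{eRank}_n(B)\}$; (e) if $X\subseteq Y$ are in $\operatorname{Def}(F^n)$ and $\operatorname{eRank}_n(X)=\operatorname{eRank}_n(Y)$,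 there is a definable subset $U$ of $X$ that is open in $Y$ with $\operatorname{eRank}_n(X\setminus U)<\operatorname{eRank}_n(Y)$; (f) a nonempty $X\in\operatorname{Def}(F^n)$ is discrete whenever $\operatorname{eRank}_n(X)$ is the smallest element of $\mathcal E_n$. A definable continuous map $f:X\to Y$ is definably proper if $f^{-1}(K)$ is definably compact for every definably compact subset $K$ of $Y$. A definable continuous map $f:X\to Y$ is definably identifying if it is surjective and, for every definable subset $K$ of $Y$, $K$ is closed in $Y$ whenever $f^{-1}(K)$ is closed in $X$. For a definable equivalence relation $E$ on $X$, a definable quotient of $X$ by $E$ is a definably identifying map $f:X\to Y$ (to some definable set $Y$) such that $f(x)=f(x')$ if and only if $(x,x')\in E$. A definable group is a definable set $G$ with a group structure whose multiplication $G\times G\to G$ and inversion $G\to G$ are definable continuous maps. A definable $G$-set is a definable set $X$ with a group action $G\times X\to X$, $(g,x)\mapsto gx$, which is a definable continuous map. The $G$-action on $X$ is definably proper if the map $G\times X\ni(g,x)\mapsto(x,gx)\in X\times X$ is definably proper. *)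

theory Defs
  imports
    "HOL-Analysis.Analysis"
    "HOL-Algebra.Group_Action"
    "HOL-Library.Extended"
    "HOL-Library.Option_ord"
begin

section \<open>Expansions of ordered fields and definable sets\<close>

text \<open>
  The language has symbols for the ordered field structure together with further function
  symbols \<open>'f\<close> and relation symbols \<open>'r\<close>.  A symbol may be applied to argument lists of every
  length, so it stands for one symbol of each arity; a symbol of a fixed arity is obtained by
  interpreting the other ones trivially, which does not change the definable sets.
\<close>

datatype 'f trm =
    Var nat
  | Zero
  | One
  | Add "'f trm" "'f trm"
  | Mul "'f trm" "'f trm"
  | Fun 'f "'f trm list"

datatype ('f, 'r) fm =
    Eq "'f trm" "'f trm"
  | Less "'f trm" "'f trm"
  | Rel 'r "'f trm list"
  | Neg "('f, 'r) fm"
  | Conj "('f, 'r) fm" "('f, 'r) fm"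
  | Ex nat "('f, 'r) fm"

record ('a, 'f, 'r) expansion =
  fun_interp :: "'f \<Rightarrow> 'a list \<Rightarrow> 'a"
  rel_interp :: "'r \<Rightarrow> 'a list \<Rightarrow> bool"

primrec eval_trm ::
  "('a::linordered_field, 'f, 'r) expansion \<Rightarrow> (nat \<Rightarrow> 'a) \<Rightarrow> 'f trm \<Rightarrow> 'a" where
  "eval_trm F e (Var v) = e v"
| "eval_trm F e Zero = 0"
| "eval_trm F e One = 1"
| "eval_trm F e (Add s t) = eval_trm F e s + eval_trm F e t"
| "eval_trm F e (Mul s t) = eval_trm F e s * eval_trm F e t"
| "eval_trm F e (Fun f ts) = fun_interp F f (map (eval_trm F e) ts)"

primrec sat ::
  "('a::linordered_field, 'f, 'r) expansion \<Rightarrow> (nat \<Rightarrow> 'a) \<Rightarrow> ('f, 'r) fm \<Rightarrow> bool" where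
  "sat F e (Eq s t) \<longleftrightarrow> eval_trm F e s = eval_trm F e t"
| "sat F e (Less s t) \<longleftrightarrow> eval_trm F e s < eval_trm F e t"
| "sat F e (Rel r ts) \<longleftrightarrow> rel_interp F r (map (eval_trm F e) ts)"
| "sat F e (Neg p) \<longleftrightarrow> \<not> sat F e p"
| "sat F e (Conj p q) \<longleftrightarrow> sat F e p \<and> sat F e q"
| "sat F e (Ex v p) \<longleftrightarrow> (\<exists>a. sat F (e(v := a)) p)"

text \<open>The elements of $F^n$ are the functions on \<open>nat\<close> that are \<open>undefined\<close> outside \<open>{..<n}\<close>.\<close>

definition tuples :: "nat \<Rightarrow> (nat \<Rightarrow> 'a) set" where
  "tuples n = {..<n} \<rightarrow>\<^sub>E UNIV"

text \<open>Definability with parameters: the variables from \<open>n\<close> on are assigned parameters by \<open>e\<close>.\<close>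

definition definable ::
  "('a::linordered_field, 'f, 'r) expansion \<Rightarrow> nat \<Rightarrow> (nat \<Rightarrow> 'a) set \<Rightarrow> bool" where
  "definable F n X \<longleftrightarrow>
     (\<exists>p e. X = {x \<in> tuples n. sat F (\<lambda>i. if i < n then x i else e i) p})"

text \<open>Concatenation $F^m \times F^n \to F^{m+n}$ and its two projections.\<close>

definition tjoin :: "nat \<Rightarrow> nat \<Rightarrow> (nat \<Rightarrow> 'a) \<Rightarrow> (nat \<Rightarrow> 'a) \<Rightarrow> nat \<Rightarrow> 'a" where
  "tjoin m n x y = (\<lambda>i\<in>{..<m+n}. if i < m then x i else y (i - m))"

definition tfst :: "nat \<Rightarrow> (nat \<Rightarrow> 'a) \<Rightarrow> nat \<Rightarrow> 'a" where
  "tfst m z = (\<lambda>i\<in>{..<m}. z i)"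

definition tsnd :: "nat \<Rightarrow> nat \<Rightarrow> (nat \<Rightarrow> 'a) \<Rightarrow> nat \<Rightarrow> 'a" where
  "tsnd m n z = (\<lambda>i\<in>{..<n}. z (m + i))"

definition tprod ::
  "nat \<Rightarrow> nat \<Rightarrow> (nat \<Rightarrow> 'a) set \<Rightarrow> (nat \<Rightarrow> 'a) set \<Rightarrow> (nat \<Rightarrow> 'a) set" where
  "tprod m n X Y = {tjoin m n x y |x y. x \<in> X \<and> y \<in> Y}"

definition definable_map ::
  "('a::linordered_field, 'f, 'r) expansion \<Rightarrow> nat \<Rightarrow> nat \<Rightarrow> (nat \<Rightarrow> 'a) set \<Rightarrow> (nat \<Rightarrow> 'a) set \<Rightarrow>
     ((nat \<Rightarrow> 'a) \<Rightarrow> nat \<Rightarrow> 'a) \<Rightarrow> bool" where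
  "definable_map F m n X Y f \<longleftrightarrow>
     definable F m X \<and> definable F n Y \<and> f \<in> X \<rightarrow> Y \<and>
     definable F (m + n) {tjoin m n x (f x) |x. x \<in> X}"

definition definable_equiv ::
  "('a::linordered_field, 'f, 'r) expansion \<Rightarrow> nat \<Rightarrow> (nat \<Rightarrow> 'a) set \<Rightarrow>
     ((nat \<Rightarrow> 'a) \<times> (nat \<Rightarrow> 'a)) set \<Rightarrow> bool" where
  "definable_equiv F m X E \<longleftrightarrow>
     definable F m X \<and> equiv X E \<and> definable F (m + m) {tjoin m m x y |x y. (x, y) \<in> E}"

text \<open>Subsets of $F$ and maps defined on them, via the identification of $F$ with $F^1$.\<close>

definition pt :: "'a \<Rightarrow> nat \<Rightarrow> 'a" where
  "pt a = (\<lambda>i\<in>{..<1}. a)"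

definition definable1 :: "('a::linordered_field, 'f, 'r) expansion \<Rightarrow> 'a set \<Rightarrow> bool" where
  "definable1 F D \<longleftrightarrow> definable F 1 (pt ` D)"

definition definable_curve ::
  "('a::linordered_field, 'f, 'r) expansion \<Rightarrow> nat \<Rightarrow> 'a set \<Rightarrow> ('a \<Rightarrow> nat \<Rightarrow> 'a) \<Rightarrow> bool" where
  "definable_curve F n D \<gamma> \<longleftrightarrow> definable_map F 1 n (pt ` D) (tuples n) (\<lambda>x. \<gamma> (x 0))"

section \<open>Topology\<close>

text \<open>The sort \<open>linorder_topology\<close> says that the topology of \<open>'a\<close> is the order topology.\<close>

definition tuple_topology :: "nat \<Rightarrow> (nat \<Rightarrow> 'a::linorder_topology) topology" where
  "tuple_topology n = product_topology (\<lambda>_. euclidean) {..<n}"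

abbreviation rel_topology ::
  "nat \<Rightarrow> (nat \<Rightarrow> 'a::linorder_topology) set \<Rightarrow> (nat \<Rightarrow> 'a) topology" where
  "rel_topology n X \<equiv> subtopology (tuple_topology n) X"

definition locally_closed_in :: "'b topology \<Rightarrow> 'b set \<Rightarrow> bool" where
  "locally_closed_in T X \<longleftrightarrow> (\<exists>U C. openin T U \<and> closedin T C \<and> X = U \<inter> C)"

definition bounded_tuples :: "nat \<Rightarrow> (nat \<Rightarrow> 'a::linorder) set \<Rightarrow> bool" where
  "bounded_tuples n X \<longleftrightarrow> (\<exists>a b. \<forall>x\<in>X. \<forall>i<n. a i \<le> x i \<and> x i \<le> b i)"

definition open_box ::
  "nat \<Rightarrow> (nat \<Rightarrow> 'a::linorder) \<Rightarrow> (nat \<Rightarrow> 'a) \<Rightarrow> (nat \<Rightarrow> 'a) set" where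
  "open_box n a b = (\<Pi>\<^sub>E i\<in>{..<n}. {a i<..<b i})"

definition definably_compact ::
  "('a::{linordered_field, linorder_topology}, 'f, 'r) expansion \<Rightarrow> nat \<Rightarrow>
     (nat \<Rightarrow> 'a) set \<Rightarrow> bool" where
  "definably_compact F n K \<longleftrightarrow>
     definable F n K \<and> closedin (tuple_topology n) K \<and> bounded_tuples n K"

definition definable_continuous_map ::
  "('a::{linordered_field, linorder_topology}, 'f, 'r) expansion \<Rightarrow> nat \<Rightarrow> nat \<Rightarrow>
     (nat \<Rightarrow> 'a) set \<Rightarrow> (nat \<Rightarrow> 'a) set \<Rightarrow> ((nat \<Rightarrow> 'a) \<Rightarrow> nat \<Rightarrow> 'a) \<Rightarrow> bool" where
  "definable_continuous_map F m n X Y f \<longleftrightarrow>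
     definable_map F m n X Y f \<and> continuous_map (rel_topology m X) (rel_topology n Y) f"

definition definably_proper_map ::
  "('a::{linordered_field, linorder_topology}, 'f, 'r) expansion \<Rightarrow> nat \<Rightarrow> nat \<Rightarrow>
     (nat \<Rightarrow> 'a) set \<Rightarrow> (nat \<Rightarrow> 'a) set \<Rightarrow> ((nat \<Rightarrow> 'a) \<Rightarrow> nat \<Rightarrow> 'a) \<Rightarrow> bool" where
  "definably_proper_map F m n X Y f \<longleftrightarrow>
     definable_continuous_map F m n X Y f \<and>
     (\<forall>K. K \<subseteq> Y \<and> definably_compact F n K \<longrightarrow> definably_compact F m {x \<in> X. f x \<in> K})"

definition definably_identifying_map ::
  "('a::{linordered_field, linorder_topology}, 'f, 'r) expansion \<Rightarrow> nat \<Rightarrow> nat \<Rightarrow>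
     (nat \<Rightarrow> 'a) set \<Rightarrow> (nat \<Rightarrow> 'a) set \<Rightarrow> ((nat \<Rightarrow> 'a) \<Rightarrow> nat \<Rightarrow> 'a) \<Rightarrow> bool" where
  "definably_identifying_map F m n X Y f \<longleftrightarrow>
     definable_continuous_map F m n X Y f \<and> f ` X = Y \<and>
     (\<forall>K. K \<subseteq> Y \<and> definable F n K \<and> closedin (rel_topology m X) {x \<in> X. f x \<in> K} \<longrightarrow>
        closedin (rel_topology n Y) K)"

definition definable_quotient ::
  "('a::{linordered_field, linorder_topology}, 'f, 'r) expansion \<Rightarrow> nat \<Rightarrow> (nat \<Rightarrow> 'a) set \<Rightarrow>
     ((nat \<Rightarrow> 'a) \<times> (nat \<Rightarrow> 'a)) set \<Rightarrow> nat \<Rightarrow> (nat \<Rightarrow> 'a) set \<Rightarrow>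
     ((nat \<Rightarrow> 'a) \<Rightarrow> nat \<Rightarrow> 'a) \<Rightarrow> bool" where
  "definable_quotient F m X E n Y f \<longleftrightarrow>
     definable_equiv F m X E \<and> definably_identifying_map F m n X Y f \<and>
     (\<forall>x\<in>X. \<forall>x'\<in>X. f x = f x' \<longleftrightarrow> (x, x') \<in> E)"

section \<open>Hypotheses on the structure\<close>

text \<open>The type \<open>'a extended\<close> is $F \cup \{\pm\infty\}$.\<close>

definition definably_complete :: "('a::linordered_field, 'f, 'r) expansion \<Rightarrow> bool" where
  "definably_complete F \<longleftrightarrow>
     (\<forall>D. definable1 F D \<longrightarrow>
        (\<exists>s :: 'a extended. (\<forall>x\<in>D. Fin x \<le> s) \<and> (\<forall>u. (\<forall>x\<in>D. Fin x \<le> u) \<longrightarrow> s \<le> u)) \<and>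
        (\<exists>s :: 'a extended. (\<forall>x\<in>D. s \<le> Fin x) \<and> (\<forall>u. (\<forall>x\<in>D. u \<le> Fin x) \<longrightarrow> u \<le> s)))"

text \<open>The coordinate projection $F^{m+n} \to F^m$ that keeps the coordinates $\sigma(0) < \dots < \sigma(m-1)$.\<close>

definition coord_proj :: "nat \<Rightarrow> (nat \<Rightarrow> nat) \<Rightarrow> (nat \<Rightarrow> 'a) \<Rightarrow> nat \<Rightarrow> 'a" where
  "coord_proj m \<sigma> z = (\<lambda>i\<in>{..<m}. z (\<sigma> i))"

definition definable_choice :: "('a::linordered_field, 'f, 'r) expansion \<Rightarrow> bool" where
  "definable_choice F \<longleftrightarrow>
     (\<forall>m n \<sigma> X Y.
        strict_mono_on {..<m} \<sigma> \<and> \<sigma> ` {..<m} \<subseteq> {..<m+n} \<and>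
        definable F m X \<and> definable F (m + n) Y \<and> coord_proj m \<sigma> ` Y = X \<longrightarrow>
        (\<exists>\<phi>. definable_map F m (m + n) X Y \<phi> \<and> (\<forall>x\<in>X. coord_proj m \<sigma> (\<phi> x) = x))) \<and>
     (\<forall>m X E. definable_equiv F m X E \<longrightarrow>
        (\<exists>S\<subseteq>X. definable F m S \<and> (\<forall>C \<in> X // E. \<exists>!s. s \<in> S \<inter> C)))"

definition limit_set :: "nat \<Rightarrow> 'a::linordered_field set \<Rightarrow> ('a \<Rightarrow> nat \<Rightarrow> 'a) \<Rightarrow> (nat \<Rightarrow> 'a) set" where
  "limit_set n D \<gamma> =
     {p \<in> tuples n. \<forall>a b c d. p \<in> open_box n a b \<and> 0 \<in> {c<..<d} \<longrightarrow>
        {t \<in> D. \<gamma> t \<in> open_box n a b} \<inter> {c<..<d} \<noteq> {}}"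

definition good_pseudo_filter ::
  "('a::{linordered_field, linorder_topology}, 'f, 'r) expansion \<Rightarrow> 'a set set \<Rightarrow> bool" where
  "good_pseudo_filter F \<DD> \<longleftrightarrow>
     \<DD> \<noteq> {} \<and> (\<forall>D\<in>\<DD>. definable1 F D \<and> D \<subseteq> {0<..} \<and> 0 \<in> closure D) \<and>
     (\<forall>D\<in>\<DD>. bdd_above D \<and> bdd_below D \<and> closure D = D \<union> {0}) \<and>
     (\<forall>D\<in>\<DD>. \<forall>D1 D2. definable1 F D1 \<and> definable1 F D2 \<and> D = D1 \<union> D2 \<longrightarrow>
        (\<exists>D'\<in>\<DD>. D' \<subseteq> D1) \<or> (\<exists>D'\<in>\<DD>. D' \<subseteq> D2)) \<and>
     (\<forall>D\<in>\<DD>. \<forall>n \<gamma>. definable_curve F n D \<gamma> \<longrightarrow>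
        (\<exists>D'\<in>\<DD>. D' \<subseteq> D \<and> continuous_map (top_of_set D') (tuple_topology n) \<gamma>) \<and>
        (limit_set n D \<gamma> \<noteq> {} \<longrightarrow>
           (\<exists>D'\<in>\<DD>. D' \<subseteq> D \<and> continuous_map (top_of_set D') (tuple_topology n) \<gamma> \<and>
              is_singleton (limit_set n D' \<gamma>))))"

text \<open>
  The ordered set $\mathcal{E}_n$ is \<open>\<E> n\<close> with the order of \<open>'e\<close> (any sequence of linearly ordered
  sets embeds in a single one), and \<open>None\<close>, which is below every \<open>Some e\<close>, plays the role of
  $-\infty$.  The condition on open subsets is imposed for nonempty \<open>X\<close> only: for
  $X = Y = \emptyset$ it would require a rank below $-\infty$, so nothing would satisfy it.
\<close>

definition good_extended_rank ::
  "('a::{linordered_field, linorder_topology}, 'f, 'r) expansion \<Rightarrow> (nat \<Rightarrow> 'e::linorder set) \<Rightarrow>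
     (nat \<Rightarrow> (nat \<Rightarrow> 'a) set \<Rightarrow> 'e option) \<Rightarrow> bool" where
  "good_extended_rank F \<E> eRank \<longleftrightarrow>
     (\<forall>n.
        (\<forall>X. definable F n X \<longrightarrow> eRank n X \<in> Some ` \<E> n \<union> {None}) \<and>
        (\<exists>e\<in>\<E> n. \<forall>e'\<in>\<E> n. e \<le> e') \<and>
        (\<forall>X. definable F n X \<longrightarrow> (eRank n X = None \<longleftrightarrow> X = {})) \<and>
        (\<nexists>s :: nat \<Rightarrow> 'e. (\<forall>i. s i \<in> \<E> n) \<and> (\<forall>i. s (Suc i) < s i)) \<and>
        (\<forall>A B. definable F n A \<and> definable F n B \<longrightarrow>
           eRank n (A \<union> B) = max (eRank n A) (eRank n B)) \<and>
        (\<forall>X Y. definable F n X \<and> definable F n Y \<and> X \<subseteq> Y \<and> X \<noteq> {} \<and> eRank n X = eRank n Y \<longrightarrow>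
           (\<exists>U. definable F n U \<and> U \<subseteq> X \<and> openin (rel_topology n Y) U \<and>
              eRank n (X - U) < eRank n Y)) \<and>
        (\<forall>X e. definable F n X \<and> X \<noteq> {} \<and> e \<in> \<E> n \<and> (\<forall>e'\<in>\<E> n. e \<le> e') \<and>
           eRank n X = Some e \<longrightarrow> rel_topology n X = discrete_topology X))"

section \<open>Definable groups and actions\<close>

definition definable_group ::
  "('a::{linordered_field, linorder_topology}, 'f, 'r) expansion \<Rightarrow> nat \<Rightarrow>
     (nat \<Rightarrow> 'a) monoid \<Rightarrow> bool" where
  "definable_group F k G \<longleftrightarrow>
     group G \<and> definable F k (carrier G) \<and>
     definable_continuous_map F (k + k) k (tprod k k (carrier G) (carrier G)) (carrier G)
       (\<lambda>z. tfst k z \<otimes>\<^bsub>G\<^esub> tsnd k k z) \<and>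
     definable_continuous_map F k k (carrier G) (carrier G) (\<lambda>g. inv\<^bsub>G\<^esub> g)"

definition definable_G_set ::
  "('a::{linordered_field, linorder_topology}, 'f, 'r) expansion \<Rightarrow> nat \<Rightarrow> (nat \<Rightarrow> 'a) monoid \<Rightarrow>
     nat \<Rightarrow> (nat \<Rightarrow> 'a) set \<Rightarrow> ((nat \<Rightarrow> 'a) \<Rightarrow> (nat \<Rightarrow> 'a) \<Rightarrow> nat \<Rightarrow> 'a) \<Rightarrow> bool" where
  "definable_G_set F k G m X \<phi> \<longleftrightarrow>
     definable F m X \<and> group_action G X \<phi> \<and>
     definable_continuous_map F (k + m) m (tprod k m (carrier G) X) X
       (\<lambda>z. \<phi> (tfst k z) (tsnd k m z))"

definition definably_proper_action ::
  "('a::{linordered_field, linorder_topology}, 'f, 'r) expansion \<Rightarrow> nat \<Rightarrow> (nat \<Rightarrow> 'a) monoid \<Rightarrow>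
     nat \<Rightarrow> (nat \<Rightarrow> 'a) set \<Rightarrow> ((nat \<Rightarrow> 'a) \<Rightarrow> (nat \<Rightarrow> 'a) \<Rightarrow> nat \<Rightarrow> 'a) \<Rightarrow> bool" where
  "definably_proper_action F k G m X \<phi> \<longleftrightarrow>
     definably_proper_map F (k + m) (m + m) (tprod k m (carrier G) X) (tprod m m X X)
       (\<lambda>z. tjoin m m (tsnd k m z) (\<phi> (tfst k z) (tsnd k m z)))"

definition orbit_relation ::
  "(nat \<Rightarrow> 'a) monoid \<Rightarrow> (nat \<Rightarrow> 'a) set \<Rightarrow> ((nat \<Rightarrow> 'a) \<Rightarrow> (nat \<Rightarrow> 'a) \<Rightarrow> nat \<Rightarrow> 'a) \<Rightarrow>
     ((nat \<Rightarrow> 'a) \<times> (nat \<Rightarrow> 'a)) set" where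
  "orbit_relation G X \<phi> = {(x, \<phi> g x) |g x. g \<in> carrier G \<and> x \<in> X}"

end

theory Submission
  imports Defs
begin

text \<open>
  Definable completeness makes projections of closed sets along bounded coordinates closed, so
  images of definably compact sets are closed; this is all the compactness that is needed.

  Let \<open>K\<^sub>c\<close> be the sublevel sets of a definably proper function on the locally closed set \<open>X\<close>.
  Properness of the action makes \<open>\<nu>(x) = inf {c. x \<in> G K\<^sub>c}\<close> a continuous invariant function, and
  the closed set of those \<open>x\<close> that lie in \<open>K\<^sub>c\<close> for all \<open>c > \<nu>(x) + 1\<close> meets every orbit;
  closed subsets of it have closed saturations.  The quotient map is \<open>\<nu>\<close> together with finitely
  many continuous invariant functions that separate the orbits, and \<open>\<nu>\<close> makes it identifying.

  The separating functions are found by induction on the rank of a closed subset \<open>Z\<close>.  Replace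
  \<open>Z\<close> by the closure \<open>T\<close> of a set \<open>S\<close> of representatives.  The rank axioms give a set
  \<open>U \<subseteq> S\<close> open in \<open>T\<close> such that \<open>T - U\<close> has smaller rank.  Functions that separate the orbits
  on \<open>T - U\<close> extend to its saturation and then, by Tietze's theorem, to \<open>T\<close>; the remaining points
  of \<open>T\<close> lie in distinct orbits and are separated by their coordinates.
\<close>

section \<open>Definability calculus\<close>

text \<open>The definably proper function is the larger of the max norm of \<open>x\<close> and the
  reciprocal of its distance to cl(X) - X.

  The saturation of a closed set can fail to be closed: points may leave every definably compact
  subset of \<open>X\<close> while their orbits converge. Points whose size exceeds the infimum over
  their orbit by at most 1 cannot do this, since continuity of \<nu> keeps them in one
  \<open>Kc c\<close> over a neighbourhood of an orbit. The slack 1 lets every orbit contain such a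
  point without knowing that the infimum is attained.

  The obstacle to separating orbits is that a definable set of representatives may fail to be
  closed, and its closure \<open>T\<close> can contain several points of one orbit. Since
  \<open>U\<close> consists of representatives, two distinct equivalent points of \<open>T\<close>
  never both lie in \<open>U\<close>, so all coincidences involve the closed set
  \<open>T - U\<close>. On its saturation the functions of the induction hypothesis do the work; off
  it every class meets \<open>T\<close> at most once, so that coordinates may serve as
  invariants.\<close>

primrec ren_trm :: "(nat \<Rightarrow> nat) \<Rightarrow> 'f trm \<Rightarrow> 'f trm" where
  "ren_trm \<rho> (Var v) = Var (\<rho> v)"
| "ren_trm \<rho> Zero = Zero"
| "ren_trm \<rho> One = One"
| "ren_trm \<rho> (Add s t) = Add (ren_trm \<rho> s) (ren_trm \<rho> t)"
| "ren_trm \<rho> (Mul s t) = Mul (ren_trm \<rho> s) (ren_trm \<rho> t)"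
| "ren_trm \<rho> (Fun f ts) = Fun f (map (ren_trm \<rho>) ts)"

primrec ren_fm :: "(nat \<Rightarrow> nat) \<Rightarrow> ('f, 'r) fm \<Rightarrow> ('f, 'r) fm" where
  "ren_fm \<rho> (Eq s t) = Eq (ren_trm \<rho> s) (ren_trm \<rho> t)"
| "ren_fm \<rho> (Less s t) = Less (ren_trm \<rho> s) (ren_trm \<rho> t)"
| "ren_fm \<rho> (Rel r ts) = Rel r (map (ren_trm \<rho>) ts)"
| "ren_fm \<rho> (Neg p) = Neg (ren_fm \<rho> p)"
| "ren_fm \<rho> (Conj p q) = Conj (ren_fm \<rho> p) (ren_fm \<rho> q)"
| "ren_fm \<rho> (Ex v p) = Ex (\<rho> v) (ren_fm \<rho> p)"

lemma eval_ren_trm: "eval_trm F e (ren_trm \<rho> t) = eval_trm F (e \<circ> \<rho>) t"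
proof (induction t)
  case (Fun f ts)
  then have "map (eval_trm F e \<circ> ren_trm \<rho>) ts = map (eval_trm F (e \<circ> \<rho>)) ts"
    by (auto simp: o_def)
  then show ?case by (metis eval_trm.simps(6) map_map ren_trm.simps(6))
qed auto

text \<open>Injectivity prevents capture: a renamed bound variable must stay different from every
  other renamed variable.\<close>

lemma sat_ren_fm: "inj \<rho> \<Longrightarrow> sat F e (ren_fm \<rho> p) = sat F (e \<circ> \<rho>) p"
proof (induction p arbitrary: e)
  case (Rel r ts)
  have "map (eval_trm F e \<circ> ren_trm \<rho>) ts = map (eval_trm F (e \<circ> \<rho>)) ts"
    by (auto simp: eval_ren_trm)
  then show ?case by (metis map_map ren_fm.simps(3) sat.simps(3))
next
  case (Ex v p)
  have "(e(\<rho> v := a)) \<circ> \<rho> = (e \<circ> \<rho>)(v := a)" for a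
    using Ex.prems by (auto simp: fun_eq_iff inj_eq)
  then show ?case by (simp only: ren_fm.simps sat.simps Ex.IH[OF Ex.prems])
qed (auto simp: eval_ren_trm)

abbreviation env :: "nat \<Rightarrow> (nat \<Rightarrow> 'a) \<Rightarrow> (nat \<Rightarrow> 'a) \<Rightarrow> nat \<Rightarrow> 'a" where
  "env n x e \<equiv> (\<lambda>i. if i < n then x i else e i)"

text \<open>With predicates in place of sets, definability is proved by one rule for each connective
  and quantifier, without writing formulas.\<close>

definition dpred ::
  "('a::linordered_field, 'f, 'r) expansion \<Rightarrow> nat \<Rightarrow> ((nat \<Rightarrow> 'a) \<Rightarrow> bool) \<Rightarrow> bool" where
  "dpred F n P \<longleftrightarrow> definable F n {x \<in> tuples n. P x}"

lemma dpred_iff: "dpred F n P \<longleftrightarrow> (\<exists>p e. \<forall>x\<in>tuples n. P x \<longleftrightarrow> sat F (env n x e) p)"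
  unfolding dpred_def definable_def by blast

lemma dpred_cong: "(\<And>x. x \<in> tuples n \<Longrightarrow> P x = Q x) \<Longrightarrow> dpred F n P = dpred F n Q"
  by (simp add: dpred_iff)

lemma dpredI: "(\<And>x. x \<in> tuples n \<Longrightarrow> P x \<longleftrightarrow> sat F (env n x e) p) \<Longrightarrow> dpred F n P"
  by (auto simp: dpred_iff)

section \<open>Tuples, their concatenation and projections\<close>

lemma tuples_iff: "x \<in> tuples n \<longleftrightarrow> (\<forall>i\<ge>n. x i = undefined)"
  by (auto simp: tuples_def PiE_def extensional_def)

lemma tuples_eqI:
  assumes "x \<in> tuples n" "y \<in> tuples n" "\<And>i. i < n \<Longrightarrow> x i = y i"
  shows "x = y"
proof
  show "x i = y i" for i using assms by (cases "i < n") (auto simp: tuples_iff)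
qed

lemma restrict_tuples [simp]: "restrict f {..<n} \<in> tuples n"
  by (auto simp: tuples_def)

lemma tfst_tuples [simp]: "tfst n x \<in> tuples n"
  by (simp add: tfst_def)

lemma tsnd_tuples [simp]: "tsnd n b x \<in> tuples b"
  by (simp add: tsnd_def)

lemma tjoin_tuples [simp]: "tjoin n b x y \<in> tuples (n + b)"
  by (simp add: tjoin_def)

lemma tfst_app [simp]: "i < n \<Longrightarrow> tfst n x i = x i"
  by (simp add: tfst_def)

lemma tsnd_app [simp]: "i < b \<Longrightarrow> tsnd n b x i = x (n + i)"
  by (simp add: tsnd_def)

lemma tjoin_app1 [simp]: "i < n \<Longrightarrow> tjoin n b x y i = x i"
  by (simp add: tjoin_def)

lemma tjoin_app2 [simp]: "i < b \<Longrightarrow> tjoin n b x y (n + i) = y i"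
  by (simp add: tjoin_def)

lemma tfst_tjoin [simp]: "x \<in> tuples n \<Longrightarrow> tfst n (tjoin n b x y) = x"
  by (rule tuples_eqI[where n = n]) auto

lemma tsnd_tjoin [simp]: "y \<in> tuples b \<Longrightarrow> tsnd n b (tjoin n b x y) = y"
  by (rule tuples_eqI[where n = b]) auto

lemma tjoin_tfst_tsnd [simp]: "z \<in> tuples (n + b) \<Longrightarrow> tjoin n b (tfst n z) (tsnd n b z) = z"
proof (rule tuples_eqI[where n = "n + b"])
  fix i assume "z \<in> tuples (n + b)" "i < n + b"
  then show "tjoin n b (tfst n z) (tsnd n b z) i = z i"
    by (cases "i < n") (auto simp: tjoin_def)
qed auto

lemma tfst_id [simp]: "x \<in> tuples n \<Longrightarrow> tfst n x = x"
  by (rule tuples_eqI[where n = n]) auto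

lemma tfst_upd [simp]: "x \<in> tuples n \<Longrightarrow> tfst n (x(n := a)) = x"
  by (rule tuples_eqI[where n = n]) auto

lemma upd_tuples [simp]: "x \<in> tuples n \<Longrightarrow> x(n := a) \<in> tuples (Suc n)"
  by (auto simp: tuples_iff)

lemma tfst_upd_id: "z \<in> tuples (Suc n) \<Longrightarrow> (tfst n z)(n := z n) = z"
  by (rule tuples_eqI[where n = "Suc n"]) (auto simp: less_Suc_eq)

section \<open>Closure of definable predicates under logical operations\<close>

lemma dpred_neg: "dpred F n P \<Longrightarrow> dpred F n (\<lambda>x. \<not> P x)"
  unfolding dpred_iff by (metis sat.simps(4))

lemma dpred_const: "dpred F n (\<lambda>x. c)"
proof -
  have "dpred F n (\<lambda>x. True)" by (rule dpredI[where p = "Eq Zero Zero"]) simp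
  moreover have "dpred F n (\<lambda>x. False)" by (rule dpredI[where p = "Less Zero Zero"]) simp
  ultimately show ?thesis by (cases c) auto
qed

text \<open>The parameters of the two formulas are interleaved.\<close>

lemma dpred_conj:
  assumes "dpred F n P" "dpred F n Q"
  shows "dpred F n (\<lambda>x. P x \<and> Q x)"
proof -
  obtain p e where p: "\<And>x. x \<in> tuples n \<Longrightarrow> P x = sat F (env n x e) p"
    using assms(1) unfolding dpred_iff by blast
  obtain q d where q: "\<And>x. x \<in> tuples n \<Longrightarrow> Q x = sat F (env n x d) q"
    using assms(2) unfolding dpred_iff by blast
  define r1 where "r1 i = (if i < n then i else n + 2 * (i - n))" for i
  define r2 where "r2 i = (if i < n then i else n + 2 * (i - n) + 1)" for i
  define c where "c j = (if even (j - n) then e (n + (j - n) div 2) else d (n + (j - n) div 2))" for j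
  have "inj r1" "inj r2" unfolding inj_def r1_def r2_def by (auto split: if_splits)
  have e1: "env n x c \<circ> r1 = env n x e" for x by (auto simp: r1_def c_def fun_eq_iff)
  have e2: "env n x c \<circ> r2 = env n x d" for x by (auto simp: r2_def c_def fun_eq_iff)
  show ?thesis
  proof (rule dpredI[where e = c and p = "Conj (ren_fm r1 p) (ren_fm r2 q)"])
    fix x :: "nat \<Rightarrow> 'a" assume x: "x \<in> tuples n"
    show "(P x \<and> Q x) = sat F (env n x c) (Conj (ren_fm r1 p) (ren_fm r2 q))"
      by (simp add: sat_ren_fm[OF \<open>inj r1\<close>] sat_ren_fm[OF \<open>inj r2\<close>] e1 e2 p[OF x] q[OF x])
  qed
qed

lemma dpred_disj:
  assumes "dpred F n P" "dpred F n Q"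
  shows "dpred F n (\<lambda>x. P x \<or> Q x)"
  using dpred_neg[OF dpred_conj[OF dpred_neg[OF assms(1)] dpred_neg[OF assms(2)]]] by simp

lemma dpred_imp:
  assumes "dpred F n P" "dpred F n Q"
  shows "dpred F n (\<lambda>x. P x \<longrightarrow> Q x)"
  using dpred_disj[OF dpred_neg[OF assms(1)] assms(2)] by (simp only: imp_conv_disj)

lemma dpred_ball_less:
  assumes "\<And>i. i < (k::nat) \<Longrightarrow> dpred F n (P i)"
  shows "dpred F n (\<lambda>x. \<forall>i<k. P i x)"
  using assms
proof (induction k)
  case 0
  then show ?case by (simp add: dpred_const)
next
  case (Suc k)
  then show ?case by (simp add: All_less_Suc dpred_conj)
qed

lemma dpred_bex_less:
  assumes "\<And>i. i < (k::nat) \<Longrightarrow> dpred F n (P i)"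
  shows "dpred F n (\<lambda>x. \<exists>i<k. P i x)"
  using dpred_neg[OF dpred_ball_less[of k F n "\<lambda>i x. \<not> P i x", OF dpred_neg[OF assms]]] by simp

text \<open>The coordinate that is quantified is the variable \<open>n\<close>. The quantifier
  overwrites whatever \<open>e\<close> assigns to it, so the parameters stay in place.\<close>

lemma dpred_ex_upd:
  assumes "dpred F (Suc n) P"
  shows "dpred F n (\<lambda>x. \<exists>a. P (x(n := a)))"
proof -
  obtain p e where p: "\<And>x. x \<in> tuples (Suc n) \<Longrightarrow> P x = sat F (env (Suc n) x e) p"
    using assms unfolding dpred_iff by blast
  show ?thesis
  proof (rule dpredI[where e = e and p = "Ex n p"])
    fix x :: "nat \<Rightarrow> 'a" assume x: "x \<in> tuples n"
    have "(env n x e)(n := a) = env (Suc n) (x(n := a)) e" for a by (auto simp: fun_eq_iff)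
    then show "(\<exists>a. P (x(n := a))) = sat F (env n x e) (Ex n p)" by (simp add: p x)
  qed
qed

lemma dpred_reindex_inj:
  assumes "dpred F n P" "inj_on \<sigma> {..<n}" "\<sigma> ` {..<n} \<subseteq> {..<N}"
  shows "dpred F N (\<lambda>z. P (\<lambda>i\<in>{..<n}. z (\<sigma> i)))"
proof -
  obtain p e where p: "\<And>x. x \<in> tuples n \<Longrightarrow> P x = sat F (env n x e) p"
    using assms(1) unfolding dpred_iff by blast
  \<comment> \<open>Parameters begin at \<open>n\<close> before the renaming and at \<open>N\<close>
    after it; sending them beyond the range of \<sigma> makes \<open>r\<close> injective.\<close>
  define r where "r i = (if i < n then \<sigma> i else i - n + N)" for i
  define c where "c j = e (j - N + n)" for j
  have s: "\<sigma> i < N" if "i < n" for i using assms(3) that by auto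
  have "inj r"
  proof (rule injI)
    fix i j assume "r i = r j"
    then show "i = j" using assms(2) s[of i] s[of j]
      by (auto simp: r_def inj_on_def split: if_splits)
  qed
  have c: "env N z c \<circ> r = env n (\<lambda>i\<in>{..<n}. z (\<sigma> i)) e" for z
    using s by (auto simp: r_def c_def fun_eq_iff)
  show ?thesis
    by (rule dpredI[where e = c and p = "ren_fm r p"])
      (simp only: sat_ren_fm[OF \<open>inj r\<close>] c, rule p, simp)
qed

lemma dpred_ex_tjoin:
  assumes "dpred F (n + b) P"
  shows "dpred F n (\<lambda>x. \<exists>y\<in>tuples b. P (tjoin n b x y))"
  using assms
proof (induction b arbitrary: P)
  case 0
  have "dpred F n P" using 0 by simp
  then show ?case
  proof (rule iffD1[OF dpred_cong, rotated])
    fix x :: "nat \<Rightarrow> 'a" assume "x \<in> tuples n"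
    then have "tjoin n 0 x y = x" for y :: "nat \<Rightarrow> 'a"
      by (intro tuples_eqI[where n = n]) (use tjoin_tuples[of n 0 x y] in auto)
    moreover have "(\<lambda>_. undefined) \<in> tuples 0" by (auto simp: tuples_iff)
    ultimately show "P x = (\<exists>y\<in>tuples 0. P (tjoin n 0 x y))" by auto
  qed
next
  case (Suc b)
  have "dpred F (n + b) (\<lambda>x. \<exists>a. P (x(n + b := a)))"
    using Suc.prems by (intro dpred_ex_upd) simp
  from Suc.IH[OF this] show ?case
  proof (rule iffD1[OF dpred_cong, rotated])
    fix x :: "nat \<Rightarrow> 'a" assume x: "x \<in> tuples n"
    have 1: "(tjoin n b x y)(n + b := a) = tjoin n (Suc b) x (y(b := a))" for y a
      by (auto simp: tjoin_def fun_eq_iff less_Suc_eq)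
    have 2: "\<exists>y'\<in>tuples b. \<exists>a. y = y'(b := a)" if "y \<in> tuples (Suc b)" for y :: "nat \<Rightarrow> 'a"
      using tfst_upd_id[OF that] by (metis tfst_tuples)
    show "(\<exists>y\<in>tuples b. \<exists>a. P ((tjoin n b x y)(n + b := a))) =
        (\<exists>y\<in>tuples (Suc b). P (tjoin n (Suc b) x y))"
      unfolding 1 using 2 upd_tuples by metis
  qed
qed

text \<open>Without injectivity the formula itself cannot be renamed. Instead fresh variables
  \<open>N + i\<close> are inserted, equated with the variables \<open>\<sigma> i\<close>, and
  quantified away.\<close>

lemma dpred_reindex:
  assumes "dpred F n P" "\<And>i. i < n \<Longrightarrow> \<sigma> i < N"
  shows "dpred F N (\<lambda>z. P (\<lambda>i\<in>{..<n}. z (\<sigma> i)))"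
proof -
  have "dpred F (N + n) (\<lambda>z. P (\<lambda>i\<in>{..<n}. z (N + i)))"
    using assms(1) by (rule dpred_reindex_inj) auto
  moreover have "dpred F (N + n) (\<lambda>z. \<forall>i<n. z (N + i) = z (\<sigma> i))"
  proof (rule dpred_ball_less)
    fix i assume "i < n"
    then show "dpred F (N + n) (\<lambda>z. z (N + i) = z (\<sigma> i))"
      using assms(2)[of i] by (intro dpredI[where p = "Eq (Var (N + i)) (Var (\<sigma> i))"]) auto
  qed
  ultimately have "dpred F N (\<lambda>x. \<exists>y\<in>tuples n. P (\<lambda>i\<in>{..<n}. tjoin N n x y (N + i)) \<and>
      (\<forall>i<n. tjoin N n x y (N + i) = tjoin N n x y (\<sigma> i)))"
    by (intro dpred_ex_tjoin dpred_conj)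
  then show ?thesis
  proof (rule iffD1[OF dpred_cong, rotated])
    fix x :: "nat \<Rightarrow> 'a" assume x: "x \<in> tuples N"
    have "(\<forall>i<n. y i = x (\<sigma> i)) \<longleftrightarrow> y = (\<lambda>i\<in>{..<n}. x (\<sigma> i))" if "y \<in> tuples n" for y
      using that by (auto intro: tuples_eqI[where n = n])
    moreover have "(\<lambda>i\<in>{..<n}. tjoin N n x y (N + i)) = y" if "y \<in> tuples n" for y
      using that by (auto intro: tuples_eqI[where n = n])
    ultimately show "(\<exists>y\<in>tuples n. P (\<lambda>i\<in>{..<n}. tjoin N n x y (N + i)) \<and>
      (\<forall>i<n. tjoin N n x y (N + i) = tjoin N n x y (\<sigma> i))) = P (\<lambda>i\<in>{..<n}. x (\<sigma> i))"
      using assms(2) by auto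
  qed
qed

text \<open>The value is the last coordinate of the graph. Functions are total on
  \<open>tuples n\<close>; a function on a smaller set gets a default value elsewhere, so that no
  domains have to be carried along.\<close>

definition dscal ::
  "('a::linordered_field, 'f, 'r) expansion \<Rightarrow> nat \<Rightarrow> ((nat \<Rightarrow> 'a) \<Rightarrow> 'a) \<Rightarrow> bool" where
  "dscal F n t \<longleftrightarrow> dpred F (Suc n) (\<lambda>z. z n = t (tfst n z))"

definition dvec ::
  "('a::linordered_field, 'f, 'r) expansion \<Rightarrow> nat \<Rightarrow> nat \<Rightarrow> ((nat \<Rightarrow> 'a) \<Rightarrow> nat \<Rightarrow> 'a) \<Rightarrow> bool" where
  "dvec F n k u \<longleftrightarrow> u \<in> tuples n \<rightarrow> tuples k \<and> (\<forall>i<k. dscal F n (\<lambda>z. u z i))"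

lemma dscal_weaken:
  assumes "dscal F n t"
  shows "dscal F (n + b) (\<lambda>z. t (tfst n z))"
proof -
  have "dpred F (Suc (n + b)) (\<lambda>z. (\<lambda>w. w n = t (tfst n w))
      (\<lambda>i\<in>{..<Suc n}. z (if i < n then i else n + b)))"
    using assms unfolding dscal_def by (rule dpred_reindex) auto
  moreover have "tfst n (\<lambda>i\<in>{..<Suc n}. z (if i < n then i else n + b)) = tfst n (tfst (n + b) z)"
    for z :: "nat \<Rightarrow> 'a" by (rule tuples_eqI[where n = n]) auto
  ultimately show ?thesis by (simp add: dscal_def)
qed

text \<open>\<open>P (u z)\<close> is read as the existence of a tuple \<open>y\<close> with
  \<open>P y\<close> whose coordinates are those of \<open>u z\<close>.\<close>

lemma dpred_subst:
  assumes "dpred F k P" "dvec F n k u"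
  shows "dpred F n (\<lambda>z. P (u z))"
proof -
  have "dpred F (n + k) (\<lambda>z. P (\<lambda>i\<in>{..<k}. z (n + i)))"
    using assms(1) by (rule dpred_reindex) auto
  moreover have "dpred F (n + k) (\<lambda>z. \<forall>i<k. z (n + i) = u (tfst n z) i)"
  proof (rule dpred_ball_less)
    fix i assume i: "i < k"
    then have "dpred F (Suc n) (\<lambda>z. z n = u (tfst n z) i)"
      using assms(2) by (auto simp: dvec_def dscal_def)
    from dpred_reindex[OF this, of "\<lambda>j. if j < n then j else n + i" "n + k"]
    have "dpred F (n + k) (\<lambda>z. z (n + i) =
        u (tfst n (\<lambda>j\<in>{..<Suc n}. z (if j < n then j else n + i))) i)"
      using i by simp
    moreover have "tfst n (\<lambda>j\<in>{..<Suc n}. z (if j < n then j else n + i)) = tfst n z"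
      for z :: "nat \<Rightarrow> 'a" by (rule tuples_eqI[where n = n]) auto
    ultimately show "dpred F (n + k) (\<lambda>z. z (n + i) = u (tfst n z) i)" by simp
  qed
  ultimately have "dpred F n (\<lambda>x. \<exists>y\<in>tuples k. P (\<lambda>i\<in>{..<k}. tjoin n k x y (n + i)) \<and>
      (\<forall>i<k. tjoin n k x y (n + i) = u (tfst n (tjoin n k x y)) i))"
    by (intro dpred_ex_tjoin dpred_conj)
  then show ?thesis
  proof (rule iffD1[OF dpred_cong, rotated])
    fix x :: "nat \<Rightarrow> 'a" assume x: "x \<in> tuples n"
    then have ux: "u x \<in> tuples k" using assms(2) by (auto simp: dvec_def)
    have "(\<forall>i<k. y i = u x i) \<longleftrightarrow> y = u x" if "y \<in> tuples k" for y
      using that ux by (auto intro: tuples_eqI[where n = k])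
    moreover have "(\<lambda>i\<in>{..<k}. tjoin n k x y (n + i)) = y" if "y \<in> tuples k" for y
      using that by (auto intro: tuples_eqI[where n = k])
    ultimately show "(\<exists>y\<in>tuples k. P (\<lambda>i\<in>{..<k}. tjoin n k x y (n + i)) \<and>
      (\<forall>i<k. tjoin n k x y (n + i) = u (tfst n (tjoin n k x y)) i)) = P (u x)"
      using x ux by auto
  qed
qed

lemma dscal_var: "i < n \<Longrightarrow> dscal F n (\<lambda>z. z i)"
  unfolding dscal_def by (rule dpredI[where p = "Eq (Var n) (Var i)"]) simp

text \<open>The constant is a parameter, held by the first variable after the value coordinate
  \<open>n\<close>.\<close>

lemma dscal_const: "dscal F n (\<lambda>z. c)"
  unfolding dscal_def
  by (rule dpredI[where p = "Eq (Var n) (Var (Suc n))" and e = "\<lambda>_. c"]) simp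

lemma dvec_self: "dvec F n n (\<lambda>z. z)"
  by (auto simp: dvec_def dscal_var)

lemma dvecI:
  "(\<And>i. i < k \<Longrightarrow> dscal F n (\<lambda>z. u z i)) \<Longrightarrow> (\<And>z. z \<in> tuples n \<Longrightarrow> u z \<in> tuples k) \<Longrightarrow> dvec F n k u"
  by (auto simp: dvec_def)

lemma dscal_subst:
  assumes "dscal F k t" "dvec F n k u"
  shows "dscal F n (\<lambda>z. t (u z))"
proof -
  \<comment> \<open>\<open>v\<close> applies \<open>u\<close> and carries the value coordinate
    along, so the graph of the composition is the preimage under \<open>v\<close> of the graph of
    \<open>t\<close>.\<close>
  define v where "v z = (u (tfst n z))(k := z n)" for z :: "nat \<Rightarrow> 'a"
  have u: "u z \<in> tuples k" if "z \<in> tuples n" for z using assms(2) that by (auto simp: dvec_def)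
  have "dvec F (Suc n) (Suc k) v"
  proof (rule dvecI)
    fix i assume "i < Suc k"
    show "dscal F (Suc n) (\<lambda>z. v z i)"
    proof (cases "i = k")
      case True
      then show ?thesis by (simp add: v_def dscal_var)
    next
      case False
      then have "dscal F n (\<lambda>z. u z i)" using \<open>i < Suc k\<close> assms(2) by (auto simp: dvec_def)
      from dscal_weaken[OF this, of 1] False show ?thesis by (simp add: v_def)
    qed
  qed (auto simp: v_def u)
  from dpred_subst[OF assms(1)[unfolded dscal_def] this]
  have "dpred F (Suc n) (\<lambda>z. v z k = t (tfst k (v z)))" .
  then show ?thesis unfolding dscal_def
    by (rule iffD1[OF dpred_cong, rotated]) (simp add: v_def u)
qed

lemma dvec_subst:
  assumes "dvec F k l u" "dvec F n k v"
  shows "dvec F n l (\<lambda>z. u (v z))"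
proof (rule dvecI)
  fix i assume "i < l"
  then have "dscal F k (\<lambda>z. u z i)" using assms(1) by (simp add: dvec_def)
  from dscal_subst[OF this assms(2)] show "dscal F n (\<lambda>z. u (v z) i)" .
qed (use assms in \<open>auto simp: dvec_def\<close>)

lemma dvec_tfst: "dvec F n (a + b) u \<Longrightarrow> dvec F n a (\<lambda>z. tfst a (u z))"
  by (auto simp: dvec_def)

lemma dvec_tfst_Suc: "dvec F n (Suc a) u \<Longrightarrow> dvec F n a (\<lambda>z. tfst a (u z))"
  by (auto simp: dvec_def)

lemma dvec_tsnd: "dvec F n (a + b) u \<Longrightarrow> dvec F n b (\<lambda>z. tsnd a b (u z))"
  by (auto simp: dvec_def)

lemma dvec_tjoin:
  assumes "dvec F n a u" "dvec F n b v"
  shows "dvec F n (a + b) (\<lambda>z. tjoin a b (u z) (v z))"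
proof (rule dvecI)
  fix i assume "i < a + b"
  then show "dscal F n (\<lambda>z. tjoin a b (u z) (v z) i)"
    using assms by (cases "i < a") (auto simp: dvec_def tjoin_def)
qed simp

lemma dscal_app: "dvec F n k u \<Longrightarrow> i < k \<Longrightarrow> dscal F n (\<lambda>z. u z i)"
  by (simp add: dvec_def)

lemma dvec_const: "c \<in> tuples k \<Longrightarrow> dvec F n k (\<lambda>z. c)"
  by (auto simp: dvec_def dscal_const)

text \<open>A binary operation or relation then has to be treated on two variables only;
  substitution does the rest.\<close>

lemma dvec_two: "dscal F n s \<Longrightarrow> dscal F n t \<Longrightarrow> dvec F n 2 (\<lambda>z. \<lambda>i\<in>{..<2}. if i = 0 then s z else t z)"
  by (rule dvecI) (auto simp: less_2_cases_iff)

lemma dscal_add: "dscal F n s \<Longrightarrow> dscal F n t \<Longrightarrow> dscal F n (\<lambda>z. s z + t z)"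
proof -
  assume st: "dscal F n s" "dscal F n t"
  have "dscal F 2 (\<lambda>z. z 0 + z 1)" unfolding dscal_def
    by (rule dpredI[where p = "Eq (Var 2) (Add (Var 0) (Var 1))"]) (simp add: tfst_def)
  from dscal_subst[OF this dvec_two[OF st]] show ?thesis by simp
qed

lemma dscal_mult: "dscal F n s \<Longrightarrow> dscal F n t \<Longrightarrow> dscal F n (\<lambda>z. s z * t z)"
proof -
  assume st: "dscal F n s" "dscal F n t"
  have "dscal F 2 (\<lambda>z. z 0 * z 1)" unfolding dscal_def
    by (rule dpredI[where p = "Eq (Var 2) (Mul (Var 0) (Var 1))"]) (simp add: tfst_def)
  from dscal_subst[OF this dvec_two[OF st]] show ?thesis by simp
qed

lemma dscal_uminus: "dscal F n s \<Longrightarrow> dscal F n (\<lambda>z. - s z)"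
  using dscal_mult[OF dscal_const[of F n "-1"], of s] by simp

lemma dscal_diff: "dscal F n s \<Longrightarrow> dscal F n t \<Longrightarrow> dscal F n (\<lambda>z. s z - t z)"
  using dscal_add[of F n s "\<lambda>z. - t z"] dscal_uminus[of F n t] by simp

lemma dpred_less: "dscal F n s \<Longrightarrow> dscal F n t \<Longrightarrow> dpred F n (\<lambda>z. s z < t z)"
proof -
  assume st: "dscal F n s" "dscal F n t"
  have "dpred F 2 (\<lambda>z. z 0 < z 1)"
    by (rule dpredI[where p = "Less (Var 0) (Var 1)"]) simp
  from dpred_subst[OF this dvec_two[OF st]] show ?thesis by simp
qed

lemma dpred_le: "dscal F n s \<Longrightarrow> dscal F n t \<Longrightarrow> dpred F n (\<lambda>z. s z \<le> t z)"
  using dpred_neg[OF dpred_less[of F n t s]] by (simp add: not_less)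

lemma dpred_eq: "dscal F n s \<Longrightarrow> dscal F n t \<Longrightarrow> dpred F n (\<lambda>z. s z = t z)"
  using dpred_conj[OF dpred_le[of F n s t] dpred_le[of F n t s]] by (simp only: order_eq_iff)

lemma dpred_vec_eq:
  assumes "dvec F n k u" "dvec F n k v"
  shows "dpred F n (\<lambda>z. u z = v z)"
proof -
  have "dpred F n (\<lambda>z. \<forall>i<k. u z i = v z i)"
    using assms by (intro dpred_ball_less dpred_eq) (auto simp: dvec_def)
  then show ?thesis
    by (rule iffD1[OF dpred_cong, rotated]) (use assms in \<open>auto simp: dvec_def intro: tuples_eqI[where n = k]\<close>)
qed

text \<open>In the premise \<open>P\<close> is applied to the projections of one longer tuple.
  Backward application therefore produces a goal of the same kind, with one more variable.\<close>

lemma dpred_ex: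
  assumes "dpred F (Suc n) (\<lambda>z. P (tfst n z) (z n))"
  shows "dpred F n (\<lambda>x. \<exists>a. P x a)"
  using dpred_ex_upd[OF assms] by (rule iffD1[OF dpred_cong, rotated]) simp

lemma dpred_all:
  assumes "dpred F (Suc n) (\<lambda>z. P (tfst n z) (z n))"
  shows "dpred F n (\<lambda>x. \<forall>a. P x a)"
  using dpred_neg[OF dpred_ex[of F n "\<lambda>x a. \<not> P x a", OF dpred_neg[OF assms]]] by simp

lemma dpred_bex_tuples:
  assumes "dpred F (n + b) (\<lambda>z. P (tfst n z) (tsnd n b z))"
  shows "dpred F n (\<lambda>x. \<exists>y\<in>tuples b. P x y)"
  using dpred_ex_tjoin[OF assms] by (rule iffD1[OF dpred_cong, rotated]) simp

lemma definable_tuples: "definable F k Y \<Longrightarrow> Y \<subseteq> tuples k"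
  by (auto simp: definable_def)

lemma definable_iff_dpred: "definable F k Y \<longleftrightarrow> Y \<subseteq> tuples k \<and> dpred F k (\<lambda>x. x \<in> Y)"
proof -
  have "{x \<in> tuples k. x \<in> Y} = Y" if "Y \<subseteq> tuples k" using that by auto
  then show ?thesis unfolding dpred_def using definable_tuples by metis
qed

lemma dpred_mem: "definable F k Y \<Longrightarrow> dvec F n k u \<Longrightarrow> dpred F n (\<lambda>z. u z \<in> Y)"
  by (rule dpred_subst[where P = "\<lambda>x. x \<in> Y"]) (auto simp: definable_iff_dpred)

lemma dpred_bex:
  assumes "definable F b Y" "dpred F (n + b) (\<lambda>z. P (tfst n z) (tsnd n b z))"
  shows "dpred F n (\<lambda>x. \<exists>y\<in>Y. P x y)"
proof -
  have "dpred F n (\<lambda>x. \<exists>y\<in>tuples b. y \<in> Y \<and> P x y)"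
    by (intro dpred_bex_tuples dpred_conj assms(2) dpred_mem[OF assms(1)] dvec_tsnd dvec_self)
  then show ?thesis
    by (rule iffD1[OF dpred_cong, rotated]) (use definable_tuples[OF assms(1)] in auto)
qed

lemma dpred_ball:
  assumes "definable F b Y" "dpred F (n + b) (\<lambda>z. P (tfst n z) (tsnd n b z))"
  shows "dpred F n (\<lambda>x. \<forall>y\<in>Y. P x y)"
  using dpred_neg[OF dpred_bex[of F b Y n "\<lambda>x a. \<not> P x a", OF assms(1) dpred_neg[OF assms(2)]]] by simp

text \<open>A first-order characterization of the value replaces a term; inverses, infima and
  choices of representatives are treated in this way.\<close>

lemma dscal_graph:
  assumes "dpred F (Suc n) (\<lambda>z. R (tfst n z) (z n))"
    and "\<And>x a. x \<in> tuples n \<Longrightarrow> R x a \<longleftrightarrow> a = t x"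
  shows "dscal F n t"
  using assms(1) unfolding dscal_def by (rule iffD1[OF dpred_cong, rotated]) (simp add: assms(2))

lemma definable_subset_Collect: "definable F n Y \<Longrightarrow> dpred F n P \<Longrightarrow> definable F n {x \<in> Y. P x}"
  unfolding definable_iff_dpred using dpred_conj[of F n "\<lambda>x. x \<in> Y" P] by auto

lemma definable_Collect: "dpred F n P \<Longrightarrow> (\<And>x. P x \<Longrightarrow> x \<in> tuples n) \<Longrightarrow> definable F n {x. P x}"
  by (auto simp: definable_iff_dpred)

lemma definable_Int: "definable F n A \<Longrightarrow> definable F n B \<Longrightarrow> definable F n (A \<inter> B)"
  unfolding definable_iff_dpred using dpred_conj[of F n "\<lambda>x. x \<in> A" "\<lambda>x. x \<in> B"] by auto

lemma definable_Diff: "definable F n A \<Longrightarrow> definable F n B \<Longrightarrow> definable F n (A - B)"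
  unfolding definable_iff_dpred
  using dpred_conj[OF _ dpred_neg, of F n "\<lambda>x. x \<in> A" "\<lambda>x. x \<in> B"] by auto

lemmas dpred_intros = dpred_conj dpred_disj dpred_imp dpred_neg dpred_const dpred_ball_less
  dpred_bex_less dpred_less dpred_le dpred_eq dpred_ex dpred_all
  dscal_add dscal_mult dscal_diff dscal_uminus dscal_const
  dvec_tfst dvec_tfst_Suc dvec_tsnd dvec_self

lemma dscal_if:
  assumes "dpred F n P" "dscal F n s" "dscal F n t"
  shows "dscal F n (\<lambda>z. if P z then s z else t z)"
proof (rule dscal_graph[where R = "\<lambda>z a. (P z \<and> a = s z) \<or> (\<not> P z \<and> a = t z)"])
  have v: "dvec F (Suc n) n (tfst n)" by (intro dvec_tfst_Suc dvec_self)
  show "dpred F (Suc n) (\<lambda>z. P (tfst n z) \<and> z n = s (tfst n z) \<or> \<not> P (tfst n z) \<and> z n = t (tfst n z))"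
    by (intro dpred_intros dpred_subst[OF assms(1)] dscal_subst[OF assms(2)] dscal_subst[OF assms(3)]
        v dscal_var) auto
qed auto

lemma dscal_inverse:
  assumes "dscal F n t"
  shows "dscal F n (\<lambda>z. inverse (t z))"
\<comment> \<open>The first disjunct accounts for the convention that the inverse of 0 is 0.\<close>
proof (rule dscal_graph[where R = "\<lambda>z a. (t z = 0 \<and> a = 0) \<or> (\<not> t z = 0 \<and> a * t z = 1)"])
  have v: "dvec F (Suc n) n (tfst n)" by (intro dvec_tfst_Suc dvec_self)
  show "dpred F (Suc n) (\<lambda>z. t (tfst n z) = 0 \<and> z n = 0 \<or> \<not> t (tfst n z) = 0 \<and> z n * t (tfst n z) = 1)"
    by (intro dpred_intros dscal_subst[OF assms] v dscal_var) auto
  show "(t x = 0 \<and> a = 0) \<or> (\<not> t x = 0 \<and> a * t x = 1) \<longleftrightarrow> a = inverse (t x)" for x a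
    by (cases "t x = 0") (simp_all add: inverse_eq_divide nonzero_eq_divide_eq)
qed

lemma dscal_divide: "dscal F n s \<Longrightarrow> dscal F n t \<Longrightarrow> dscal F n (\<lambda>z. s z / t z)"
  using dscal_mult[of F n s "\<lambda>z. inverse (t z)"] dscal_inverse[of F n t] by (simp add: divide_inverse)

lemma dscal_abs: "dscal F n s \<Longrightarrow> dscal F n (\<lambda>z. \<bar>s z\<bar>)"
  unfolding abs_if by (intro dscal_if dpred_less dscal_uminus dscal_const)

section \<open>The topology of tuples\<close>

text \<open>The open ball of the max norm with radius in the field. For \<open>n = 0\<close> the
  condition is vacuous.\<close>

definition near :: "nat \<Rightarrow> (nat \<Rightarrow> 'a::linordered_field) \<Rightarrow> (nat \<Rightarrow> 'a) \<Rightarrow> 'a \<Rightarrow> bool" where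
  "near n x y r \<longleftrightarrow> (\<forall>i<n. \<bar>x i - y i\<bar> < r)"

text \<open>This notion, \<open>clo\<close> and \<open>contn\<close> are the relative topology in
  terms of radii. They need only the ordered field and are first-order in \<open>near\<close>, so
  that topological and definability arguments combine.\<close>

definition opn :: "nat \<Rightarrow> (nat \<Rightarrow> 'a::linordered_field) set \<Rightarrow> (nat \<Rightarrow> 'a) set \<Rightarrow> bool" where
  "opn n Z U \<longleftrightarrow> U \<subseteq> Z \<and> (\<forall>x\<in>U. \<exists>r>0. \<forall>y\<in>Z. near n x y r \<longrightarrow> y \<in> U)"

definition clo :: "nat \<Rightarrow> (nat \<Rightarrow> 'a::linordered_field) set \<Rightarrow> (nat \<Rightarrow> 'a) set \<Rightarrow> bool" where
  "clo n Z C \<longleftrightarrow> C \<subseteq> Z \<and> (\<forall>x\<in>Z. (\<forall>r>0. \<exists>y\<in>C. near n x y r) \<longrightarrow> x \<in> C)"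

definition contn ::
  "nat \<Rightarrow> (nat \<Rightarrow> 'a::linordered_field) set \<Rightarrow> ((nat \<Rightarrow> 'a) \<Rightarrow> 'a) \<Rightarrow> bool" where
  "contn n Z h \<longleftrightarrow> (\<forall>x\<in>Z. \<forall>e>0. \<exists>r>0. \<forall>y\<in>Z. near n x y r \<longrightarrow> \<bar>h y - h x\<bar> < e)"

lemma near_refl: "0 < r \<Longrightarrow> near n x x r"
  by (simp add: near_def)

lemma near_sym: "near n x y r \<longleftrightarrow> near n y x r"
  by (simp add: near_def abs_minus_commute)

lemma near_mono: "near n x y r \<Longrightarrow> r \<le> s \<Longrightarrow> near n x y s"
  unfolding near_def by (meson order_less_le_trans)

lemma near_trans:
  assumes "near n x y r" "near n y z s"
  shows "near n x z (r + s)"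
  unfolding near_def
proof (intro allI impI)
  fix i assume i: "i < n"
  have "\<bar>x i - z i\<bar> \<le> \<bar>x i - y i\<bar> + \<bar>y i - z i\<bar>" using abs_triangle_ineq[of "x i - y i" "y i - z i"] by simp
  also have "\<dots> < r + s" using assms i by (auto simp: near_def intro: add_strict_mono)
  finally show "\<bar>x i - z i\<bar> < r + s" .
qed

lemma near_tjoin:
  "near (n + b) (tjoin n b x y) (tjoin n b x' y') r \<longleftrightarrow> near n x x' r \<and> near b y y' r"
proof
  assume *: "near (n + b) (tjoin n b x y) (tjoin n b x' y') r"
  have "\<bar>y i - y' i\<bar> < r" if "i < b" for i
    using *[unfolded near_def, rule_format, of "n + i"] that by simp
  moreover have "\<bar>x i - x' i\<bar> < r" if "i < n" for i
    using *[unfolded near_def, rule_format, of i] that by simp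
  ultimately show "near n x x' r \<and> near b y y' r" by (simp add: near_def)
next
  assume *: "near n x x' r \<and> near b y y' r"
  show "near (n + b) (tjoin n b x y) (tjoin n b x' y') r"
    unfolding near_def
  proof (intro allI impI)
    fix i assume "i < n + b"
    then show "\<bar>tjoin n b x y i - tjoin n b x' y' i\<bar> < r"
      using * by (cases "i < n") (auto simp: near_def tjoin_def)
  qed
qed

text \<open>Finitely many positive radii have a positive minimum; the second premise allows each
  radius to shrink to it.\<close>

lemma ex_pos_ball_less:
  fixes Q :: "nat \<Rightarrow> 'a::linordered_field \<Rightarrow> bool"
  assumes "\<And>i. i < n \<Longrightarrow> \<exists>r>0. Q i r"
    and "\<And>i r s. i < n \<Longrightarrow> Q i r \<Longrightarrow> 0 < s \<Longrightarrow> s \<le> r \<Longrightarrow> Q i s"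
  shows "\<exists>r>0. \<forall>i<n. Q i r"
  using assms
proof (induction n)
  case 0
  then show ?case using zero_less_one by blast
next
  case (Suc n)
  have "\<exists>r>0. \<forall>i<n. Q i r" using Suc.prems by (intro Suc.IH) (meson less_Suc_eq)+
  then obtain r where r: "r > 0" "\<And>i. i < n \<Longrightarrow> Q i r" by blast
  obtain s where s: "s > 0" "Q n s" using Suc.prems(1)[of n] by auto
  have "min r s > 0" using r s by simp
  moreover have "Q i (min r s)" if "i < Suc n" for i
    using that r s Suc.prems(2)[of i _ "min r s"] \<open>min r s > 0\<close>
    by (metis less_Suc_eq min.cobounded1 min.cobounded2)
  ultimately show ?case by blast
qed

lemma near_open:
  assumes "near n x y s"
  shows "\<exists>r>0. \<forall>z. near n x z r \<longrightarrow> near n z y s"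
proof -
  have "\<exists>r>0. \<forall>i<n. \<bar>x i - y i\<bar> \<le> s - r"
  proof (rule ex_pos_ball_less)
    fix i assume "i < n"
    then show "\<exists>r>0. \<bar>x i - y i\<bar> \<le> s - r"
      using assms by (intro exI[of _ "s - \<bar>x i - y i\<bar>"]) (auto simp: near_def)
  qed auto
  then obtain r where r: "r > 0" "\<And>i. i < n \<Longrightarrow> \<bar>x i - y i\<bar> \<le> s - r" by blast
  have "near n z y s" if z: "near n x z r" for z
    unfolding near_def
  proof (intro allI impI)
    fix i assume i: "i < n"
    have "\<bar>z i - y i\<bar> \<le> \<bar>x i - y i\<bar> + \<bar>x i - z i\<bar>" by (simp add: abs_if)
    also have "\<dots> < (s - r) + r" using r(2)[OF i] z i by (intro add_le_less_mono) (auto simp: near_def)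
    finally show "\<bar>z i - y i\<bar> < s" by simp
  qed
  then show ?thesis using r by blast
qed

section \<open>Comparison with the order and product topologies\<close>

lemma open_ex_abs_less:
  fixes V :: "'a::{linordered_field, linorder_topology} set"
  assumes "open V" "a \<in> V"
  shows "\<exists>r>0. \<forall>b. \<bar>b - a\<bar> < r \<longrightarrow> b \<in> V"
proof -
  obtain c where c: "c > a" "{a..<c} \<subseteq> V"
    using open_right[OF assms, of "a + 1"] by auto
  obtain d where d: "d < a" "{d<..a} \<subseteq> V"
    using open_left[OF assms, of "a - 1"] by auto
  have "b \<in> V" if "\<bar>b - a\<bar> < min (c - a) (a - d)" for b
  proof (cases "a \<le> b")
    case True
    then have "b \<in> {a..<c}" using that by auto
    then show ?thesis using c by blast
  next
    case False
    then have "b \<in> {d<..a}" using that by auto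
    then show ?thesis using d by blast
  qed
  moreover have "min (c - a) (a - d) > 0" using c d by simp
  ultimately show ?thesis by blast
qed

lemma abs_minus_less_interval: "\<bar>b - a\<bar> < r \<longleftrightarrow> b \<in> {a - r<..<a + (r :: 'a::linordered_field)}"
  by (auto simp: abs_less_iff)

lemma topspace_tuple_topology [simp]: "topspace (tuple_topology n) = tuples n"
  by (simp add: tuple_topology_def tuples_def)

lemma openin_tuple_iff:
  fixes U :: "(nat \<Rightarrow> 'a::{linordered_field, linorder_topology}) set"
  shows "openin (tuple_topology n) U \<longleftrightarrow> opn n (tuples n) U"
proof
  assume U: "openin (tuple_topology n) U"
  show "opn n (tuples n) U"
    unfolding opn_def
  proof (intro conjI ballI)
    show "U \<subseteq> tuples n" using openin_subset[OF U] by simp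
    fix x assume "x \<in> U"
    with U[unfolded tuple_topology_def openin_product_topology_alt] obtain V
      where "\<forall>i\<in>{..<n}. openin euclidean (V i)" "x \<in> Pi\<^sub>E {..<n} V" "Pi\<^sub>E {..<n} V \<subseteq> U"
      by blast
    then have V: "\<And>i. i < n \<Longrightarrow> open (V i)" "x \<in> Pi\<^sub>E {..<n} V" "Pi\<^sub>E {..<n} V \<subseteq> U" by auto
    have "\<exists>r>0. \<forall>i<n. \<forall>b. \<bar>b - x i\<bar> < r \<longrightarrow> b \<in> V i"
    proof (rule ex_pos_ball_less)
      fix i assume "i < n"
      then show "\<exists>r>0. \<forall>b. \<bar>b - x i\<bar> < r \<longrightarrow> b \<in> V i"
        using V by (intro open_ex_abs_less) auto
    qed auto
    then obtain r where r: "r > 0" "\<And>i b. i < n \<Longrightarrow> \<bar>b - x i\<bar> < r \<Longrightarrow> b \<in> V i" by blast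
    have "y \<in> U" if "y \<in> tuples n" "near n x y r" for y
    proof -
      have "y \<in> Pi\<^sub>E {..<n} V"
        using that r by (auto simp: near_def PiE_iff tuples_def abs_minus_commute)
      then show ?thesis using V by blast
    qed
    then show "\<exists>r>0. \<forall>y\<in>tuples n. near n x y r \<longrightarrow> y \<in> U" using r by blast
  qed
next
  assume U: "opn n (tuples n) U"
  show "openin (tuple_topology n) U"
    unfolding tuple_topology_def openin_product_topology_alt
  proof (intro ballI)
    fix x assume x: "x \<in> U"
    then obtain r where r: "r > 0" "\<And>y. y \<in> tuples n \<Longrightarrow> near n x y r \<Longrightarrow> y \<in> U"
      using U unfolding opn_def by blast
    define V where "V i = {x i - r<..<x i + r}" for i
    have "x \<in> tuples n" using x U by (auto simp: opn_def)
    then have "x \<in> Pi\<^sub>E {..<n} V" using r by (auto simp: V_def tuples_def)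
    moreover have "Pi\<^sub>E {..<n} V \<subseteq> U"
    proof
      fix y assume y: "y \<in> Pi\<^sub>E {..<n} V"
      have "y \<in> tuples n" using y by (auto simp: tuples_def)
      moreover have "near n x y r"
        using y by (subst near_sym) (auto simp: near_def V_def abs_minus_less_interval PiE_iff)
      ultimately show "y \<in> U" by (rule r)
    qed
    ultimately show "\<exists>V. finite {i \<in> {..<n}. V i \<noteq> topspace euclidean} \<and>
        (\<forall>i\<in>{..<n}. openin euclidean (V i)) \<and> x \<in> Pi\<^sub>E {..<n} V \<and> Pi\<^sub>E {..<n} V \<subseteq> U"
      by (intro exI[of _ V]) (auto simp: V_def)
  qed
qed

lemma openin_rel_iff:
  fixes Z :: "(nat \<Rightarrow> 'a::{linordered_field, linorder_topology}) set"
  assumes Z: "Z \<subseteq> tuples n"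
  shows "openin (rel_topology n Z) U \<longleftrightarrow> opn n Z U"
proof
  assume "openin (rel_topology n Z) U"
  then show "opn n Z U"
    using Z unfolding openin_subtopology openin_tuple_iff opn_def by blast
next
  assume U: "opn n Z U"
  \<comment> \<open>An open set of the ambient space that cuts out \<open>U\<close>: the union of
    all balls about points of \<open>U\<close> whose trace on \<open>Z\<close> lies in
    \<open>U\<close>.\<close>
  define V where "V = {y \<in> tuples n. \<exists>x\<in>U. \<exists>r>0. near n x y r \<and> (\<forall>y'\<in>Z. near n x y' r \<longrightarrow> y' \<in> U)}"
  have "opn n (tuples n) V"
    unfolding opn_def
  proof (intro conjI ballI)
    show "V \<subseteq> tuples n" by (auto simp: V_def)
    fix y assume "y \<in> V"
    then obtain x r where x: "x \<in> U" "r > 0" "near n x y r" "\<forall>y'\<in>Z. near n x y' r \<longrightarrow> y' \<in> U"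
      by (auto simp: V_def)
    have "near n y x r" using x(3) near_sym by blast
    then obtain s where s: "s > 0" "\<And>z. near n y z s \<Longrightarrow> near n z x r" using near_open by blast
    have "z \<in> V" if z: "z \<in> tuples n" "near n y z s" for z
      using x s(2)[OF z(2)] z(1) near_sym unfolding V_def by blast
    then show "\<exists>r>0. \<forall>z\<in>tuples n. near n y z r \<longrightarrow> z \<in> V" using s by blast
  qed
  moreover have "U = V \<inter> Z"
  proof
    show "U \<subseteq> V \<inter> Z"
    proof
      fix x assume x: "x \<in> U"
      then obtain r where r: "r > 0" "\<forall>y\<in>Z. near n x y r \<longrightarrow> y \<in> U" using U by (auto simp: opn_def)
      have "x \<in> Z" using x U by (auto simp: opn_def)
      then show "x \<in> V \<inter> Z" using x r near_refl[OF r(1), of n x] Z by (auto simp: V_def)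
    qed
    show "V \<inter> Z \<subseteq> U" by (auto simp: V_def)
  qed
  ultimately show "openin (rel_topology n Z) U"
    unfolding openin_subtopology openin_tuple_iff by blast
qed

lemma cloD: "clo n Z C \<Longrightarrow> x \<in> Z \<Longrightarrow> x \<notin> C \<Longrightarrow> \<exists>r>0. \<forall>y\<in>C. \<not> near n x y r"
  by (auto simp: clo_def)

lemma cloI:
  "C \<subseteq> Z \<Longrightarrow> (\<And>x. x \<in> Z \<Longrightarrow> x \<notin> C \<Longrightarrow> \<exists>r>0. \<forall>y\<in>C. \<not> near n x y r) \<Longrightarrow> clo n Z C"
  unfolding clo_def by blast

lemma opn_Diff_iff:
  assumes "C \<subseteq> Z"
  shows "opn n Z (Z - C) \<longleftrightarrow> clo n Z C"
proof
  assume *: "opn n Z (Z - C)"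
  show "clo n Z C"
  proof (rule cloI[OF assms])
    fix x assume "x \<in> Z" "x \<notin> C"
    then obtain r where "r > 0" "\<forall>y\<in>Z. near n x y r \<longrightarrow> y \<in> Z - C" using * unfolding opn_def by blast
    then show "\<exists>r>0. \<forall>y\<in>C. \<not> near n x y r" using assms by blast
  qed
next
  assume *: "clo n Z C"
  show "opn n Z (Z - C)"
    unfolding opn_def
  proof (intro conjI ballI)
    fix x assume "x \<in> Z - C"
    then obtain r where "r > 0" "\<forall>y\<in>C. \<not> near n x y r" using cloD[OF *] by blast
    then show "\<exists>r>0. \<forall>y\<in>Z. near n x y r \<longrightarrow> y \<in> Z - C" by blast
  qed auto
qed

lemma closedin_rel_iff:
  fixes Z :: "(nat \<Rightarrow> 'a::{linordered_field, linorder_topology}) set"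
  assumes Z: "Z \<subseteq> tuples n"
  shows "closedin (rel_topology n Z) C \<longleftrightarrow> clo n Z C"
proof -
  have "topspace (rel_topology n Z) = Z" using Z by auto
  then show ?thesis
    unfolding closedin_def openin_rel_iff[OF Z] using opn_Diff_iff[of C Z n] by (auto simp: clo_def)
qed

lemma closedin_tuple_iff:
  fixes C :: "(nat \<Rightarrow> 'a::{linordered_field, linorder_topology}) set"
  shows "closedin (tuple_topology n) C \<longleftrightarrow> clo n (tuples n) C"
  using closedin_rel_iff[of "tuples n" n C] by (metis subset_refl subtopology_topspace topspace_tuple_topology)

lemma continuous_map_rel_iff:
  fixes h :: "(nat \<Rightarrow> 'a::{linordered_field, linorder_topology}) \<Rightarrow> 'a"
  assumes Z: "Z \<subseteq> tuples n"
  shows "continuous_map (rel_topology n Z) euclidean h \<longleftrightarrow> contn n Z h"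
proof -
  have top: "topspace (rel_topology n Z) = Z" using Z by auto
  show ?thesis
  proof
    assume *: "continuous_map (rel_topology n Z) euclidean h"
    show "contn n Z h"
      unfolding contn_def
    proof (intro ballI allI impI)
      fix x e assume x: "x \<in> Z" and e: "e > (0::'a)"
      have "opn n Z {y \<in> Z. h y \<in> {h x - e<..<h x + e}}"
        using openin_continuous_map_preimage[OF *, of "{h x - e<..<h x + e}"]
        unfolding top openin_rel_iff[OF Z] by simp
      then obtain r where "r > 0" "\<forall>y\<in>Z. near n x y r \<longrightarrow> h y \<in> {h x - e<..<h x + e}"
        using x e unfolding opn_def by fastforce
      then show "\<exists>r>0. \<forall>y\<in>Z. near n x y r \<longrightarrow> \<bar>h y - h x\<bar> < e"
        unfolding abs_minus_less_interval by blast
    qed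
  next
    assume *: "contn n Z h"
    show "continuous_map (rel_topology n Z) euclidean h"
      unfolding continuous_map_def top openin_rel_iff[OF Z]
    proof (intro conjI allI impI)
      fix V :: "'a set" assume "openin euclidean V"
      then have V: "open V" by simp
      show "opn n Z {x \<in> Z. h x \<in> V}"
        unfolding opn_def
      proof (intro conjI ballI)
        fix x assume x: "x \<in> {x \<in> Z. h x \<in> V}"
        then obtain e where e: "e > 0" "\<And>b. \<bar>b - h x\<bar> < e \<Longrightarrow> b \<in> V"
          using open_ex_abs_less[OF V] by blast
        obtain r where "r > 0" "\<forall>y\<in>Z. near n x y r \<longrightarrow> \<bar>h y - h x\<bar> < e"
          using * x e(1) unfolding contn_def by blast
        then show "\<exists>r>0. \<forall>y\<in>Z. near n x y r \<longrightarrow> y \<in> {x \<in> Z. h x \<in> V}" using e(2) by blast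
      qed auto
    qed auto
  qed
qed

lemma continuous_map_rel_rel_iff:
  fixes f :: "(nat \<Rightarrow> 'a::{linordered_field, linorder_topology}) \<Rightarrow> nat \<Rightarrow> 'a"
  assumes Z: "Z \<subseteq> tuples n" and Y: "Y \<subseteq> tuples k"
  shows "continuous_map (rel_topology n Z) (rel_topology k Y) f \<longleftrightarrow>
    f \<in> Z \<rightarrow> Y \<and> (\<forall>i<k. contn n Z (\<lambda>x. f x i))"
proof -
  have top: "topspace (rel_topology n Z) = Z" using Z by auto
  have "f \<in> Z \<rightarrow> Y \<Longrightarrow> f ` Z \<subseteq> extensional {..<k}" using Y by (auto simp: tuples_def PiE_def)
  then show ?thesis
    unfolding continuous_map_in_subtopology top continuous_map_rel_iff[OF Z, symmetric]
    by (subst tuple_topology_def) (auto simp: continuous_map_componentwise top)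
qed

section \<open>Relatively closed sets and continuous functions\<close>

lemma opnD: "opn n Z U \<Longrightarrow> x \<in> U \<Longrightarrow> \<exists>r>0. \<forall>y\<in>Z. near n x y r \<longrightarrow> y \<in> U"
  by (auto simp: opn_def)

lemma clo_self: "clo n Z Z"
  by (auto simp: clo_def)

lemma clo_trans:
  assumes "clo n Z C" "clo n C D"
  shows "clo n Z D"
proof -
  have "D \<subseteq> C" "C \<subseteq> Z" using assms by (auto simp: clo_def)
  moreover have "x \<in> C" if "x \<in> Z" "\<forall>r>0. \<exists>y\<in>D. near n x y r" for x
    using assms(1) that \<open>D \<subseteq> C\<close> unfolding clo_def by blast
  moreover have "x \<in> D" if "x \<in> C" "\<forall>r>0. \<exists>y\<in>D. near n x y r" for x
    using assms(2) that unfolding clo_def by blast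
  ultimately show ?thesis unfolding clo_def by blast
qed

lemma clo_mono: "clo n Z C \<Longrightarrow> C \<subseteq> T \<Longrightarrow> T \<subseteq> Z \<Longrightarrow> clo n T C"
  unfolding clo_def by blast

lemma clo_restrict: "clo n Z C \<Longrightarrow> T \<subseteq> Z \<Longrightarrow> clo n T (C \<inter> T)"
  unfolding clo_def by blast

lemma clo_Diff_opn: "opn n Z U \<Longrightarrow> clo n Z (Z - U)"
  unfolding opn_def clo_def by blast

lemma contnD: "contn n Z h \<Longrightarrow> x \<in> Z \<Longrightarrow> e > 0 \<Longrightarrow> \<exists>r>0. \<forall>y\<in>Z. near n x y r \<longrightarrow> \<bar>h y - h x\<bar> < e"
  by (auto simp: contn_def)

lemma contn_subset: "contn n Z h \<Longrightarrow> T \<subseteq> Z \<Longrightarrow> contn n T h"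
  unfolding contn_def by (meson subsetD)

lemma contn_const: "contn n Z (\<lambda>x. c)"
  unfolding contn_def by (auto intro: exI[of _ 1])

lemma contn_var: "i < n \<Longrightarrow> contn n Z (\<lambda>x. x i)"
  unfolding contn_def near_def by (metis abs_minus_commute)

text \<open>Continuity of a two-variable operation is checked at the values; this yields continuity of
  the field operations on \<open>'a\<close>, which are not part of its type class.\<close>

lemma contn_binop:
  assumes h: "contn n Z h" and k: "contn n Z k"
    and op: "\<And>x e. x \<in> Z \<Longrightarrow> e > 0 \<Longrightarrow>
      \<exists>d>0. \<forall>a b. \<bar>a - h x\<bar> < d \<longrightarrow> \<bar>b - k x\<bar> < d \<longrightarrow> \<bar>f a b - f (h x) (k x)\<bar> < e"
  shows "contn n Z (\<lambda>x. f (h x) (k x))"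
  unfolding contn_def
proof (intro ballI allI impI)
  fix x e assume x: "x \<in> Z" and e: "e > (0::'a)"
  obtain d where d: "d > 0"
    "\<And>a b. \<bar>a - h x\<bar> < d \<Longrightarrow> \<bar>b - k x\<bar> < d \<Longrightarrow> \<bar>f a b - f (h x) (k x)\<bar> < e"
    using op[OF x e] by blast
  obtain r where r: "r > 0" "\<forall>y\<in>Z. near n x y r \<longrightarrow> \<bar>h y - h x\<bar> < d" using contnD[OF h x d(1)] by blast
  obtain s where s: "s > 0" "\<forall>y\<in>Z. near n x y s \<longrightarrow> \<bar>k y - k x\<bar> < d" using contnD[OF k x d(1)] by blast
  have "min r s > 0" using r s by simp
  moreover have "\<bar>f (h y) (k y) - f (h x) (k x)\<bar> < e" if "y \<in> Z" "near n x y (min r s)" for y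
    using that near_mono[OF that(2), of r] near_mono[OF that(2), of s] r s d(2) by auto
  ultimately show "\<exists>r>0. \<forall>y\<in>Z. near n x y r \<longrightarrow> \<bar>f (h y) (k y) - f (h x) (k x)\<bar> < e"
    by blast
qed

lemma contn_add:
  assumes "contn n Z h" "contn n Z k"
  shows "contn n Z (\<lambda>x. h x + k x)"
proof (rule contn_binop[OF assms])
  fix x and e :: 'a assume "e > 0"
  have "\<bar>a + b - (h x + k x)\<bar> < e" if "\<bar>a - h x\<bar> < e / 2" "\<bar>b - k x\<bar> < e / 2" for a b
  proof -
    have "a - h x < e / 2" "- (a - h x) < e / 2" "b - k x < e / 2" "- (b - k x) < e / 2"
      using that by (simp_all only: abs_less_iff)
    then show ?thesis unfolding abs_less_iff by linarith
  qed
  then show "\<exists>d>0. \<forall>a b. \<bar>a - h x\<bar> < d \<longrightarrow> \<bar>b - k x\<bar> < d \<longrightarrow> \<bar>a + b - (h x + k x)\<bar> < e"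
    using half_gt_zero[OF \<open>e > 0\<close>] by blast
qed

lemma contn_mult:
  assumes "contn n Z h" "contn n Z k"
  shows "contn n Z (\<lambda>x. h x * k x)"
proof (rule contn_binop[OF assms])
  fix x and e :: 'a assume e: "e > 0"
  \<comment> \<open>After expanding the difference of the products, the quadratic term is at most
    \<open>d\<close> because \<open>d \<le> 1\<close>. The total is below
    \<open>d * M\<close>.\<close>
  define M where "M = 1 + \<bar>h x\<bar> + \<bar>k x\<bar>"
  have M: "M > 0" by (simp add: M_def add_pos_nonneg)
  define d where "d = min 1 (e / M)"
  have d: "d > 0" using e M by (simp add: d_def)
  have "\<bar>a * b - h x * k x\<bar> < e" if a: "\<bar>a - h x\<bar> < d" and b: "\<bar>b - k x\<bar> < d" for a b
  proof -
    have "\<bar>a - h x\<bar> \<le> 1" using a by (simp add: d_def)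
    have "a * b - h x * k x = (a - h x) * (b - k x) + (a - h x) * k x + h x * (b - k x)"
      by (simp add: algebra_simps)
    then have "\<bar>a * b - h x * k x\<bar> \<le> \<bar>a - h x\<bar> * \<bar>b - k x\<bar> + \<bar>a - h x\<bar> * \<bar>k x\<bar> + \<bar>h x\<bar> * \<bar>b - k x\<bar>"
      using abs_triangle_ineq[of "(a - h x) * (b - k x) + (a - h x) * k x" "h x * (b - k x)"]
        abs_triangle_ineq[of "(a - h x) * (b - k x)" "(a - h x) * k x"]
      unfolding abs_mult by linarith
    also have "\<dots> \<le> 1 * \<bar>b - k x\<bar> + d * \<bar>k x\<bar> + \<bar>h x\<bar> * d"
      using a b \<open>\<bar>a - h x\<bar> \<le> 1\<close> by (intro add_mono mult_mono) auto
    also have "\<dots> < 1 * d + d * \<bar>k x\<bar> + \<bar>h x\<bar> * d" using b by simp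
    also have "\<dots> = d * M" by (simp add: M_def algebra_simps)
    also have "\<dots> \<le> e" using M by (simp add: d_def min_def field_simps)
    finally show ?thesis .
  qed
  then show "\<exists>d>0. \<forall>a b. \<bar>a - h x\<bar> < d \<longrightarrow> \<bar>b - k x\<bar> < d \<longrightarrow> \<bar>a * b - h x * k x\<bar> < e"
    using d by blast
qed

lemma contn_abs:
  assumes "contn n Z h"
  shows "contn n Z (\<lambda>x. \<bar>h x\<bar>)"
proof (rule contn_binop[OF assms assms, where f = "\<lambda>a b. \<bar>a\<bar>"])
  show "\<exists>d>0. \<forall>a b. \<bar>a - h x\<bar> < d \<longrightarrow> \<bar>b - h x\<bar> < d \<longrightarrow> \<bar>\<bar>a\<bar> - \<bar>h x\<bar>\<bar> < e" if "e > 0" for x e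
    using that by (meson abs_triangle_ineq3 order_le_less_trans)
qed

lemma contn_inverse:
  assumes "contn n Z h" "\<And>x. x \<in> Z \<Longrightarrow> h x > 0"
  shows "contn n Z (\<lambda>x. inverse (h x))"
proof (rule contn_binop[OF assms(1,1), where f = "\<lambda>a b. inverse a"])
  fix x and e :: 'a assume e: "e > 0" and x: "x \<in> Z"
  define c where "c = h x"
  have c: "c > 0" using assms(2)[OF x] by (simp add: c_def)
  \<comment> \<open>The first bound forces \<open>a > c / 2\<close>, hence a denominator
    \<open>a * c\<close> above \<open>c * c / 2\<close>; the second bounds the numerator
    accordingly.\<close>
  define d where "d = min (c / 2) (e * c * c / 2)"
  have d: "d > 0" using c e by (simp add: d_def)
  have "\<bar>inverse a - inverse c\<bar> < e" if a: "\<bar>a - c\<bar> < d" for a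
  proof -
    have "\<bar>a - c\<bar> < c / 2" using a by (simp add: d_def)
    then have "- (a - c) < c / 2" by (simp only: abs_less_iff)
    then have a2: "a > c / 2" by linarith
    then have a0: "a > 0" using c by (meson half_gt_zero less_trans)
    have "\<bar>inverse a - inverse c\<bar> = \<bar>a - c\<bar> / (a * c)"
      using a0 c by (simp add: inverse_diff_inverse abs_mult divide_inverse abs_minus_commute mult_ac)
    also have "\<dots> < (e * c * c / 2) / (a * c)"
      using a a0 c by (intro divide_strict_right_mono) (auto simp: d_def)
    also have "\<dots> \<le> (e * c * c / 2) / ((c / 2) * c)"
      using a2 c e a0 by (intro divide_left_mono) auto
    also have "\<dots> = e" using c by simp
    finally show ?thesis .
  qed
  then show "\<exists>d>0. \<forall>a b. \<bar>a - h x\<bar> < d \<longrightarrow> \<bar>b - h x\<bar> < d \<longrightarrow> \<bar>inverse a - inverse (h x)\<bar> < e"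
    using d unfolding c_def by blast
qed

lemma contn_divide:
  assumes "contn n Z h" "contn n Z k" "\<And>x. x \<in> Z \<Longrightarrow> k x > 0"
  shows "contn n Z (\<lambda>x. h x / k x)"
  using contn_mult[OF assms(1) contn_inverse[OF assms(2,3)]] by (simp add: divide_inverse)

lemma clo_le_contn:
  assumes "contn n Z h"
  shows "clo n Z {x \<in> Z. h x \<le> c}"
proof (rule cloI)
  fix x assume x: "x \<in> Z" "x \<notin> {x \<in> Z. h x \<le> c}"
  then have "h x - c > 0" by auto
  from contnD[OF assms x(1) this]
  show "\<exists>r>0. \<forall>y\<in>{x \<in> Z. h x \<le> c}. \<not> near n x y r" by (fastforce simp: abs_less_iff)
qed auto

lemma clo_ge_contn:
  assumes "contn n Z h"
  shows "clo n Z {x \<in> Z. c \<le> h x}"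
proof (rule cloI)
  fix x assume x: "x \<in> Z" "x \<notin> {x \<in> Z. c \<le> h x}"
  then have "c - h x > 0" by auto
  from contnD[OF assms x(1) this]
  show "\<exists>r>0. \<forall>y\<in>{x \<in> Z. c \<le> h x}. \<not> near n x y r" by (fastforce simp: abs_less_iff)
qed auto

text \<open>Open rays generate the order topology. The criterion suits functions whose level sets
  are saturations, for which closedness is what is known.\<close>

lemma contnI_clo:
  assumes "\<And>c. clo n Z {x \<in> Z. h x \<le> c}" "\<And>c. clo n Z {x \<in> Z. c \<le> h x}"
  shows "contn n Z h"
  unfolding contn_def
proof (intro ballI allI impI)
  fix x e assume x: "x \<in> Z" and e: "e > (0::'a)"
  obtain r where r: "r > 0" "\<forall>y\<in>Z. near n x y r \<longrightarrow> h x - e < h y"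
    using cloD[OF assms(1)[of "h x - e"] x] e by force
  obtain s where s: "s > 0" "\<forall>y\<in>Z. near n x y s \<longrightarrow> h y < h x + e"
    using cloD[OF assms(2)[of "h x + e"] x] e by force
  have "min r s > 0" using r s by simp
  moreover have "\<bar>h y - h x\<bar> < e" if "y \<in> Z" "near n x y (min r s)" for y
  proof -
    have "h x - e < h y" "h y < h x + e"
      using that near_mono[OF that(2), of r] near_mono[OF that(2), of s] r s by auto
    then show ?thesis by (simp add: abs_less_iff algebra_simps)
  qed
  ultimately show "\<exists>r>0. \<forall>y\<in>Z. near n x y r \<longrightarrow> \<bar>h y - h x\<bar> < e" by blast
qed

lemma dpred_near:
  assumes "\<And>i. i < n \<Longrightarrow> dscal F N (\<lambda>z. u z i)" "\<And>i. i < n \<Longrightarrow> dscal F N (\<lambda>z. v z i)" "dscal F N r"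
  shows "dpred F N (\<lambda>z. near n (u z) (v z) (r z))"
  unfolding near_def
  by (intro dpred_ball_less dpred_less dscal_abs dscal_diff assms)

section \<open>Consequences of definable completeness\<close>

definition isglb :: "'a::linorder set \<Rightarrow> 'a \<Rightarrow> bool" where
  "isglb S s \<longleftrightarrow> (\<forall>x\<in>S. s \<le> x) \<and> (\<forall>u. (\<forall>x\<in>S. u \<le> x) \<longrightarrow> u \<le> s)"

definition glb :: "'a::linorder set \<Rightarrow> 'a" where
  "glb S = (THE s. isglb S s)"

lemma isglb_unique: "isglb S s \<Longrightarrow> isglb S t \<Longrightarrow> s = t"
  by (auto simp: isglb_def intro: order_antisym)

lemma isglb_glb: "isglb S s \<Longrightarrow> isglb S (glb S)"
  unfolding glb_def by (metis isglb_unique theI)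

lemma isglb_le: "isglb S s \<Longrightarrow> x \<in> S \<Longrightarrow> s \<le> x"
  by (auto simp: isglb_def)

lemma isglb_greatest: "isglb S s \<Longrightarrow> (\<And>x. x \<in> S \<Longrightarrow> u \<le> x) \<Longrightarrow> u \<le> s"
  by (auto simp: isglb_def)

lemma isglb_less: "isglb S s \<Longrightarrow> s < u \<Longrightarrow> \<exists>x\<in>S. x < u"
  unfolding isglb_def by (meson linorder_not_less)

lemma definable1_Collect:
  assumes "dpred F 1 (\<lambda>w. P (w 0))"
  shows "definable1 F {a. P a}"
proof -
  have "pt ` {a. P a} = {x \<in> tuples 1. P (x 0)}"
  proof
    show "pt ` {a. P a} \<subseteq> {x \<in> tuples 1. P (x 0)}" by (auto simp: pt_def)
    show "{x \<in> tuples 1. P (x 0)} \<subseteq> pt ` {a. P a}"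
    proof
      fix x assume x: "x \<in> {x \<in> tuples 1. P (x 0)}"
      then have "x = pt (x 0)" by (intro tuples_eqI[where n = 1]) (auto simp: pt_def)
      then show "x \<in> pt ` {a. P a}" using x by blast
    qed
  qed
  then show ?thesis using assms by (simp add: definable1_def dpred_def)
qed

lemma extended_bounds:
  assumes "Fin a \<le> s" "s \<le> Fin b"
  shows "\<exists>c. s = Fin c"
  using assms by (cases s) auto

lemma complete_lub:
  fixes P :: "'a::linordered_field \<Rightarrow> bool"
  assumes F: "definably_complete F" and P: "dpred F 1 (\<lambda>w. P (w 0))"
    and a: "P a" and b: "\<And>x. P x \<Longrightarrow> x \<le> b"
  shows "\<exists>s. (\<forall>x. P x \<longrightarrow> x \<le> s) \<and> (\<forall>u. (\<forall>x. P x \<longrightarrow> x \<le> u) \<longrightarrow> s \<le> u)"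
proof -
  obtain s :: "'a extended" where s: "\<And>x. P x \<Longrightarrow> Fin x \<le> s"
    "\<And>u. (\<And>x. P x \<Longrightarrow> Fin x \<le> u) \<Longrightarrow> s \<le> u"
    using F definable1_Collect[OF P] unfolding definably_complete_def by (metis mem_Collect_eq)
  have "s \<le> Fin b" using b by (intro s(2)) auto
  then obtain c where c: "s = Fin c" using extended_bounds[OF s(1)[OF a]] by blast
  have "x \<le> c" if "P x" for x using s(1)[OF that] c by simp
  moreover have "c \<le> u" if "\<And>x. P x \<Longrightarrow> x \<le> u" for u
    using s(2)[of "Fin u"] that c by simp
  ultimately show ?thesis by blast
qed

lemma complete_glb:
  fixes P :: "'a::linordered_field \<Rightarrow> bool"
  assumes F: "definably_complete F" and P: "dpred F 1 (\<lambda>w. P (w 0))"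
    and a: "P a" and b: "\<And>x. P x \<Longrightarrow> b \<le> x"
  shows "isglb {c. P c} (glb {c. P c})"
proof -
  obtain s :: "'a extended" where s: "\<And>x. P x \<Longrightarrow> s \<le> Fin x"
    "\<And>u. (\<And>x. P x \<Longrightarrow> u \<le> Fin x) \<Longrightarrow> u \<le> s"
    using F definable1_Collect[OF P] unfolding definably_complete_def by (metis mem_Collect_eq)
  have "Fin b \<le> s" using b by (intro s(2)) auto
  then obtain c where c: "s = Fin c" using extended_bounds[OF _ s(1)[OF a]] by blast
  have "c \<le> x" if "P x" for x using s(1)[OF that] c by simp
  moreover have "u \<le> c" if "\<And>x. P x \<Longrightarrow> u \<le> x" for u
    using s(2)[of "Fin u"] that c by simp
  ultimately have "isglb {c. P c} c" by (auto simp: isglb_def)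
  then show ?thesis by (rule isglb_glb)
qed

lemmas def_intros = dpred_intros dpred_near dscal_abs dscal_divide dscal_app
  dvec_const dvec_tjoin

lemma complete_glb_fibre:
  fixes Q :: "(nat \<Rightarrow> 'a::linordered_field) \<Rightarrow> 'a \<Rightarrow> bool"
  assumes F: "definably_complete F" and Q: "dpred F (Suc n) (\<lambda>z. Q (tfst n z) (z n))"
    and x: "x \<in> tuples n"
    and a: "Q x a" and b: "\<And>c. Q x c \<Longrightarrow> b \<le> c"
  shows "isglb {c. Q x c} (glb {c. Q x c})"
proof (rule complete_glb[where P = "Q x" and a = a and b = b, OF F])
  \<comment> \<open>Completeness speaks about subsets of the line, so the coordinates of the fixed
    point \<open>x\<close> become parameters.\<close>
  have "dvec F 1 (Suc n) (\<lambda>w. x(n := w 0))"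
  proof (rule dvecI)
    fix i assume "i < Suc n"
    show "dscal F 1 (\<lambda>w. (x(n := w 0)) i)"
      by (cases "i = n") (auto intro: dscal_const dscal_var)
  qed (use x in auto)
  from dpred_subst[OF Q this] show "dpred F 1 (\<lambda>w. Q x (w 0))" using x by simp
qed (use a b in auto)

text \<open>Being a greatest lower bound is first-order in the family \<open>Q\<close>, hence
  pointwise infima of a definable family form a definable function. Outside \<open>D\<close> the
  value is set to 0.\<close>

lemma dscal_glb:
  assumes D: "dpred F n D" and Q: "dpred F (Suc n) (\<lambda>z. Q (tfst n z) (z n))"
    and t: "\<And>x. x \<in> tuples n \<Longrightarrow> D x \<Longrightarrow> isglb {c. Q x c} (t x)"
    and t0: "\<And>x. x \<in> tuples n \<Longrightarrow> \<not> D x \<Longrightarrow> t x = 0"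
  shows "dscal F n t"
proof (rule dscal_graph)
  have Q': "dpred F N (\<lambda>z. Q (u z) (s z))" if "dvec F N n u" "dscal F N s" for N u s
  proof -
    have u: "u z \<in> tuples n" if "z \<in> tuples N" for z using \<open>dvec F N n u\<close> that by (auto simp: dvec_def)
    have "dvec F N (Suc n) (\<lambda>z. (u z)(n := s z))"
    proof (rule dvecI)
      fix i assume "i < Suc n"
      then show "dscal F N (\<lambda>z. ((u z)(n := s z)) i)"
        using that by (cases "i = n") (auto simp: dvec_def)
    qed (use u in auto)
    from dpred_subst[OF Q this] show ?thesis
      by (rule iffD1[OF dpred_cong, rotated]) (simp add: u)
  qed
  have D': "dpred F N (\<lambda>z. D (u z))" if "dvec F N n u" for N u
    using dpred_subst[OF D that] .
  show "dpred F (Suc n) (\<lambda>z. (\<lambda>x a. (D x \<and> (\<forall>c. Q x c \<longrightarrow> a \<le> c) \<and>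
      (\<forall>u. (\<forall>c. Q x c \<longrightarrow> u \<le> c) \<longrightarrow> u \<le> a)) \<or> (\<not> D x \<and> a = 0)) (tfst n z) (z n))"
    by (rule def_intros Q' D' | simp)+
  show "(D x \<and> (\<forall>c. Q x c \<longrightarrow> a \<le> c) \<and>
      (\<forall>u. (\<forall>c. Q x c \<longrightarrow> u \<le> c) \<longrightarrow> u \<le> a)) \<or> (\<not> D x \<and> a = 0) \<longleftrightarrow> a = t x"
    if "x \<in> tuples n" for x a
  proof (cases "D x")
    case True
    have "isglb {c. Q x c} a \<longleftrightarrow> a = t x" using t[OF that True] isglb_unique by blast
    then show ?thesis using True by (auto simp: isglb_def)
  qed (use t0[OF that] in auto)
qed

text \<open>A point of the closure of the projection is lifted by taking for its last coordinate the
  limes inferior of the last coordinates of the nearby points of \<open>K\<close>.\<close>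

lemma clo_projection_Suc:
  fixes K :: "(nat \<Rightarrow> 'a::linordered_field) set"
  assumes F: "definably_complete F" and K: "definable F (Suc n) K"
    and clo: "clo (Suc n) (tuples (Suc n)) K"
    and bd: "\<And>z. z \<in> K \<Longrightarrow> a \<le> z n" "\<And>z. z \<in> K \<Longrightarrow> z n \<le> b"
  shows "clo n (tuples n) {x \<in> tuples n. \<exists>c. x(n := c) \<in> K}"
  unfolding clo_def
proof (intro conjI ballI impI)
  fix p assume p: "p \<in> tuples n"
    and *: "\<forall>r>0. \<exists>y\<in>{x \<in> tuples n. \<exists>c. x(n := c) \<in> K}. near n p y r"
  have near: "\<exists>z\<in>K. near n p z r" if r: "r > 0" for r
  proof -
    obtain y c where "y(n := c) \<in> K" "near n p y r" using * r by blast
    then show ?thesis by (intro bexI[of _ "y(n := c)"]) (auto simp: near_def)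
  qed
  define S where "S y \<longleftrightarrow> (\<exists>e. 0 < e \<and> (\<forall>z\<in>K. near n p z e \<longrightarrow> y \<le> z n))" for y
  have "dpred F 1 (\<lambda>w. S (w 0))"
    unfolding S_def
  proof (rule dpred_ex, rule dpred_conj)
    show "dpred F (Suc 1) (\<lambda>z. \<forall>za\<in>K. near n p za (z 1) \<longrightarrow> tfst 1 z 0 \<le> za n)"
      by (rule dpred_ball[OF K]) (rule def_intros p | simp add: near_def)+
  qed (rule def_intros | simp)+
  moreover have "S a" unfolding S_def using bd(1) by (intro exI[of _ 1]) auto
  moreover have "y \<le> b" if "S y" for y
    using that near bd(2) unfolding S_def by (meson order_trans)
  ultimately obtain s where s: "\<And>y. S y \<Longrightarrow> y \<le> s" "\<And>u. (\<And>y. S y \<Longrightarrow> y \<le> u) \<Longrightarrow> s \<le> u"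
    using complete_lub[OF F, of S] by metis
  have "p(n := s) \<in> K"
  proof (rule ccontr)
    assume "p(n := s) \<notin> K"
    then obtain d where d: "d > 0" "\<And>z. z \<in> K \<Longrightarrow> \<not> near (Suc n) (p(n := s)) z d"
      using cloD[OF clo, of "p(n := s)"] p by auto
    \<comment> \<open>As \<open>s\<close> is the supremum of \<open>S\<close>, some
      \<open>y > s - d\<close> bounds the last coordinate from below near \<open>p\<close>, whereas
      \<open>s + d\<close> does not. Together this yields a point of \<open>K\<close> within
      \<open>d\<close> of the lifted point.\<close>
    obtain y where y: "S y" "s - d < y" using s(2)[of "s - d"] d(1) by force
    obtain e where e: "e > 0" "\<And>z. z \<in> K \<Longrightarrow> near n p z e \<Longrightarrow> y \<le> z n"
      using y(1) unfolding S_def by blast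
    have "\<not> S (s + d)" using s(1)[of "s + d"] d(1) by auto
    then obtain z where z: "z \<in> K" "near n p z (min e d)" "z n < s + d"
      unfolding S_def using e(1) d(1) by (metis linorder_not_less min_less_iff_conj)
    have "s - d < z n"
      using y(2) e(2)[OF z(1) near_mono[OF z(2)]] by simp
    then have "near (Suc n) (p(n := s)) z d"
      using z near_mono[OF z(2), of d] by (auto simp: near_def less_Suc_eq abs_less_iff algebra_simps)
    then show False using d(2)[OF z(1)] by blast
  qed
  then show "p \<in> {x \<in> tuples n. \<exists>c. x(n := c) \<in> K}" using p by blast
qed auto

text \<open>Coordinates are projected away one at a time, beginning with the last, so that
  completeness in one variable suffices. The intermediate sets inherit the bounds.\<close>

lemma clo_projection:
  fixes K :: "(nat \<Rightarrow> 'a::linordered_field) set"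
  assumes F: "definably_complete F" and K: "definable F (n + b) K"
    and clo: "clo (n + b) (tuples (n + b)) K"
    and bd: "\<And>z i. z \<in> K \<Longrightarrow> i < b \<Longrightarrow> l i \<le> z (n + i) \<and> z (n + i) \<le> u i"
  shows "clo n (tuples n) (tfst n ` K)"
  using K clo bd
proof (induction b arbitrary: K)
  case 0
  then have "tfst n ` K = K" using definable_tuples[OF 0(1)] by (force simp: image_iff)
  then show ?case using 0 by simp
next
  case (Suc b)
  define K' where "K' = {x \<in> tuples (n + b). \<exists>c. x(n + b := c) \<in> K}"
  have KS: "K \<subseteq> tuples (Suc (n + b))" using definable_tuples[OF Suc.prems(1)] by simp
  have "definable F (n + b) K'"
    using dpred_ex_upd[of F "n + b" "\<lambda>x. x \<in> K"] Suc.prems(1)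
    unfolding K'_def dpred_def[symmetric] by (simp add: definable_iff_dpred)
  moreover have "clo (n + b) (tuples (n + b)) K'"
    unfolding K'_def
    by (rule clo_projection_Suc[OF F, where a = "l b" and b = "u b"]) (use Suc.prems in auto)
  moreover have "l i \<le> z (n + i) \<and> z (n + i) \<le> u i" if z: "z \<in> K'" "i < b" for z i
  proof -
    obtain c where "z(n + b := c) \<in> K" using z by (auto simp: K'_def)
    from Suc.prems(3)[OF this, of i] z show ?thesis by auto
  qed
  ultimately have "clo n (tuples n) (tfst n ` K')" by (rule Suc.IH)
  moreover have "tfst n ` K' = tfst n ` K"
  proof
    have *: "tfst n (x(n + b := c)) = tfst n x" for x :: "nat \<Rightarrow> 'a" and c
      by (rule tuples_eqI[where n = n]) auto
    show "tfst n ` K' \<subseteq> tfst n ` K"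
    proof
      fix y assume "y \<in> tfst n ` K'"
      then obtain x c where "x(n + b := c) \<in> K" "y = tfst n x" by (auto simp: K'_def)
      then show "y \<in> tfst n ` K" using *[of x c] by (metis imageI)
    qed
    show "tfst n ` K \<subseteq> tfst n ` K'"
    proof
      fix y assume "y \<in> tfst n ` K"
      then obtain z where z: "z \<in> K" "y = tfst n z" by blast
      then have e: "(tfst (n + b) z)(n + b := z (n + b)) = z" using KS by (intro tfst_upd_id) auto
      then have "tfst (n + b) z \<in> K'" using z by (auto simp: K'_def intro!: exI[of _ "z (n + b)"])
      moreover have "tfst n (tfst (n + b) z) = y" using z *[of "tfst (n + b) z" "z (n + b)"] e by simp
      ultimately show "y \<in> tfst n ` K'" by blast
    qed
  qed
  ultimately show ?case by simp
qed

lemma definable_image: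
  assumes u: "u \<in> P \<rightarrow> tuples n"
    and gr: "dpred F (n + p) (\<lambda>z. tsnd n p z \<in> P \<and> tfst n z = u (tsnd n p z))"
    and P: "P \<subseteq> tuples p"
  shows "definable F n (u ` P)"
proof -
  have "dpred F n (\<lambda>y. \<exists>x\<in>tuples p. x \<in> P \<and> y = u x)"
    using gr by (intro dpred_bex_tuples)
  then have "dpred F n (\<lambda>y. y \<in> u ` P)"
    by (rule iffD1[OF dpred_cong, rotated]) (use P in blast)
  then show ?thesis using u by (auto simp: definable_iff_dpred)
qed

text \<open>The image is the projection of the graph, written with the value first. The graph over a
  closed set is closed, and the source coordinates, which are projected away, are bounded.\<close>

lemma clo_image:
  fixes P :: "(nat \<Rightarrow> 'a::linordered_field) set"
  assumes F: "definably_complete F"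
    and P: "P \<subseteq> tuples p" "clo p (tuples p) P" "bounded_tuples p P"
    and u: "u \<in> P \<rightarrow> tuples n" "\<And>i. i < n \<Longrightarrow> contn p P (\<lambda>x. u x i)"
    and gr: "dpred F (n + p) (\<lambda>z. tsnd n p z \<in> P \<and> tfst n z = u (tsnd n p z))"
  shows "clo n (tuples n) (u ` P)"
proof -
  define K where "K = {z \<in> tuples (n + p). tsnd n p z \<in> P \<and> tfst n z = u (tsnd n p z)}"
  have "definable F (n + p) K" using gr by (simp add: K_def dpred_def)
  moreover have "clo (n + p) (tuples (n + p)) K"
  proof (rule cloI)
    fix z assume z: "z \<in> tuples (n + p)" "z \<notin> K"
    define x where "x = tsnd n p z"
    define y where "y = tfst n z"
    have split: "near n y (tfst n w) r \<and> near p x (tsnd n p w) r" if "w \<in> K" "near (n + p) z w r" for w r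
    proof -
      have "w \<in> tuples (n + p)" using that by (simp add: K_def)
      then have "tjoin n p y x = z" "tjoin n p (tfst n w) (tsnd n p w) = w"
        using z tjoin_tfst_tsnd unfolding x_def y_def by blast+
      then show ?thesis using near_tjoin[of n p y x "tfst n w" "tsnd n p w" r] that by metis
    qed
    show "\<exists>r>0. \<forall>w\<in>K. \<not> near (n + p) z w r"
    proof (cases "x \<in> P")
      case False
      then obtain r where "r > 0" "\<forall>x'\<in>P. \<not> near p x x' r"
        using cloD[OF P(2), of x] by (auto simp: x_def)
      then show ?thesis using split by (fastforce simp: K_def)
    next
      case True
      have "u x \<noteq> y" using z True by (auto simp: K_def x_def y_def)
      then obtain i where i: "i < n" "u x i \<noteq> y i"
        using tuples_eqI[of "u x" n y] u(1) True by (auto simp: y_def)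
      \<comment> \<open>Half the gap in a coordinate where \<open>z\<close> misses the graph: an
        error below \<open>e\<close> in the value and one below \<open>e\<close> from continuity
        cannot bridge it.\<close>
      define e where "e = \<bar>u x i - y i\<bar> / 2"
      have e: "e > 0" using i by (simp add: e_def)
      obtain r where r: "r > 0" "\<forall>x'\<in>P. near p x x' r \<longrightarrow> \<bar>u x' i - u x i\<bar> < e"
        using contnD[OF u(2)[OF i(1)] True e] by blast
      have "\<not> near (n + p) z w (min r e)" if w: "w \<in> K" for w
      proof
        assume "near (n + p) z w (min r e)"
        then have *: "near n y (tfst n w) (min r e)" "near p x (tsnd n p w) (min r e)"
          using split[OF w] by auto
        have "\<bar>u (tsnd n p w) i - u x i\<bar> < e"
          using r(2) w near_mono[OF *(2), of r] by (auto simp: K_def)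
        moreover have "\<bar>y i - u (tsnd n p w) i\<bar> < e"
        proof -
          have "\<bar>y i - tfst n w i\<bar> < e"
            using near_mono[OF *(1), of e] i(1) unfolding near_def by simp
          then show ?thesis using w by (simp only: K_def mem_Collect_eq)
        qed
        moreover have "\<bar>u x i - y i\<bar> \<le> \<bar>u (tsnd n p w) i - u x i\<bar> + \<bar>y i - u (tsnd n p w) i\<bar>"
          by (simp add: abs_if)
        ultimately show False by (simp add: e_def)
      qed
      then show ?thesis using r e by (intro exI[of _ "min r e"]) auto
    qed
  qed (auto simp: K_def)
  moreover obtain l v where "\<forall>x\<in>P. \<forall>i<p. l i \<le> x i \<and> x i \<le> v i"
    using P(3) by (auto simp: bounded_tuples_def)
  then have "l i \<le> z (n + i) \<and> z (n + i) \<le> v i" if "z \<in> K" "i < p" for z i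
    using that by (auto simp: K_def dest: bspec[of P _ "tsnd n p z"])
  ultimately have "clo n (tuples n) (tfst n ` K)" by (intro clo_projection[OF F])
  moreover have "tfst n ` K = u ` P"
  proof
    show "tfst n ` K \<subseteq> u ` P" by (auto simp: K_def)
    show "u ` P \<subseteq> tfst n ` K"
    proof
      fix y assume "y \<in> u ` P"
      then obtain x where x: "x \<in> P" "y = u x" by blast
      then have "y \<in> tuples n" "x \<in> tuples p" using u P by auto
      then have "tjoin n p y x \<in> K" "tfst n (tjoin n p y x) = y" using x by (auto simp: K_def)
      then show "y \<in> tfst n ` K" by force
    qed
  qed
  ultimately show ?thesis by simp
qed

section \<open>Extension of continuous functions\<close>

text \<open>For \<open>f = 1\<close> this is the distance to \<open>A\<close>, capped at 2.\<close>

definition wdist_set ::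
  "nat \<Rightarrow> (nat \<Rightarrow> 'a::linordered_field) set \<Rightarrow> ((nat \<Rightarrow> 'a) \<Rightarrow> 'a) \<Rightarrow> (nat \<Rightarrow> 'a) \<Rightarrow> 'a \<Rightarrow> bool" where
  "wdist_set m A f x c \<longleftrightarrow> c = 2 \<or> (\<exists>a\<in>A. \<exists>r. 0 < r \<and> near m a x r \<and> c = f a * r)"

definition wdist ::
  "nat \<Rightarrow> (nat \<Rightarrow> 'a::linordered_field) set \<Rightarrow> ((nat \<Rightarrow> 'a) \<Rightarrow> 'a) \<Rightarrow> (nat \<Rightarrow> 'a) \<Rightarrow> 'a" where
  "wdist m A f x = glb {c. wdist_set m A f x c}"

context
  fixes F :: "('a::linordered_field, 'f, 'r) expansion" and m A f
  assumes complete: "definably_complete F"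
    and A: "definable F m A"
    and f: "dscal F m f" "\<And>a. a \<in> A \<Longrightarrow> 1 \<le> f a" "\<And>a. a \<in> A \<Longrightarrow> f a \<le> 2"
begin

lemma dpred_wdist_set: "dpred F (Suc m) (\<lambda>z. wdist_set m A f (tfst m z) (z m))"
  unfolding wdist_set_def
proof (rule dpred_disj)
  have *: "dscal F N (\<lambda>z. f (u z))" if "dvec F N m u" for N u
    using dscal_subst[OF f(1) that] .
  show "dpred F (Suc m) (\<lambda>z. \<exists>a\<in>A. \<exists>r. 0 < r \<and> near m a (tfst m z) r \<and> z m = f a * r)"
    by (rule dpred_bex[OF A]) (rule def_intros * | simp)+
qed (rule def_intros | simp)+

lemma weight_nonneg: "a \<in> A \<Longrightarrow> 0 < r \<Longrightarrow> 0 \<le> f a * r"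
  using order_trans[OF zero_le_one f(2)] by (intro mult_nonneg_nonneg) auto

text \<open>The cap 2 keeps the set nonempty even when \<open>A\<close> is empty, and 0 is a lower
  bound because the weights are positive.\<close>

lemma wdist_isglb: "x \<in> tuples m \<Longrightarrow> isglb {c. wdist_set m A f x c} (wdist m A f x)"
  unfolding wdist_def
proof (rule complete_glb_fibre[where b = 0 and a = 2, OF complete dpred_wdist_set])
  show "0 \<le> c" if "wdist_set m A f x c" for c
    using that weight_nonneg unfolding wdist_set_def by auto
qed (auto simp: wdist_set_def)

lemma wdist_le_2: "x \<in> tuples m \<Longrightarrow> wdist m A f x \<le> 2"
  using isglb_le[OF wdist_isglb, of x 2] by (simp add: wdist_set_def)

lemma wdist_le: "x \<in> tuples m \<Longrightarrow> a \<in> A \<Longrightarrow> 0 < r \<Longrightarrow> near m a x r \<Longrightarrow> wdist m A f x \<le> f a * r"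
  by (rule isglb_le[OF wdist_isglb]) (auto simp: wdist_set_def)

lemma wdist_ge:
  assumes "x \<in> tuples m" "u \<le> 2" "\<And>a r. a \<in> A \<Longrightarrow> 0 < r \<Longrightarrow> near m a x r \<Longrightarrow> u \<le> f a * r"
  shows "u \<le> wdist m A f x"
  by (rule isglb_greatest[OF wdist_isglb[OF assms(1)]]) (use assms(2,3) in \<open>auto simp: wdist_set_def\<close>)

lemma wdist_nonneg: "x \<in> tuples m \<Longrightarrow> 0 \<le> wdist m A f x"
  by (rule wdist_ge) (auto simp: weight_nonneg)

lemma dscal_wdist: "dscal F m (wdist m A f)"
  by (rule dscal_glb[where D = "\<lambda>_. True", OF dpred_const dpred_wdist_set]) (auto simp: wdist_isglb)

text \<open>Moving the point by \<open>d\<close> enlarges an admissible radius by \<open>d\<close>,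
  which costs at most \<open>2 * d\<close> because the weights do not exceed 2.\<close>

lemma wdist_lipschitz:
  assumes x: "x \<in> tuples m" and y: "y \<in> tuples m" and d: "0 < d" "near m x y d"
  shows "wdist m A f y \<le> wdist m A f x + 2 * d"
proof -
  have "wdist m A f y - 2 * d \<le> wdist m A f x"
  proof (rule wdist_ge[OF x])
    show "wdist m A f y - 2 * d \<le> 2" using wdist_le_2[OF y] d(1) by linarith
    fix a r assume a: "a \<in> A" "0 < r" "near m a x r"
    have "wdist m A f y \<le> f a * (r + d)"
      using a d near_trans by (intro wdist_le[OF y]) auto
    also have "\<dots> \<le> f a * r + 2 * d"
      using f(3)[OF a(1)] d(1) by (simp add: distrib_left)
    finally show "wdist m A f y - 2 * d \<le> f a * r" by simp
  qed
  then show ?thesis by simp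
qed

lemma contn_wdist:
  assumes "Z \<subseteq> tuples m"
  shows "contn m Z (wdist m A f)"
  unfolding contn_def
proof (intro ballI allI impI)
  fix x e assume x: "x \<in> Z" and e: "e > (0::'a)"
  have "\<bar>wdist m A f y - wdist m A f x\<bar> < e" if "y \<in> Z" "near m x y (e / 4)" for y
  proof -
    have "wdist m A f y \<le> wdist m A f x + 2 * (e / 4)"
      using x that e assms by (intro wdist_lipschitz) auto
    moreover have "wdist m A f x \<le> wdist m A f y + 2 * (e / 4)"
      using x that e assms by (intro wdist_lipschitz) (auto simp: near_sym[of m y x])
    moreover have "2 * (e / 4) < e" using e by (simp add: field_simps)
    ultimately show ?thesis unfolding abs_less_iff by linarith
  qed
  then show "\<exists>r>0. \<forall>y\<in>Z. near m x y r \<longrightarrow> \<bar>wdist m A f y - wdist m A f x\<bar> < e"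
    using e by (intro exI[of _ "e / 4"]) auto
qed

lemma wdist_eq_0_iff:
  assumes T: "T \<subseteq> tuples m" "clo m T A" and x: "x \<in> T"
  shows "wdist m A f x = 0 \<longleftrightarrow> x \<in> A"
proof
  assume xA: "x \<in> A"
  show "wdist m A f x = 0"
  proof (rule ccontr)
    assume "wdist m A f x \<noteq> 0"
    then have pos: "wdist m A f x > 0" using wdist_nonneg[of x] T x by force
    \<comment> \<open>The point \<open>x\<close> itself competes, with any positive radius. A
      quarter of the supposed value, times a weight of at most 2, is too small.\<close>
    have "wdist m A f x \<le> f x * (wdist m A f x / 4)"
      using pos xA T x by (intro wdist_le near_refl) auto
    also have "\<dots> \<le> 2 * (wdist m A f x / 4)" using f(3)[OF xA] pos by (intro mult_right_mono) auto
    finally show False using pos by linarith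
  qed
next
  assume 0: "wdist m A f x = 0"
  show "x \<in> A"
  proof (rule ccontr)
    assume "x \<notin> A"
    then obtain r where r: "r > 0" "\<And>a. a \<in> A \<Longrightarrow> \<not> near m x a r" using cloD[OF T(2) x] by blast
    \<comment> \<open>A ball of radius \<open>r\<close> about \<open>x\<close> misses
      \<open>A\<close>, and weights are at least 1; the 2 accounts for the cap.\<close>
    have "min 2 r \<le> wdist m A f x"
    proof (rule wdist_ge)
      fix a s assume a: "a \<in> A" "0 < s" "near m a x s"
      have "r < s" using r(2)[OF a(1)] near_mono[OF a(3), of r] near_sym linorder_not_less by blast
      also have "s \<le> f a * s" using f(2)[OF a(1)] a(2) by (simp add: mult_le_cancel_right1)
      finally show "min 2 r \<le> f a * s" by simp
    qed (use T x in auto)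
    then show False using 0 r(1) by simp
  qed
qed

end

text \<open>Hausdorff's formula for the Tietze extension.\<close>

lemma tietze:
  fixes F :: "('a::linordered_field, 'f, 'r) expansion"
  assumes complete: "definably_complete F"
    and T: "T \<subseteq> tuples m" and A: "definable F m A" and clo: "clo m T A"
    and f: "dscal F m f" "\<And>a. a \<in> A \<Longrightarrow> 1 \<le> f a" "\<And>a. a \<in> A \<Longrightarrow> f a \<le> 2" "contn m A f"
  shows "\<exists>k. dscal F m k \<and> contn m T k \<and> (\<forall>x\<in>A. k x = f x)"
proof -
  define d where "d = wdist m A (\<lambda>_. 1)"
  define N where "N = wdist m A f"
  define k where "k x = (if x \<in> A then f x else N x / d x)" for x
  note fd = complete A f(1-3)
  have gd: "dscal F m (\<lambda>_. 1)" "(1::'a) \<le> 1" "(1::'a) \<le> 2"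
    by (simp_all add: dscal_const)
  note gd = complete A gd
  have dpos: "d x > 0" if "x \<in> T" "x \<notin> A" for x
    using wdist_eq_0_iff[OF gd T clo that(1)] wdist_nonneg[OF gd, of x] T that
    by (force simp: d_def)
  have "dscal F m k"
    unfolding k_def d_def N_def using A
    by (intro dscal_if dscal_divide dscal_wdist[OF fd] dscal_wdist[OF gd] f(1))
      (simp add: definable_iff_dpred)
  moreover have "contn m T k"
    unfolding contn_def
  proof (intro ballI allI impI)
    fix x e assume x: "x \<in> T" and e: "e > (0::'a)"
    show "\<exists>r>0. \<forall>y\<in>T. near m x y r \<longrightarrow> \<bar>k y - k x\<bar> < e"
    proof (cases "x \<in> A")
      case False
      obtain r where r: "r > 0" "\<And>a. a \<in> A \<Longrightarrow> \<not> near m x a r" using cloD[OF clo x False] by blast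
      have "contn m (T - A) (\<lambda>x. N x / d x)"
        unfolding N_def using T dpos
        by (intro contn_divide contn_wdist[OF fd]) (auto simp: d_def intro!: contn_wdist[OF gd])
      then obtain s where s: "s > 0"
        "\<And>y. y \<in> T - A \<Longrightarrow> near m x y s \<Longrightarrow> \<bar>N y / d y - N x / d x\<bar> < e"
        using contnD[of m "T - A" "\<lambda>x. N x / d x" x e] x False e by blast
      have "\<bar>k y - k x\<bar> < e" if "y \<in> T" "near m x y (min r s)" for y
      proof -
        have "y \<notin> A" using r(2) near_mono[OF that(2), of r] by auto
        then show ?thesis using s(2)[of y] near_mono[OF that(2), of s] that False by (simp add: k_def)
      qed
      then show ?thesis using r s by (intro exI[of _ "min r s"]) auto
    next
      case True
      \<comment> \<open>At a point of \<open>A\<close> the idea is that, for \<open>y\<close> near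
        \<open>x\<close>, only points of \<open>A\<close> with \<open>f a\<close> close to
        \<open>f x\<close> influence \<open>N y\<close>, so \<open>N y / d y\<close> is close to
        \<open>f x\<close>. The errors sum to one \<open>e'\<close> below and two above, less than
        \<open>e\<close> in both cases.\<close>
      define e' where "e' = e / 4"
      have e': "e' > 0" using e by (simp add: e'_def)
      obtain D where D: "D > 0" "\<And>a. a \<in> A \<Longrightarrow> near m x a D \<Longrightarrow> \<bar>f a - f x\<bar> < e'"
        using contnD[OF f(4) True e'] by blast
      \<comment> \<open>The factor 8 leaves room: radii up to \<open>D / 2\<close> about
        \<open>y\<close> stay within \<open>D\<close> of \<open>x\<close>, twice \<open>d y\<close>
        stays below \<open>D / 2\<close>, and the caps are never reached.\<close>
      define s where "s = min (D / 8) (1 / 8)"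
      have s: "s > 0" "s \<le> D / 8" "s \<le> 1 / 8" using D(1) by (auto simp: s_def)
      have fx: "1 \<le> f x" "f x \<le> 2" using f True by auto
      have "\<bar>k y - k x\<bar> < e" if y: "y \<in> T" "near m x y s" for y
      proof (cases "y \<in> A")
        case yA: True
        have "near m x y D" using near_mono[OF y(2)] s D(1) by simp
        then have "\<bar>f y - f x\<bar> < e'" using D(2) yA by blast
        also have "e' < e" using e by (simp add: e'_def)
        finally show ?thesis using yA True by (simp add: k_def)
      next
        case yA: False
        have yt: "y \<in> tuples m" using y T by auto
        have dy: "d y > 0" using dpos[OF y(1) yA] .
        have ds: "d y \<le> s"
          using wdist_le[OF gd yt True s(1) y(2)] by (simp add: d_def)
        have nearD: "near m x a D" if "near m a y r" "r \<le> D / 2" for a r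
        proof (rule near_mono[OF near_trans[OF y(2), of a r]])
          show "near m y a r" using that(1) near_sym by blast
          show "s + r \<le> D" using s(2) that(2) D(1) by linarith
        qed
        \<comment> \<open>Near points of \<open>A\<close> have weight above \<open>f x - e'\<close>.
          For points with radius above \<open>D / 2\<close> the product exceeds
          \<open>2 * d y\<close>, which is already enough because
          \<open>f x - e' \<le> 2\<close>.\<close>
        have lower: "(f x - e') * d y \<le> N y"
          unfolding N_def
        proof (rule wdist_ge[OF fd yt])
          have "(f x - e') * d y \<le> 2 * 1"
            using fx e' dy ds s by (intro mult_mono) auto
          then show "(f x - e') * d y \<le> 2" by simp
          fix a r assume a: "a \<in> A" "0 < r" "near m a y r"
          have dr: "d y \<le> r" using wdist_le[OF gd yt a] by (simp add: d_def)
          show "(f x - e') * d y \<le> f a * r"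
          proof (cases "r \<le> D / 2")
            case True
            have "\<bar>f a - f x\<bar> < e'" using D(2)[OF a(1) nearD[OF a(3) True]] .
            then have "- (f a - f x) < e'" by (simp only: abs_less_iff)
            then have "(f x - e') \<le> f a" by linarith
            then have "(f x - e') * d y \<le> f a * d y" using dy by (intro mult_right_mono) auto
            also have "\<dots> \<le> f a * r" using dr f(2)[OF a(1)] by (intro mult_left_mono) auto
            finally show ?thesis .
          next
            case False
            have "(f x - e') * d y \<le> 2 * d y" using fx e' dy by (intro mult_right_mono) auto
            also have "\<dots> \<le> r" using False ds s(2) D(1) by linarith
            also have "r \<le> f a * r" using f(2)[OF a(1)] a(2) by (simp add: mult_le_cancel_right1)
            finally show ?thesis .
          qed
        qed
        \<comment> \<open>The infimum \<open>d y\<close> need not be attained, so a radius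
          \<open>c\<close> within the factor \<open>1 + t\<close> of it is used; \<open>t\<close> is
          chosen so that \<open>(2 + e') * t = e'\<close> absorbs the loss.\<close>
        define t where "t = e' / (2 + e')"
        have t: "0 < t" "t \<le> 1" using e' by (auto simp: t_def field_simps)
        have "d y < d y * (1 + t)" using dy t by (simp add: distrib_left)
        then obtain c where c: "wdist_set m A (\<lambda>_. 1) y c" "c < d y * (1 + t)"
          using isglb_less[OF wdist_isglb[OF gd yt]] by (auto simp: d_def)
        have dt: "d y * (1 + t) \<le> 2 * d y" using dy t by (simp add: distrib_left)
        have "c < 2" using c(2) dt ds s(3) by linarith
        then obtain a where a: "a \<in> A" "0 < c" "near m a y c"
          using c(1) by (auto simp: wdist_set_def)
        have "c \<le> D / 2" using c(2) dt ds s(2) D(1) by linarith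
        then have "\<bar>f a - f x\<bar> < e'" using D(2)[OF a(1) nearD[OF a(3)]] by blast
        then have "f a - f x < e'" by (simp only: abs_less_iff)
        then have fa: "f a \<le> f x + e'" by linarith
        have "N y \<le> f a * c" unfolding N_def by (rule wdist_le[OF fd yt a])
        also have "\<dots> \<le> (f x + e') * (d y * (1 + t))"
          using fa c(2) a(2) fx e' by (intro mult_mono) auto
        also have "\<dots> = (f x + e' + (f x + e') * t) * d y" by (simp add: algebra_simps)
        also have "\<dots> \<le> (f x + e' + (2 + e') * t) * d y"
          using fx t dy by (intro mult_right_mono add_left_mono) auto
        also have "(2 + e') * t = e'" using e' by (simp add: t_def)
        finally have upper: "N y \<le> (f x + e' + e') * d y" .
        have "N y / d y \<le> f x + e' + e'" "f x - e' \<le> N y / d y"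
          using upper lower dy by (auto simp: pos_divide_le_eq pos_le_divide_eq)
        moreover have "e = 4 * e'" by (simp add: e'_def)
        ultimately show ?thesis using True yA e' unfolding k_def abs_less_iff by auto
      qed
      then show ?thesis using s by blast
    qed
  qed
  ultimately show ?thesis by (intro exI[of _ k]) (auto simp: k_def)
qed

lemma dist_function:
  fixes F :: "('a::linordered_field, 'f, 'r) expansion"
  assumes "definably_complete F" "T \<subseteq> tuples m" "definable F m A" "clo m T A"
  shows "\<exists>d. dscal F m d \<and> contn m T d \<and> (\<forall>x\<in>T. d x = 0 \<longleftrightarrow> x \<in> A)"
proof -
  have gd: "dscal F m (\<lambda>_. 1)" "(1::'a) \<le> 1" "(1::'a) \<le> 2"
    by (simp_all add: dscal_const)
  note gd = assms(1,3) gd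
  show ?thesis
    using dscal_wdist[OF gd] contn_wdist[OF gd assms(2)] wdist_eq_0_iff[OF gd assms(2,4)] by blast
qed

text \<open>An increasing compression of the line onto the open interval from 1 to 2, so that
  \<open>tietze\<close> applies to unbounded functions. Its injectivity preserves the separation of
  orbits.\<close>

definition squeeze :: "'a::linordered_field \<Rightarrow> 'a" where
  "squeeze t = (3 + t / (1 + \<bar>t\<bar>)) / 2"

lemma squeeze_bounds: "1 \<le> squeeze t" "squeeze t \<le> 2"
proof -
  have "-1 \<le> t / (1 + \<bar>t\<bar>)" "t / (1 + \<bar>t\<bar>) \<le> 1"
    by (simp_all add: pos_le_divide_eq pos_divide_le_eq add_pos_nonneg abs_if)
  then show "1 \<le> squeeze t" "squeeze t \<le> 2" by (auto simp: squeeze_def)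
qed

lemma squeeze_eq_iff: "squeeze s = squeeze t \<longleftrightarrow> s = t"
proof
  assume "squeeze s = squeeze t"
  then have eq: "s / (1 + \<bar>s\<bar>) = t / (1 + \<bar>t\<bar>)"
    unfolding squeeze_def by (metis add_left_cancel divide_cancel_right zero_neq_numeral)
  have pos: "1 + \<bar>u\<bar> > 0" for u :: 'a by (simp add: add_pos_nonneg)
  have st: "s * (1 + \<bar>t\<bar>) = t * (1 + \<bar>s\<bar>)"
    using eq pos[of s] pos[of t] by (simp add: frac_eq_eq)
  \<comment> \<open>Equal signs give \<open>s * \<bar>t\<bar> = t * \<bar>s\<bar>\<close>, and these
    terms cancel from the cross-multiplied equation.\<close>
  have "sgn s = sgn t"
  proof -
    have "sgn (s * (1 + \<bar>t\<bar>)) = sgn (t * (1 + \<bar>s\<bar>))" using st by simp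
    then show ?thesis using pos[of s] pos[of t] by (simp add: sgn_mult)
  qed
  then have "s * \<bar>t\<bar> = t * \<bar>s\<bar>"
    by (metis abs_mult_sgn mult.assoc mult.commute)
  then show "s = t" using st by (simp add: distrib_left)
qed simp

lemma dscal_squeeze: "dscal F n h \<Longrightarrow> dscal F n (\<lambda>x. squeeze (h x))"
  unfolding squeeze_def by (intro dscal_divide dscal_add dscal_abs dscal_const)

lemma contn_squeeze: "contn n Z h \<Longrightarrow> contn n Z (\<lambda>x. squeeze (h x))"
  unfolding squeeze_def by (intro contn_divide contn_add contn_abs contn_const) (auto simp: add_pos_nonneg)

section \<open>Quotients by equivalence relations with closed and open saturations\<close>

text \<open>The last assumption says that \<open>X\<close> is open in its closure: points of the
  closure that are close enough to \<open>x\<close> belong to \<open>X\<close>.\<close>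

locale locally_closed_set =
  fixes F :: "('a::linordered_field, 'f, 'r) expansion" and m :: nat and X :: "(nat \<Rightarrow> 'a) set"
  assumes complete: "definably_complete F"
    and X: "definable F m X"
    and locally_closed: "x \<in> X \<Longrightarrow> \<exists>r>0. \<forall>y\<in>tuples m. near m x y r \<longrightarrow>
      (\<forall>s>0. \<exists>z\<in>X. near m y z s) \<longrightarrow> y \<in> X"
begin

lemma X_tuples: "x \<in> X \<Longrightarrow> x \<in> tuples m"
  using definable_tuples[OF X] by blast

text \<open>This is cl(X) - X, in general smaller than the topological boundary. Local closedness
  gives each point of \<open>X\<close> a positive distance to it.\<close>

definition boundary :: "(nat \<Rightarrow> 'a) set" where
  "boundary = {y \<in> tuples m. y \<notin> X \<and> (\<forall>r. 0 < r \<longrightarrow> (\<exists>x\<in>X. near m x y r))}"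

lemma definable_boundary: "definable F m boundary"
proof -
  have "dpred F m (\<lambda>y. y \<notin> X \<and> (\<forall>r. 0 < r \<longrightarrow> (\<exists>x\<in>X. near m x y r)))"
    by (rule def_intros dpred_mem[OF X] dpred_bex[OF X] | simp)+
  then show ?thesis unfolding boundary_def dpred_def .
qed

text \<open>An exhaustion of \<open>X\<close> by definably compact sets.\<close>

definition Kc :: "'a \<Rightarrow> (nat \<Rightarrow> 'a) set" where
  "Kc c = {x \<in> X. (\<forall>i<m. \<bar>x i\<bar> \<le> c) \<and> (\<forall>y\<in>boundary. \<exists>i<m. 1 \<le> c * \<bar>x i - y i\<bar>)}"

lemma dpred_Kc:
  assumes u: "dvec F n m u" and s: "dscal F n s"
  shows "dpred F n (\<lambda>z. u z \<in> Kc (s z))"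
  unfolding Kc_def mem_Collect_eq
  by (rule dscal_subst[OF s] dvec_subst[OF u] u s def_intros dpred_mem[OF X] dpred_ball[OF definable_boundary] | simp)+

lemma definable_Kc: "definable F m (Kc c)"
proof -
  have "dpred F m (\<lambda>z. z \<in> Kc c)" by (rule dpred_Kc def_intros)+
  then show ?thesis using X_tuples by (auto simp: definable_iff_dpred Kc_def)
qed

lemma Kc_subset: "Kc c \<subseteq> X"
  by (auto simp: Kc_def)

lemma Kc_mono:
  assumes "c \<le> c'" "x \<in> Kc c"
  shows "x \<in> Kc c'"
proof -
  have "\<exists>i<m. 1 \<le> c' * \<bar>x i - y i\<bar>" if y: "y \<in> boundary" for y
  proof -
    obtain i where "i < m" "1 \<le> c * \<bar>x i - y i\<bar>" using y assms(2) by (auto simp: Kc_def)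
    moreover have "c * \<bar>x i - y i\<bar> \<le> c' * \<bar>x i - y i\<bar>" using assms(1) by (intro mult_right_mono) auto
    ultimately show ?thesis by (meson order_trans)
  qed
  then show ?thesis using assms by (auto simp: Kc_def intro: order_trans)
qed

lemma Kc_cover:
  assumes "x \<in> X"
  shows "\<exists>c>0. x \<in> Kc c"
proof -
  obtain r where r: "r > 0" "\<And>y. y \<in> tuples m \<Longrightarrow> near m x y r \<Longrightarrow> (\<forall>s>0. \<exists>z\<in>X. near m y z s) \<Longrightarrow> y \<in> X"
    using locally_closed[OF assms] by blast
  define b where "b = (\<Sum>i<m. \<bar>x i\<bar>)"
  have b: "0 \<le> b" "\<bar>x i\<bar> \<le> b" if "i < m" for i
    using that unfolding b_def by (auto intro: sum_nonneg member_le_sum)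
  have b0: "0 \<le> b" by (simp add: b_def sum_nonneg)
  \<comment> \<open>The summand \<open>b\<close> bounds all coordinates of \<open>x\<close>, and
    \<open>1 / r\<close> takes care of the distance to \<open>boundary\<close>, which is at least
    \<open>r\<close>.\<close>
  define c where "c = b + 1 / r"
  have c: "c > 0" "b \<le> c" "1 / r \<le> c" using b0 r(1) by (auto simp: c_def add_nonneg_pos)
  have "\<exists>i<m. 1 \<le> c * \<bar>x i - y i\<bar>" if y: "y \<in> boundary" for y
  proof -
    have "\<not> near m x y r" using r(2)[of y] y near_sym unfolding boundary_def by blast
    then obtain i where i: "i < m" "r \<le> \<bar>x i - y i\<bar>" by (auto simp: near_def not_less)
    have "1 = 1 / r * r" using r(1) by simp
    also have "\<dots> \<le> c * \<bar>x i - y i\<bar>" using i c r(1) by (intro mult_mono) auto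
    finally show ?thesis using i(1) by blast
  qed
  then have "x \<in> Kc c" using assms b(2) c(2) by (auto simp: Kc_def intro: order_trans)
  then show ?thesis using c(1) by blast
qed

lemma Kc_interior:
  assumes "0 < c" "c < c'"
  shows "\<exists>d>0. \<forall>x\<in>Kc c. \<forall>y\<in>X. near m x y d \<longrightarrow> y \<in> Kc c'"
proof -
  \<comment> \<open>The two terms are the slack in the bound on the coordinates and in the distance
    to \<open>boundary\<close>; neither depends on the point of \<open>Kc c\<close>.\<close>
  define d where "d = min (c' - c) (1 / c - 1 / c')"
  have "1 / c' < 1 / c" using assms by (intro divide_strict_left_mono) auto
  then have d: "d > 0" "d \<le> c' - c" "d \<le> 1 / c - 1 / c'" using assms by (auto simp: d_def)
  have "y \<in> Kc c'" if x: "x \<in> Kc c" and y: "y \<in> X" "near m x y d" for x y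
  proof -
    have xy: "\<bar>x i - y i\<bar> < d" if "i < m" for i using y that by (auto simp: near_def)
    have "\<bar>y i\<bar> \<le> c'" if i: "i < m" for i
    proof -
      have "\<bar>y i\<bar> \<le> \<bar>x i\<bar> + \<bar>x i - y i\<bar>" by (simp add: abs_if)
      moreover have "\<bar>x i\<bar> \<le> c" using x i by (auto simp: Kc_def)
      ultimately show ?thesis using xy[OF i] d(2) by linarith
    qed
    moreover have "\<exists>i<m. 1 \<le> c' * \<bar>y i - w i\<bar>" if w: "w \<in> boundary" for w
    proof -
      obtain i where i: "i < m" "1 \<le> c * \<bar>x i - w i\<bar>" using x w by (auto simp: Kc_def)
      have "1 / c \<le> \<bar>x i - w i\<bar>" using i(2) assms by (simp add: pos_divide_le_eq mult.commute)
      moreover have "\<bar>x i - w i\<bar> \<le> \<bar>x i - y i\<bar> + \<bar>y i - w i\<bar>"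
        using abs_triangle_ineq[of "x i - y i" "y i - w i"] by simp
      ultimately have "1 / c' \<le> \<bar>y i - w i\<bar>" using xy[OF i(1)] d(3) by linarith
      then have "1 \<le> c' * \<bar>y i - w i\<bar>" using assms by (simp add: pos_divide_le_eq mult.commute)
      then show ?thesis using i(1) by blast
    qed
    ultimately show ?thesis using y(1) by (auto simp: Kc_def)
  qed
  then show ?thesis using d(1) by blast
qed

lemma clo_Kc:
  assumes c: "0 < c"
  shows "clo m (tuples m) (Kc c)"
proof (rule cloI)
  show "Kc c \<subseteq> tuples m" using Kc_subset X_tuples by blast
  fix x assume xt: "x \<in> tuples m" and x: "x \<notin> Kc c"
  have fr: "\<not> near m y x (1 / c)" if xy: "x \<in> boundary" "y \<in> Kc c" for x y
  proof -
    obtain i where i: "i < m" "1 \<le> c * \<bar>y i - x i\<bar>" using xy by (auto simp: Kc_def)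
    have "1 / c \<le> \<bar>y i - x i\<bar>" using i(2) c by (simp add: pos_divide_le_eq mult.commute)
    then show ?thesis using i(1) by (auto simp: near_def not_less)
  qed
  have "x \<notin> X \<or> (\<exists>i<m. c < \<bar>x i\<bar>) \<or> (\<exists>y\<in>boundary. \<forall>i<m. c * \<bar>x i - y i\<bar> < 1)"
    using x by (auto simp: Kc_def not_le)
  \<comment> \<open>The cases are: a point off the closure of \<open>X\<close>, a point of
    \<open>boundary\<close>, from which \<open>Kc c\<close> keeps distance \<open>1 / c\<close>, a
    point with a large coordinate, and a point closer than \<open>1 / c\<close> to
    \<open>boundary\<close>.\<close>
  then consider "x \<notin> X" "x \<notin> boundary" | "x \<in> boundary" | i where "i < m" "c < \<bar>x i\<bar>"
    | y where "y \<in> boundary" "\<forall>i<m. c * \<bar>x i - y i\<bar> < 1"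
    by blast
  then show "\<exists>r>0. \<forall>y\<in>Kc c. \<not> near m x y r"
  proof cases
    case 1
    then obtain r where "r > 0" "\<forall>y\<in>X. \<not> near m y x r" using xt by (auto simp: boundary_def)
    then show ?thesis using Kc_subset near_sym by blast
  next
    case 2
    then show ?thesis using fr[OF 2] c by (intro exI[of _ "1 / c"]) (auto simp: near_sym[of m x])
  next
    case (3 i)
    have "\<not> near m x y (\<bar>x i\<bar> - c)" if "y \<in> Kc c" for y
    proof
      assume "near m x y (\<bar>x i\<bar> - c)"
      then have "\<bar>x i - y i\<bar> < \<bar>x i\<bar> - c" using 3 by (auto simp: near_def)
      moreover have "\<bar>y i\<bar> \<le> c" using that 3 by (auto simp: Kc_def)
      moreover have "\<bar>x i\<bar> \<le> \<bar>x i - y i\<bar> + \<bar>y i\<bar>" by (simp add: abs_if)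
      ultimately show False by linarith
    qed
    then show ?thesis using 3 by (intro exI[of _ "\<bar>x i\<bar> - c"]) auto
  next
    case (4 y)
    have "near m x y (1 / c)"
      using 4(2) c by (auto simp: near_def pos_less_divide_eq mult.commute)
    then obtain r where r: "r > 0" "\<And>z. near m x z r \<Longrightarrow> near m z y (1 / c)"
      using near_open by blast
    then show ?thesis using fr[OF 4(1)] by blast
  qed
qed

lemma bounded_Kc: "bounded_tuples m (Kc c)"
  unfolding bounded_tuples_def
  by (intro exI[of _ "\<lambda>_. - c"] exI[of _ "\<lambda>_. c"]) (auto simp: Kc_def abs_le_iff minus_le_iff)

end

text \<open>What the construction uses of a proper action: properness will yield the closed
  saturations of definably compact sets, continuity of the translations the open
  saturations.\<close>

locale orbit_space = locally_closed_set F m X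
  for F :: "('a::linordered_field, 'f, 'r) expansion" and m X +
  fixes E :: "((nat \<Rightarrow> 'a) \<times> (nat \<Rightarrow> 'a)) set"
  assumes E: "equiv X E"
    and definable_E: "dpred F (m + m) (\<lambda>z. (tfst m z, tsnd m m z) \<in> E)"
    and saturation_clo_compact: "definable F m K \<Longrightarrow> K \<subseteq> X \<Longrightarrow> clo m (tuples m) K \<Longrightarrow>
      bounded_tuples m K \<Longrightarrow> clo m X (E `` K)"
    and saturation_opn: "definable F m V \<Longrightarrow> opn m X V \<Longrightarrow> opn m X (E `` V)"
begin

lemma E_refl: "x \<in> X \<Longrightarrow> (x, x) \<in> E"
  using E by (auto simp: equiv_def refl_on_def)

lemma E_sym: "(x, y) \<in> E \<Longrightarrow> (y, x) \<in> E"
  using E by (auto simp: equiv_def sym_def)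

lemma E_trans: "(x, y) \<in> E \<Longrightarrow> (y, z) \<in> E \<Longrightarrow> (x, z) \<in> E"
  using E unfolding equiv_def by (meson transD)

lemma E_X: "(x, y) \<in> E \<Longrightarrow> x \<in> X \<and> y \<in> X"
  using E by (auto simp: equiv_def)

lemma dpred_E:
  assumes "dvec F n m u" "dvec F n m v"
  shows "dpred F n (\<lambda>z. (u z, v z) \<in> E)"
proof -
  have uv: "u z \<in> tuples m" "v z \<in> tuples m" if "z \<in> tuples n" for z
    using assms that by (auto simp: dvec_def)
  show ?thesis
    using dpred_subst[OF definable_E dvec_tjoin[OF assms]]
    by (rule iffD1[OF dpred_cong, rotated]) (simp add: uv)
qed

lemma definable_saturation:
  assumes "definable F m C"
  shows "definable F m (E `` C)"
proof -
  have "dpred F m (\<lambda>y. \<exists>x\<in>C. (x, y) \<in> E)"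
    by (rule dpred_bex[OF assms]) (rule def_intros dpred_E | simp)+
  then have "definable F m {y. \<exists>x\<in>C. (x, y) \<in> E}"
    using E_X X_tuples by (intro definable_Collect) auto
  then show ?thesis by (simp add: Image_def)
qed

section \<open>The gauge of an orbit and closed saturations\<close>

lemma clo_saturation_Int_Kc:
  assumes "definable F m C" "clo m X C" "0 < c"
  shows "clo m X (E `` (C \<inter> Kc c))"
proof (rule saturation_clo_compact)
  show "definable F m (C \<inter> Kc c)" using assms definable_Kc definable_Int by blast
  show "clo m (tuples m) (C \<inter> Kc c)"
    using clo_trans[OF clo_Kc[OF assms(3)] clo_restrict[OF assms(2) Kc_subset]] .
  show "bounded_tuples m (C \<inter> Kc c)"
    using bounded_Kc[of c] by (auto simp: bounded_tuples_def)
qed (use Kc_subset in blast)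

lemma clo_saturation_Kc: "0 < c \<Longrightarrow> clo m X (E `` Kc c)"
  using clo_saturation_Int_Kc[OF X clo_self] Kc_subset by (simp add: Int_absorb1)

text \<open>This is \<nu>: how far out in the exhaustion one must go to meet the orbit of
  \<open>x\<close>. The value 0 off \<open>X\<close> is a default.\<close>

definition gauge :: "(nat \<Rightarrow> 'a) \<Rightarrow> 'a" where
  "gauge x = (if x \<in> X then glb {c. 0 < c \<and> x \<in> E `` Kc c} else 0)"

lemma dpred_gauge_set: "dpred F (Suc m) (\<lambda>z. 0 < z m \<and> tfst m z \<in> E `` Kc (z m))"
proof -
  have "dpred F (Suc m) (\<lambda>z. 0 < z m \<and> (\<exists>y\<in>X. y \<in> Kc (z m) \<and> (y, tfst m z) \<in> E))"
    by (rule def_intros dpred_Kc dpred_E dpred_bex[OF X] | simp)+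
  then show ?thesis
    by (rule iffD1[OF dpred_cong, rotated]) (use Kc_subset in \<open>auto simp: Image_def\<close>)
qed

lemma gauge_isglb:
  assumes "x \<in> X"
  shows "isglb {c. 0 < c \<and> x \<in> E `` Kc c} (gauge x)"
proof -
  obtain c where "0 < c" "x \<in> Kc c" using Kc_cover[OF assms] by blast
  then have "0 < c \<and> x \<in> E `` Kc c" using E_refl[OF assms] by blast
  then show ?thesis
    using complete_glb_fibre[OF complete dpred_gauge_set X_tuples[OF assms], of c 0] assms
    by (auto simp: gauge_def)
qed

lemma dscal_gauge: "dscal F m gauge"
  by (rule dscal_glb[where D = "\<lambda>x. x \<in> X", OF _ dpred_gauge_set])
    (use X gauge_isglb in \<open>auto simp: definable_iff_dpred gauge_def\<close>)

lemma gauge_nonneg: "x \<in> X \<Longrightarrow> 0 \<le> gauge x"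
  by (rule isglb_greatest[OF gauge_isglb]) auto

lemma gauge_le: "0 < c \<Longrightarrow> y \<in> Kc c \<Longrightarrow> (y, x) \<in> E \<Longrightarrow> gauge x \<le> c"
  using E_X by (intro isglb_le[OF gauge_isglb]) blast+

lemma gauge_less:
  assumes "x \<in> X" "gauge x < c"
  shows "\<exists>y\<in>Kc c. (y, x) \<in> E"
proof -
  obtain c' where "c' < c" "x \<in> E `` Kc c'" using isglb_less[OF gauge_isglb[OF assms(1)] assms(2)] by auto
  then show ?thesis using Kc_mono[of c' c] by auto
qed

lemma gauge_invariant:
  assumes "(x, y) \<in> E"
  shows "gauge x = gauge y"
proof -
  have "x \<in> E `` C \<longleftrightarrow> y \<in> E `` C" for C using assms E_sym E_trans by blast
  then show ?thesis using E_X[OF assms] by (simp add: gauge_def)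
qed

text \<open>Each half of the continuity uses one property of saturations: sublevel sets are closed
  because saturations of the sets \<open>Kc c\<close> are closed, superlevel sets because
  saturations of open sets are open.\<close>

lemma contn_gauge: "contn m X gauge"
proof (rule contnI_clo)
  fix c :: 'a
  show "clo m X {x \<in> X. gauge x \<le> c}"
  proof (rule cloI)
    fix x assume x: "x \<in> X" "x \<notin> {x \<in> X. gauge x \<le> c}"
    show "\<exists>r>0. \<forall>y\<in>{x \<in> X. gauge x \<le> c}. \<not> near m x y r"
    proof (cases "c < 0")
      case True
      then have "{x \<in> X. gauge x \<le> c} = {}" using gauge_nonneg by force
      then show ?thesis using zero_less_one by blast
    next
      case False
      obtain c' where c': "c < c'" "c' < gauge x" using x dense[of c "gauge x"] by auto
      then have pos: "0 < c'" using False by simp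
      have "x \<notin> E `` Kc c'" using gauge_le[OF pos] c'(2) by force
      then obtain r where r: "r > 0" "\<forall>y\<in>E `` Kc c'. \<not> near m x y r"
        using cloD[OF clo_saturation_Kc[OF pos] x(1)] by blast
      have "y \<in> E `` Kc c'" if "y \<in> X" "gauge y \<le> c" for y
        using gauge_less[of y c'] that c'(1) by auto
      then show ?thesis using r by blast
    qed
  qed auto
  show "clo m X {x \<in> X. c \<le> gauge x}"
  proof (rule cloI)
    fix x assume x: "x \<in> X" "x \<notin> {x \<in> X. c \<le> gauge x}"
    obtain c2 where c2: "gauge x < c2" "c2 < c" using x dense[of "gauge x" c] by auto
    obtain c1 where c1: "gauge x < c1" "c1 < c2" using dense[OF c2(1)] by auto
    have pos: "0 < c1" using c1 gauge_nonneg[OF x(1)] by simp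
    obtain w where w: "w \<in> Kc c1" "(w, x) \<in> E" using gauge_less[OF x(1) c1(1)] by blast
    obtain d where d: "d > 0" "\<And>y. y \<in> X \<Longrightarrow> near m w y d \<Longrightarrow> y \<in> Kc c2"
      using Kc_interior[OF pos c1(2)] w(1) by blast
    \<comment> \<open>A ball in \<open>X\<close> about a point \<open>w\<close> of the orbit of
      \<open>x\<close>, small enough to lie in \<open>Kc c2\<close>. Its saturation is a
      neighbourhood of \<open>x\<close> on which the gauge is at most \<open>c2 < c\<close>.\<close>
    define V where "V = {y \<in> X. near m y w d}"
    have wX: "w \<in> X" using E_X w(2) by blast
    have "definable F m V"
      unfolding V_def using X_tuples[OF wX]
      by (intro definable_subset_Collect[OF X]) (rule def_intros | simp)+
    moreover have "opn m X V"
      unfolding opn_def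
    proof (intro conjI ballI)
      fix y assume "y \<in> V"
      then have "near m y w d" by (simp add: V_def)
      from near_open[OF this] obtain r where "r > 0" "\<And>z. near m y z r \<Longrightarrow> near m z w d" by blast
      then show "\<exists>r>0. \<forall>z\<in>X. near m y z r \<longrightarrow> z \<in> V" by (auto simp: V_def)
    qed (auto simp: V_def)
    ultimately have "opn m X (E `` V)" by (rule saturation_opn)
    moreover have "x \<in> E `` V" using w(2) wX near_refl[OF d(1)] by (auto simp: V_def)
    ultimately obtain r where r: "r > 0" "\<forall>y\<in>X. near m x y r \<longrightarrow> y \<in> E `` V" using opnD by blast
    have "gauge y \<le> c2" if "y \<in> E `` V" for y
      using that gauge_le[of c2] d(2) pos c1(2) near_sym by (fastforce simp: V_def)
    then show "\<exists>r>0. \<forall>y\<in>{x \<in> X. c \<le> gauge x}. \<not> near m x y r"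
      using r c2(2) by (intro exI[of _ r]) force
  qed auto
qed

text \<open>On this closed set of nearly minimal points of the orbits, \<open>E\<close> is definably proper.\<close>

definition core :: "(nat \<Rightarrow> 'a) set" where
  "core = {x \<in> X. \<forall>c. gauge x + 1 < c \<longrightarrow> x \<in> Kc c}"

lemma definable_core: "definable F m core"
  unfolding core_def
  by (intro definable_subset_Collect[OF X]) (rule dscal_subst[OF dscal_gauge] def_intros dpred_Kc | simp)+

text \<open>If \<open>x\<close> violates the condition at \<open>c\<close>, it also violates it at
  some \<open>c'\<close> strictly between \<open>gauge x + 1\<close> and \<open>c\<close>. By
  continuity of the gauge, points of \<open>core\<close> near \<open>x\<close> lie in
  \<open>Kc c'\<close>, a closed set that misses \<open>x\<close>.\<close>

lemma clo_core: "clo m X core"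
proof (rule cloI)
  fix x assume x: "x \<in> X" "x \<notin> core"
  then obtain c where c: "gauge x + 1 < c" "x \<notin> Kc c" by (auto simp: core_def)
  obtain c' where c': "gauge x + 1 < c'" "c' < c" using dense[OF c(1)] by blast
  have pos: "0 < c'" using c' gauge_nonneg[OF x(1)] by (meson add_nonneg_pos order_le_less_trans zero_less_one less_imp_le less_trans)
  obtain r where r: "r > 0" "\<And>y. y \<in> X \<Longrightarrow> near m x y r \<Longrightarrow> \<bar>gauge y - gauge x\<bar> < c' - (gauge x + 1)"
    using contnD[OF contn_gauge x(1), of "c' - (gauge x + 1)"] c'(1) by auto
  have "x \<notin> Kc c'" using Kc_mono[of c' c x] c' c by auto
  then obtain s where s: "s > 0" "\<And>y. y \<in> Kc c' \<Longrightarrow> \<not> near m x y s"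
    using cloD[OF clo_Kc[OF pos] X_tuples[OF x(1)]] by blast
  have "\<not> near m x y (min r s)" if y: "y \<in> core" for y
  proof
    assume *: "near m x y (min r s)"
    have "gauge y - gauge x < c' - (gauge x + 1)"
      using r(2)[of y] near_mono[OF *, of r] y by (auto simp: core_def abs_less_iff)
    then have "y \<in> Kc c'" using y by (auto simp: core_def)
    then show False using s(2) near_mono[OF *, of s] by auto
  qed
  then show "\<exists>r>0. \<forall>y\<in>core. \<not> near m x y r" using r s by (intro exI[of _ "min r s"]) auto
qed (auto simp: core_def)

lemma core_subset: "core \<subseteq> X"
  by (auto simp: core_def)

text \<open>Here the slack 1 pays off: \<open>Kc (gauge x + 1)\<close> meets the orbit because its
  index is strictly above the infimum.\<close>

lemma core_meets:
  assumes "x \<in> X"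
  shows "\<exists>y\<in>core. (y, x) \<in> E"
proof -
  obtain y where y: "y \<in> Kc (gauge x + 1)" "(y, x) \<in> E" using gauge_less[OF assms, of "gauge x + 1"] by auto
  have "gauge y = gauge x" using gauge_invariant y(2) by blast
  then have "y \<in> core" using y E_X Kc_mono[OF _ y(1)] by (auto simp: core_def)
  then show ?thesis using y by blast
qed

lemma saturation_core: "E `` core = X"
  using core_meets E_X by blast

text \<open>Closedness is local, and near \<open>x\<close> the gauge is bounded. There only the
  definably compact part \<open>C \<inter> Kc (c + 1)\<close> contributes to the saturation.\<close>

lemma clo_saturation:
  assumes C: "definable F m C" "clo m X C" "C \<subseteq> core"
  shows "clo m X (E `` C)"
proof (rule cloI)
  show "E `` C \<subseteq> X" using E_X by blast
  fix x assume x: "x \<in> X" "x \<notin> E `` C"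
  define c where "c = gauge x + 1"
  obtain r where r: "r > 0" "\<And>y. y \<in> X \<Longrightarrow> near m x y r \<Longrightarrow> \<bar>gauge y - gauge x\<bar> < 1"
    using contnD[OF contn_gauge x(1), of 1] by auto
  have pos: "0 < c + 1" using gauge_nonneg[OF x(1)] by (simp add: c_def add_nonneg_pos)
  have "x \<notin> E `` (C \<inter> Kc (c + 1))" using x(2) by blast
  then obtain s where s: "s > 0" "\<And>y. y \<in> E `` (C \<inter> Kc (c + 1)) \<Longrightarrow> \<not> near m x y s"
    using cloD[OF clo_saturation_Int_Kc[OF C(1,2) pos] x(1)] by blast
  have "\<not> near m x y (min r s)" if y: "y \<in> E `` C" for y
  proof
    assume *: "near m x y (min r s)"
    obtain z where z: "z \<in> C" "(z, y) \<in> E" using y by blast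
    have "gauge y - gauge x < 1"
      using r(2)[of y] near_mono[OF *, of r] E_X[OF z(2)] by (auto simp: abs_less_iff)
    then have "gauge z < c" using gauge_invariant[OF z(2)] by (simp add: c_def)
    \<comment> \<open>A point of \<open>core\<close> lies in every \<open>Kc c'\<close> with
      \<open>c' > gauge z + 1\<close>, and \<open>gauge z + 1 < c + 1\<close>.\<close>
    then have "z \<in> Kc (c + 1)" using z(1) C(3) by (auto simp: core_def)
    then show False using s(2)[of y] near_mono[OF *, of s] z by auto
  qed
  then show "\<exists>r>0. \<forall>y\<in>E `` C. \<not> near m x y r" using r s by (intro exI[of _ "min r s"]) auto
qed

text \<open>The value at \<open>y\<close> is that of \<open>h\<close> at any equivalent point of
  \<open>Z\<close>. The sublevel and superlevel sets of the extension are saturations of closed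
  subsets of \<open>Z\<close>, hence closed by \<open>clo_saturation\<close>.\<close>

lemma invariant_extension:
  assumes Z: "definable F m Z" "clo m X Z" "Z \<subseteq> core"
    and h: "dscal F m h" "contn m Z h" "\<And>x y. x \<in> Z \<Longrightarrow> y \<in> Z \<Longrightarrow> (x, y) \<in> E \<Longrightarrow> h x = h y"
  shows "\<exists>k. dscal F m k \<and> contn m (E `` Z) k \<and> (\<forall>x y. x \<in> Z \<longrightarrow> (x, y) \<in> E \<longrightarrow> k y = h x)"
proof -
  define k where "k y = (if y \<in> E `` Z then h (SOME x. x \<in> Z \<and> (x, y) \<in> E) else 0)" for y
  have k: "k y = h x" if "x \<in> Z" "(x, y) \<in> E" for x y
  proof -
    define x' where "x' = (SOME x. x \<in> Z \<and> (x, y) \<in> E)"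
    have "x' \<in> Z \<and> (x', y) \<in> E" unfolding x'_def by (rule someI[of _ x]) (use that in blast)
    then have "h x' = h x" using that h(3) E_sym E_trans by blast
    moreover have "y \<in> E `` Z" using that by blast
    ultimately show ?thesis by (simp add: k_def x'_def)
  qed
  \<comment> \<open>The arbitrary choice in \<open>k\<close> disappears from the graph, because all
    representatives give the same value.\<close>
  have "dscal F m k"
  proof (rule dscal_graph)
    show "dpred F (Suc m) (\<lambda>z. (\<lambda>y a. (\<exists>x\<in>Z. (x, y) \<in> E \<and> a = h x) \<or>
        (\<not> (\<exists>x\<in>Z. (x, y) \<in> E) \<and> a = 0)) (tfst m z) (z m))"
      by (rule dscal_subst[OF h(1)] def_intros dpred_E dpred_bex[OF Z(1)] | simp)+
    show "(\<exists>x\<in>Z. (x, y) \<in> E \<and> a = h x) \<or> (\<not> (\<exists>x\<in>Z. (x, y) \<in> E) \<and> a = 0) \<longleftrightarrow> a = k y" for y a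
    proof (cases "\<exists>x\<in>Z. (x, y) \<in> E")
      case True
      then show ?thesis using k by metis
    next
      case False
      then have "k y = 0" by (auto simp: k_def)
      then show ?thesis using False by auto
    qed
  qed
  moreover have "contn m (E `` Z) k"
  proof (rule contnI_clo)
    fix c
    have sub: "E `` Z \<subseteq> X" using E_X by blast
    have *: "clo m (E `` Z) {y \<in> E `` Z. k y \<in> S}"
      if S: "dpred F m (\<lambda>x. h x \<in> S)" "clo m Z {x \<in> Z. h x \<in> S}" for S
    proof -
      have "clo m X (E `` {x \<in> Z. h x \<in> S})"
        by (rule clo_saturation) (use S Z clo_trans[OF Z(2) S(2)] in \<open>auto intro: definable_subset_Collect\<close>)
      moreover have "E `` {x \<in> Z. h x \<in> S} = {y \<in> E `` Z. k y \<in> S}" using k by auto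
      ultimately show ?thesis using clo_mono[of m X _ "E `` Z"] sub by auto
    qed
    have "dpred F m (\<lambda>x. h x \<in> {..c})" "dpred F m (\<lambda>x. h x \<in> {c..})"
      by (simp_all add: dpred_le h(1) dscal_const)
    then show "clo m (E `` Z) {y \<in> E `` Z. k y \<le> c}" "clo m (E `` Z) {y \<in> E `` Z. c \<le> k y}"
      using *[of "{..c}"] *[of "{c..}"] clo_le_contn[OF h(2)] clo_ge_contn[OF h(2)] by auto
  qed
  ultimately show ?thesis using k by blast
qed

section \<open>Finite families of functions that separate the classes\<close>

definition separated :: "(nat \<Rightarrow> 'a) set \<Rightarrow> bool" where
  "separated Z \<longleftrightarrow> (\<exists>(M::nat) h. (\<forall>i<M. dscal F m (h i) \<and> contn m Z (h i)) \<and>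
     (\<forall>x\<in>Z. \<forall>y\<in>Z. (\<forall>i<M. h i x = h i y) \<longleftrightarrow> (x, y) \<in> E))"

lemma separated_subset:
  assumes "separated Z" "W \<subseteq> Z"
  shows "separated W"
proof -
  obtain M :: nat and h where "\<forall>i<M. dscal F m (h i) \<and> contn m Z (h i)"
    "\<forall>x\<in>Z. \<forall>y\<in>Z. (\<forall>i<M. h i x = h i y) \<longleftrightarrow> (x, y) \<in> E"
    using assms(1) unfolding separated_def by blast
  then show ?thesis
    unfolding separated_def using assms(2) contn_subset[OF _ assms(2)]
    by (intro exI[of _ M] exI[of _ h]) (simp add: subset_iff)
qed

lemma separated_saturation:
  assumes Z: "definable F m Z" "clo m X Z" "Z \<subseteq> core" and "separated Z"
  shows "separated (E `` Z)"
proof -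
  obtain M :: nat and h where h: "\<And>i. i < M \<Longrightarrow> dscal F m (h i)" "\<And>i. i < M \<Longrightarrow> contn m Z (h i)"
    "\<And>x y. x \<in> Z \<Longrightarrow> y \<in> Z \<Longrightarrow> (\<forall>i<M. h i x = h i y) \<longleftrightarrow> (x, y) \<in> E"
    using assms(4) unfolding separated_def by blast
  have h': "h i x = h i y" if "i < M" "x \<in> Z" "y \<in> Z" "(x, y) \<in> E" for i x y
    using h(3) that by blast
  have "\<forall>i\<in>{..<M}. \<exists>k. dscal F m k \<and> contn m (E `` Z) k \<and>
      (\<forall>x y. x \<in> Z \<longrightarrow> (x, y) \<in> E \<longrightarrow> k y = h i x)"
    using h(1,2) h' by (intro ballI invariant_extension[OF Z]) auto
  then obtain k where k: "\<forall>i\<in>{..<M}. dscal F m (k i) \<and> contn m (E `` Z) (k i) \<and>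
      (\<forall>x y. x \<in> Z \<longrightarrow> (x, y) \<in> E \<longrightarrow> k i y = h i x)"
    by (rule bchoice[elim_format]) blast
  have "(\<forall>i<M. k i x = k i y) \<longleftrightarrow> (x, y) \<in> E" if xy: "x \<in> E `` Z" "y \<in> E `` Z" for x y
  proof -
    obtain z w where zw: "z \<in> Z" "(z, x) \<in> E" "w \<in> Z" "(w, y) \<in> E" using xy by blast
    have "(\<forall>i<M. k i x = k i y) \<longleftrightarrow> (\<forall>i<M. h i z = h i w)" using k zw by auto
    also have "\<dots> \<longleftrightarrow> (z, w) \<in> E" using h(3) zw by blast
    also have "\<dots> \<longleftrightarrow> (x, y) \<in> E" using zw E_sym E_trans by meson
    finally show ?thesis .
  qed
  then show ?thesis unfolding separated_def using k by (intro exI[of _ M] exI[of _ k]) auto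
qed

text \<open>The functions on \<open>Z\<close> are extended to its saturation, then to \<open>T\<close>; outside the saturation,
  where \<open>E\<close> is trivial, the points are separated by the coordinates, damped by the distance to it.\<close>

lemma separated_glue:
  assumes T: "definable F m T" "T \<subseteq> X"
    and Z: "definable F m Z" "clo m X Z" "Z \<subseteq> core" "separated Z"
    and inj: "\<And>x y. x \<in> T - Z \<Longrightarrow> y \<in> T - Z \<Longrightarrow> (x, y) \<in> E \<Longrightarrow> x = y"
    and "Z \<subseteq> T"
  shows "separated T"
proof -
  obtain M :: nat and h where h: "\<And>i. i < M \<Longrightarrow> dscal F m (h i)" "\<And>i. i < M \<Longrightarrow> contn m (E `` Z) (h i)"
    "\<And>x y. x \<in> E `` Z \<Longrightarrow> y \<in> E `` Z \<Longrightarrow> (\<forall>i<M. h i x = h i y) \<longleftrightarrow> (x, y) \<in> E"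
    using separated_saturation[OF Z] unfolding separated_def by blast
  define A where "A = E `` Z \<inter> T"
  have Tt: "T \<subseteq> tuples m" using T X_tuples by blast
  have A: "definable F m A" "clo m T A"
    unfolding A_def using clo_restrict[OF clo_saturation[OF Z(1-3)] T(2)]
    by (auto intro: definable_Int definable_saturation Z T)
  have "\<forall>i\<in>{..<M}. \<exists>k. dscal F m k \<and> contn m T k \<and> (\<forall>x\<in>A. k x = squeeze (h i x))"
  proof
    fix i assume i: "i \<in> {..<M}"
    show "\<exists>k. dscal F m k \<and> contn m T k \<and> (\<forall>x\<in>A. k x = squeeze (h i x))"
      using i h by (intro tietze[OF complete Tt A] dscal_squeeze contn_squeeze squeeze_bounds)
        (auto simp: A_def intro: contn_subset)
  qed
  then obtain k where k: "\<forall>i\<in>{..<M}. dscal F m (k i) \<and> contn m T (k i) \<and> (\<forall>x\<in>A. k i x = squeeze (h i x))"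
    by (rule bchoice[elim_format]) blast
  obtain d where d: "dscal F m d" "contn m T d" "\<And>x. x \<in> T \<Longrightarrow> d x = 0 \<longleftrightarrow> x \<in> A"
    using dist_function[OF complete Tt A] by blast
  define g where "g i = (if i < M then k i else if i = M then d else (\<lambda>x. d x * x (i - Suc M)))" for i
  have "dscal F m (g i) \<and> contn m T (g i)" if "i < Suc M + m" for i
    using that k d by (auto simp: g_def intro!: dscal_mult dscal_var contn_mult contn_var)
  moreover have "(\<forall>i<Suc M + m. g i x = g i y) \<longleftrightarrow> (x, y) \<in> E" if x: "x \<in> T" and y: "y \<in> T" for x y
  proof
    assume eq: "\<forall>i<Suc M + m. g i x = g i y"
    have deq: "d x = d y" using eq[rule_format, of M] by (simp add: g_def)
    show "(x, y) \<in> E"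
    proof (cases "d x = 0")
      case True
      then have "d y = 0" using deq by simp
      then have xy: "x \<in> A" "y \<in> A" using d(3) True x y by blast+
      have "h i x = h i y" if "i < M" for i
        using eq[rule_format, of i] that k xy by (simp add: g_def squeeze_eq_iff)
      then show ?thesis using h(3) xy by (auto simp: A_def)
    next
      case False
      have "x i = y i" if "i < m" for i
        using eq[rule_format, of "Suc M + i"] that False deq by (simp add: g_def)
      then have "x = y" using Tt x y by (intro tuples_eqI[of x m y]) auto
      then show ?thesis using E_refl T x by blast
    qed
  next
    assume xy: "(x, y) \<in> E"
    show "\<forall>i<Suc M + m. g i x = g i y"
    proof (cases "x = y")
      case False
      \<comment> \<open>Distinct equivalent points cannot both avoid \<open>Z\<close>. Hence both
        lie in its saturation, where \<open>d\<close> and the damped coordinates vanish.\<close>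
      then have "x \<in> Z \<or> y \<in> Z" using inj x y xy by blast
      then have ZE: "x \<in> E `` Z" "y \<in> E `` Z" using xy E_sym E_refl E_X by blast+
      then have A': "x \<in> A" "y \<in> A" using x y by (auto simp: A_def)
      then have "d x = 0" "d y = 0" using d(3) x y by auto
      moreover have "k i x = k i y" if "i < M" for i
        using h(3)[OF ZE] xy k A' that by auto
      ultimately show ?thesis by (simp add: g_def)
    qed simp
  qed
  ultimately show ?thesis unfolding separated_def by blast
qed

text \<open>Below, \<open>(W, T) \<in> R\<close> will mean that \<open>W\<close> has smaller rank than \<open>T\<close>.\<close>

lemma separated_core:
  assumes wf: "wf R"
    and mono: "\<And>W T Z. (W, T) \<in> R \<Longrightarrow> definable F m Z \<Longrightarrow> T \<subseteq> Z \<Longrightarrow> (W, Z) \<in> R"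
    and reps: "\<And>Z. definable F m Z \<Longrightarrow> Z \<subseteq> X \<Longrightarrow> \<exists>S\<subseteq>Z. definable F m S \<and>
      (\<forall>x\<in>Z. \<exists>s\<in>S. (s, x) \<in> E) \<and> (\<forall>x\<in>S. \<forall>y\<in>S. (x, y) \<in> E \<longrightarrow> x = y)"
    and rank: "\<And>S T. definable F m S \<Longrightarrow> definable F m T \<Longrightarrow> S \<subseteq> T \<Longrightarrow> S \<noteq> {} \<Longrightarrow>
      (\<forall>x\<in>T. \<forall>r>0. \<exists>s\<in>S. near m x s r) \<Longrightarrow>
      \<exists>U\<subseteq>S. definable F m U \<and> opn m T U \<and> (T - U, T) \<in> R"
  shows "separated core"
proof -
  have "definable F m Z \<Longrightarrow> clo m X Z \<Longrightarrow> Z \<subseteq> core \<Longrightarrow> separated Z" for Z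
  proof (induction Z rule: wf_induct_rule[OF wf])
    case (1 Z)
    have ZX: "Z \<subseteq> X" using 1 core_subset by blast
    obtain S where S: "S \<subseteq> Z" "definable F m S" "\<And>x. x \<in> Z \<Longrightarrow> \<exists>s\<in>S. (s, x) \<in> E"
      "\<And>x y. x \<in> S \<Longrightarrow> y \<in> S \<Longrightarrow> (x, y) \<in> E \<Longrightarrow> x = y"
      using reps[OF 1(2) ZX] by metis
    define T where "T = {x \<in> X. \<forall>r. 0 < r \<longrightarrow> (\<exists>s\<in>S. near m x s r)}"
    have TZ: "T \<subseteq> Z" using 1(3) S(1) unfolding T_def clo_def by fast
    have ST: "S \<subseteq> T" using S(1) ZX near_refl by (fastforce simp: T_def)
    have defT: "definable F m T"
      unfolding T_def by (intro definable_subset_Collect[OF X]) (rule def_intros dpred_bex[OF S(2)] | simp)+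
    have cloT: "clo m X T"
    proof (rule cloI)
      fix x assume "x \<in> X" "x \<notin> T"
      then obtain r where r: "r > 0" "\<And>s. s \<in> S \<Longrightarrow> \<not> near m x s r" by (auto simp: T_def)
      have "\<not> near m x y (r / 2)" if y: "y \<in> T" for y
      proof
        assume xy: "near m x y (r / 2)"
        obtain s where "s \<in> S" "near m y s (r / 2)" using y half_gt_zero[OF r(1)] unfolding T_def by blast
        then show False using near_trans[OF xy, of s "r / 2"] r(2) by simp
      qed
      then show "\<exists>r>0. \<forall>y\<in>T. \<not> near m x y r" using r(1) by (intro exI[of _ "r / 2"]) auto
    qed (auto simp: T_def)
    show ?case
    proof (cases "S = {}")
      case True
      then have "Z = {}" using S(3) by blast
      then show ?thesis by (auto simp: separated_def)
    next
      case False
      then obtain U where U: "U \<subseteq> S" "definable F m U" "opn m T U" "(T - U, T) \<in> R"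
        using rank[OF S(2) defT ST] unfolding T_def by blast
      have cloU: "clo m X (T - U)" using clo_trans[OF cloT clo_Diff_opn[OF U(3)]] .
      have defU: "definable F m (T - U)" using definable_Diff defT U(2) by blast
      \<comment> \<open>The rank drops from \<open>T\<close> to \<open>T - U\<close>, while the
        induction runs over \<open>Z\<close>; monotonicity along \<open>T \<subseteq> Z\<close>
        connects the two.\<close>
      have "separated (T - U)"
        using 1(4) TZ by (intro 1(1) mono[OF U(4) 1(2) TZ] defU cloU) auto
      then have "separated T"
      proof (rule separated_glue[OF defT _ defU cloU, rotated 2])
        show "x = y" if "x \<in> T - (T - U)" "y \<in> T - (T - U)" "(x, y) \<in> E" for x y
          using that U(1) S(4) by blast
      qed (use TZ ZX 1(4) in auto)
      \<comment> \<open>\<open>T\<close> may be much smaller than \<open>Z\<close>, but it contains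
        the representatives in \<open>S\<close>, so its saturation contains
        \<open>Z\<close>.\<close>
      then have "separated (E `` T)"
        using TZ 1(4) by (intro separated_saturation defT cloT) auto
      then show ?thesis by (rule separated_subset) (use S(3) ST in blast)
    qed
  qed
  then show ?thesis using definable_core clo_core by blast
qed

text \<open>The gauge is made coordinate 0 of the map. It bounds the orbits over a neighbourhood of
  a point of the image, so that closedness of \<open>K\<close> there reduces to the image of a
  definably compact set.\<close>

lemma exists_identifying:
  assumes "separated core"
  shows "\<exists>n f. dvec F m n f \<and> (\<forall>i<n. contn m X (\<lambda>x. f x i)) \<and>
    (\<forall>x\<in>X. \<forall>y\<in>X. f x = f y \<longleftrightarrow> (x, y) \<in> E) \<and>
    (\<forall>K. K \<subseteq> f ` X \<and> definable F n K \<and> clo m X {x \<in> X. f x \<in> K} \<longrightarrow> clo n (f ` X) K)"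
proof -
  obtain M :: nat and h where h: "\<And>i. i < M \<Longrightarrow> dscal F m (h i)" "\<And>i. i < M \<Longrightarrow> contn m X (h i)"
    "\<And>x y. x \<in> X \<Longrightarrow> y \<in> X \<Longrightarrow> (\<forall>i<M. h i x = h i y) \<longleftrightarrow> (x, y) \<in> E"
    using separated_saturation[OF definable_core clo_core order_refl assms]
    unfolding separated_def saturation_core by blast
  define n where "n = Suc M"
  define f where "f x = (\<lambda>i\<in>{..<n}. if i = 0 then gauge x else h (i - 1) x)" for x
  have f: "dvec F m n f"
  proof (rule dvecI)
    fix i assume "i < n"
    then show "dscal F m (\<lambda>z. f z i)"
      using h(1)[of "i - 1"] dscal_gauge by (cases i) (auto simp: f_def n_def)
  qed (simp add: f_def)
  have fc: "contn m X (\<lambda>x. f x i)" if "i < n" for i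
    using that h(2)[of "i - 1"] contn_gauge by (cases i) (auto simp: f_def n_def)
  have sep: "f x = f y \<longleftrightarrow> (x, y) \<in> E" if x: "x \<in> X" and y: "y \<in> X" for x y
  proof
    assume eq: "f x = f y"
    have "h i x = h i y" if "i < M" for i
    proof -
      have "f x (Suc i) = f y (Suc i)" using eq by simp
      then show ?thesis using that by (simp add: f_def n_def)
    qed
    then show "(x, y) \<in> E" using h(3) x y by blast
  next
    assume xy: "(x, y) \<in> E"
    have "h i x = h i y" if "i < M" for i using h(3)[OF x y] xy that by blast
    then show "f x = f y" using gauge_invariant[OF xy] by (auto simp: f_def n_def fun_eq_iff)
  qed
  have ft: "f x \<in> tuples n" for x by (simp add: f_def)
  have "clo n (f ` X) K"
    if K: "K \<subseteq> f ` X" "definable F n K" "clo m X {x \<in> X. f x \<in> K}" for K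
  proof (rule cloI[OF K(1)])
    fix y assume y: "y \<in> f ` X" "y \<notin> K"
    then obtain x0 where x0: "x0 \<in> X" "y = f x0" by blast
    define c where "c = gauge x0 + 1"
    have c: "0 < c" using gauge_nonneg[OF x0(1)] by (simp add: c_def add_nonneg_pos)
    define Q where "Q = {x \<in> X. f x \<in> K} \<inter> Kc c"
    have defQ: "definable F m Q"
      unfolding Q_def
      by (intro definable_Int definable_Kc definable_subset_Collect[OF X] dpred_mem[OF K(2) f])
    have Qt: "Q \<subseteq> tuples m" using X_tuples by (auto simp: Q_def)
    have "clo n (tuples n) (f ` Q)"
    proof (rule clo_image[OF complete Qt])
      show "clo m (tuples m) Q"
        unfolding Q_def using clo_trans[OF clo_Kc[OF c] clo_restrict[OF K(3) Kc_subset]] .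
      show "bounded_tuples m Q" using bounded_Kc[of c] by (auto simp: Q_def bounded_tuples_def)
      show "contn m Q (\<lambda>x. f x i)" if "i < n" for i
        by (rule contn_subset[OF fc[OF that]]) (auto simp: Q_def)
      show "dpred F (n + m) (\<lambda>z. tsnd n m z \<in> Q \<and> tfst n z = f (tsnd n m z))"
        by (rule dpred_conj dpred_mem[OF defQ] dpred_vec_eq[where k = n] dvec_subst[OF f]
            dvec_tfst dvec_tsnd dvec_self)+
    qed (simp add: ft)
    moreover have "y \<notin> f ` Q" using y by (auto simp: Q_def)
    ultimately obtain r where r: "r > 0" "\<And>w. w \<in> f ` Q \<Longrightarrow> \<not> near n y w r"
      using cloD[of n "tuples n" "f ` Q" y] x0 ft by blast
    have "\<not> near n y w (min r 1)" if w: "w \<in> K" for w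
    proof
      assume *: "near n y w (min r 1)"
      obtain x where x: "x \<in> X" "w = f x" using w K(1) by blast
      have "\<bar>y 0 - w 0\<bar> < 1" using near_mono[OF *, of 1] by (simp add: near_def n_def)
      then have "- (gauge x0 - gauge x) < 1" unfolding abs_less_iff by (simp add: x0 x f_def n_def)
      then have "gauge x < c" unfolding c_def by linarith
      then obtain z where z: "z \<in> Kc c" "(z, x) \<in> E" using gauge_less[OF x(1)] by blast
      then have "f z = f x" using sep E_X by blast
      then have "z \<in> Q" using z x w E_X by (auto simp: Q_def)
      then have "w \<in> f ` Q" using \<open>f z = f x\<close> x(2) by (metis imageI)
      then show False using r(2) near_mono[OF *, of r] by auto
    qed
    then show "\<exists>r>0. \<forall>w\<in>K. \<not> near n y w r" using r(1) by (intro exI[of _ "min r 1"]) auto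
  qed
  then show ?thesis using f fc sep by blast
qed

end

section \<open>Definable maps and quotients\<close>

lemma graph_dpred_iff:
  assumes f: "f \<in> A \<rightarrow> tuples n" and A: "A \<subseteq> tuples k"
  shows "definable F (k + n) {tjoin k n x (f x) |x. x \<in> A} \<longleftrightarrow>
    dpred F (k + n) (\<lambda>z. tfst k z \<in> A \<and> tsnd k n z = f (tfst k z))"
proof -
  have "{tjoin k n x (f x) |x. x \<in> A} =
      {z \<in> tuples (k + n). tfst k z \<in> A \<and> tsnd k n z = f (tfst k z)}" (is "?L = ?R")
  proof
    show "?L \<subseteq> ?R" using f A by (auto simp: Pi_iff subset_iff)
    show "?R \<subseteq> ?L"
    proof
      fix z assume "z \<in> ?R"
      then have "z = tjoin k n (tfst k z) (f (tfst k z))" "tfst k z \<in> A"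
        using tjoin_tfst_tsnd[of z k n] by auto
      then show "z \<in> ?L" by blast
    qed
  qed
  then show ?thesis by (simp add: dpred_def)
qed

lemma definable_map_graph:
  assumes "definable_map F k n A B f"
  shows "dpred F (k + n) (\<lambda>z. tfst k z \<in> A \<and> tsnd k n z = f (tfst k z))"
  using assms graph_dpred_iff[of f A n k F] definable_tuples[of F k A] definable_tuples[of F n B]
  by (auto simp: definable_map_def)

lemma definable_relation_iff:
  assumes "E \<subseteq> tuples m \<times> tuples m"
  shows "definable F (m + m) {tjoin m m x y |x y. (x, y) \<in> E} \<longleftrightarrow>
    dpred F (m + m) (\<lambda>z. (tfst m z, tsnd m m z) \<in> E)"
proof -
  have "{tjoin m m x y |x y. (x, y) \<in> E} = {z \<in> tuples (m + m). (tfst m z, tsnd m m z) \<in> E}" (is "?L = ?R")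
  proof
    show "?L \<subseteq> ?R" using assms by auto
    show "?R \<subseteq> ?L"
    proof
      fix z assume "z \<in> ?R"
      then have "z = tjoin m m (tfst m z) (tsnd m m z)" "(tfst m z, tsnd m m z) \<in> E" by auto
      then show "z \<in> ?L" by blast
    qed
  qed
  then show ?thesis by (simp add: dpred_def)
qed

lemma definable_representatives:
  fixes F :: "('a::linordered_field, 'f, 'r) expansion"
  assumes choice: "definable_choice F" and Z: "definable F m Z" "Z \<subseteq> X"
    and E: "equiv X E" "E \<subseteq> tuples m \<times> tuples m"
    and defE: "dpred F (m + m) (\<lambda>z. (tfst m z, tsnd m m z) \<in> E)"
  shows "\<exists>S\<subseteq>Z. definable F m S \<and> (\<forall>x\<in>Z. \<exists>s\<in>S. (s, x) \<in> E) \<and>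
    (\<forall>x\<in>S. \<forall>y\<in>S. (x, y) \<in> E \<longrightarrow> x = y)"
proof -
  define E' where "E' = E \<inter> Z \<times> Z"
  have eqv: "equiv Z E'"
    using E(1) Z(2) unfolding E'_def equiv_def refl_on_def sym_def trans_def by blast
  have "dpred F (m + m) (\<lambda>z. (tfst m z, tsnd m m z) \<in> E')"
  proof -
    have "dpred F (m + m) (\<lambda>z. (tfst m z, tsnd m m z) \<in> E \<and> tfst m z \<in> Z \<and> tsnd m m z \<in> Z)"
      by (rule dpred_conj defE dpred_mem[OF Z(1)] dvec_tfst dvec_tsnd dvec_self)+
    then show ?thesis by (simp add: E'_def)
  qed
  then have "definable_equiv F m Z E'"
    using definable_relation_iff[of E' m F] E(2) Z(1) eqv by (auto simp: definable_equiv_def E'_def)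
  then obtain S where S: "S \<subseteq> Z" "definable F m S" "\<And>C. C \<in> Z // E' \<Longrightarrow> \<exists>!s. s \<in> S \<inter> C"
    using choice unfolding definable_choice_def by meson
  have "\<exists>s\<in>S. (s, x) \<in> E" if "x \<in> Z" for x
  proof -
    have "E' `` {x} \<in> Z // E'" using that by (rule quotientI)
    then obtain s where "s \<in> S" "(x, s) \<in> E'" using S(3) by blast
    then show ?thesis using eqv unfolding equiv_def sym_def E'_def by blast
  qed
  moreover have "x = y" if xy: "x \<in> S" "y \<in> S" "(x, y) \<in> E" for x y
  proof -
    have "E' `` {x} \<in> Z // E'" using xy S(1) by (blast intro: quotientI)
    moreover have "y \<in> E' `` {x}" using xy S(1) by (auto simp: E'_def)
    moreover have "x \<in> E' `` {x}" using eqv xy S(1) by (auto simp: equiv_def refl_on_def)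
    ultimately show ?thesis using S(3) xy by blast
  qed
  ultimately show ?thesis using S by blast
qed

text \<open>For the third claim, suppose that \<open>T - S\<close> had full rank. It would then
  contain a set \<open>V\<close> open in \<open>T\<close> whose removal lowers the rank; density of
  \<open>S\<close> forces \<open>V = {}\<close>, a contradiction. So \<open>S\<close> has full rank,
  and the axiom yields \<open>U\<close> inside \<open>S\<close>. Then \<open>T - U\<close> is the
  union of \<open>S - U\<close> and \<open>T - S\<close>, both of smaller rank.\<close>

lemma smaller_rank:
  fixes F :: "('a::{linordered_field, linorder_topology}, 'f, 'r) expansion"
    and eRank :: "nat \<Rightarrow> (nat \<Rightarrow> 'a) set \<Rightarrow> 'e::linorder option" and m :: nat
  assumes rank: "good_extended_rank F \<E> eRank"
  defines "R \<equiv> {(W, Z). definable F m W \<and> definable F m Z \<and> eRank m W < eRank m Z}"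
  shows "wf R"
    and "(W, T) \<in> R \<Longrightarrow> definable F m Z \<Longrightarrow> T \<subseteq> Z \<Longrightarrow> (W, Z) \<in> R"
    and "definable F m S \<Longrightarrow> definable F m T \<Longrightarrow> S \<subseteq> T \<Longrightarrow> S \<noteq> {} \<Longrightarrow>
      (\<forall>x\<in>T. \<forall>r>0. \<exists>s\<in>S. near m x s r) \<Longrightarrow> \<exists>U\<subseteq>S. definable F m U \<and> opn m T U \<and> (T - U, T) \<in> R"
proof -
  note r = spec[OF rank[unfolded good_extended_rank_def], of m]
  note val = r[THEN conjunct1, rule_format]
  note empty = r[THEN conjunct2, THEN conjunct2, THEN conjunct1, rule_format]
  note dec = r[THEN conjunct2, THEN conjunct2, THEN conjunct2, THEN conjunct1]
  note un = r[THEN conjunct2, THEN conjunct2, THEN conjunct2, THEN conjunct2, THEN conjunct1, rule_format, OF conjI]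
  have op: "\<exists>U. definable F m U \<and> U \<subseteq> A \<and> openin (rel_topology m B) U \<and> eRank m (A - U) < eRank m B"
    if "definable F m A" "definable F m B" "A \<subseteq> B" "A \<noteq> {}" "eRank m A = eRank m B" for A B
    using that r[THEN conjunct2, THEN conjunct2, THEN conjunct2, THEN conjunct2, THEN conjunct2, THEN conjunct1,
        THEN spec, of A, THEN spec, of B] by simp
  have mono: "eRank m A \<le> eRank m B" if "definable F m A" "definable F m B" "A \<subseteq> B" for A B
    using un[OF that(1,2)] that(3) by (simp add: Un_absorb1 max_def split: if_splits)
  show "wf R"
    unfolding wf_iff_no_infinite_down_chain
  proof
    assume "\<exists>f. \<forall>i. (f (Suc i), f i) \<in> R"
    then obtain f where f: "\<And>i. definable F m (f i)" "\<And>i. eRank m (f (Suc i)) < eRank m (f i)"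
      unfolding R_def by blast
    \<comment> \<open>Every set in the chain has a successor of smaller rank, so \<open>None\<close>
      does not occur.\<close>
    have "\<exists>e. e \<in> \<E> m \<and> eRank m (f i) = Some e" for i
      using val[OF f(1)[of i]] f(2)[of i] by auto
    then obtain s where s: "\<And>i. s i \<in> \<E> m" "\<And>i. eRank m (f i) = Some (s i)" by metis
    have "s (Suc i) < s i" for i using f(2)[of i] by (simp add: s(2))
    then show False using dec s(1) by blast
  qed
  show "(W, Z) \<in> R" if "(W, T) \<in> R" "definable F m Z" "T \<subseteq> Z"
    using that mono[of T Z] by (auto simp: R_def)
  assume S: "definable F m S" and T: "definable F m T" and ST: "S \<subseteq> T" "S \<noteq> {}"
    and dense: "\<forall>x\<in>T. \<forall>r>0. \<exists>s\<in>S. near m x s r"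
  have Tt: "T \<subseteq> tuples m" by (rule definable_tuples[OF T])
  have defD: "definable F m (T - S)" by (rule definable_Diff[OF T S])
  have "T = S \<union> (T - S)" using ST by blast
  then have max: "eRank m T = max (eRank m S) (eRank m (T - S))" using un[OF S defD] by simp
  have rest: "eRank m (T - S) < eRank m T"
  proof (rule ccontr)
    assume "\<not> eRank m (T - S) < eRank m T"
    then have eq: "eRank m (T - S) = eRank m T" using max by (simp add: max_def split: if_splits)
    have "T - S \<noteq> {}" using eq empty[OF defD] empty[OF T] ST by auto
    then obtain V where V: "V \<subseteq> T - S" "openin (rel_topology m T) V" "eRank m (T - S - V) < eRank m T"
      using op[OF defD T _ _ eq] by blast
    have "V = {}"
    proof (rule ccontr)
      assume "V \<noteq> {}"
      then obtain x where "x \<in> V" by blast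
      then obtain r where "r > 0" "\<forall>y\<in>T. near m x y r \<longrightarrow> y \<in> V"
        using V(2) unfolding openin_rel_iff[OF Tt] opn_def by blast
      then show False using dense V(1) ST \<open>x \<in> V\<close> by blast
    qed
    then show False using V(3) eq by simp
  qed
  then have "eRank m S = eRank m T" using max by (simp add: max_def split: if_splits)
  then obtain U where U: "definable F m U" "U \<subseteq> S" "openin (rel_topology m T) U" "eRank m (S - U) < eRank m T"
    using op[OF S T ST] by blast
  have "T - U = (S - U) \<union> (T - S)" using ST U(2) by blast
  then have "eRank m (T - U) < eRank m T"
    using un[OF definable_Diff[OF S U(1)] defD] U(4) rest by simp
  then show "\<exists>U\<subseteq>S. definable F m U \<and> opn m T U \<and> (T - U, T) \<in> R"
    using U definable_Diff[OF T U(1)] T unfolding R_def openin_rel_iff[OF Tt] by blast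
qed

lemma orbit_space_quotient:
  fixes F :: "('a::{linordered_field, linorder_topology}, 'f, 'r) expansion"
  assumes "orbit_space F m X E" and choice: "definable_choice F"
    and rank: "good_extended_rank F \<E> eRank"
  shows "\<exists>n Y f. definable_quotient F m X E n Y f"
proof -
  interpret orbit_space F m X E by fact
  have Et: "E \<subseteq> tuples m \<times> tuples m" by (auto dest!: E_X intro: X_tuples)
  have Xt: "X \<subseteq> tuples m" using X_tuples by blast
  have "separated core"
    by (rule separated_core[OF smaller_rank(1)[where m = m, OF rank]],
        erule (2) smaller_rank(2)[OF rank],
        erule (1) definable_representatives[OF choice _ _ E Et definable_E],
        erule (4) smaller_rank(3)[OF rank])
  from exists_identifying[OF this] obtain n f where *: "dvec F m n f \<and> (\<forall>i<n. contn m X (\<lambda>x. f x i)) \<and>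
    (\<forall>x\<in>X. \<forall>y\<in>X. f x = f y \<longleftrightarrow> (x, y) \<in> E) \<and>
    (\<forall>K. K \<subseteq> f ` X \<and> definable F n K \<and> clo m X {x \<in> X. f x \<in> K} \<longrightarrow> clo n (f ` X) K)"
    by (elim exE)
  then have f: "dvec F m n f" "\<forall>i<n. contn m X (\<lambda>x. f x i)"
    "\<forall>x\<in>X. \<forall>y\<in>X. f x = f y \<longleftrightarrow> (x, y) \<in> E"
    "\<forall>K. K \<subseteq> f ` X \<and> definable F n K \<and> clo m X {x \<in> X. f x \<in> K} \<longrightarrow> clo n (f ` X) K"
    by simp_all
  have ft: "f \<in> X \<rightarrow> tuples n" using f(1) Xt by (auto simp: dvec_def)
  then have Yt: "f ` X \<subseteq> tuples n" by auto
  have Y: "definable F n (f ` X)"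
  proof (rule definable_image[OF ft _ Xt])
    show "dpred F (n + m) (\<lambda>z. tsnd n m z \<in> X \<and> tfst n z = f (tsnd n m z))"
      by (rule dpred_conj dpred_mem[OF X] dpred_vec_eq[where k = n] dvec_subst[OF f(1)]
          dvec_tfst dvec_tsnd dvec_self)+
  qed
  have "dpred F (m + n) (\<lambda>z. tfst m z \<in> X \<and> tsnd m n z = f (tfst m z))"
    by (rule dpred_conj dpred_mem[OF X] dpred_vec_eq[where k = n] dvec_subst[OF f(1)]
        dvec_tfst dvec_tsnd dvec_self)+
  then have "definable_map F m n X (f ` X) f"
    using X Y graph_dpred_iff[OF ft Xt] by (auto simp: definable_map_def)
  then have "definably_identifying_map F m n X (f ` X) f"
    using f(2,4) by (auto simp: definably_identifying_map_def definable_continuous_map_def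
        continuous_map_rel_rel_iff[OF Xt Yt] closedin_rel_iff[OF Xt] closedin_rel_iff[OF Yt])
  moreover have "definable_equiv F m X E"
    using X E definable_relation_iff[OF Et] definable_E by (auto simp: definable_equiv_def)
  ultimately have "definable_quotient F m X E n (f ` X) f"
    using f(3) by (simp add: definable_quotient_def)
  then show ?thesis by blast
qed

section \<open>Proper actions\<close>

lemma tprod_iff:
  assumes "A \<subseteq> tuples k" "B \<subseteq> tuples l" "z \<in> tuples (k + l)"
  shows "z \<in> tprod k l A B \<longleftrightarrow> tfst k z \<in> A \<and> tsnd k l z \<in> B"
proof
  assume "z \<in> tprod k l A B"
  then obtain x y where "x \<in> A" "y \<in> B" "z = tjoin k l x y" by (auto simp: tprod_def)
  then show "tfst k z \<in> A \<and> tsnd k l z \<in> B" using assms by auto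
next
  assume "tfst k z \<in> A \<and> tsnd k l z \<in> B"
  moreover have "z = tjoin k l (tfst k z) (tsnd k l z)" using assms(3) by simp
  ultimately show "z \<in> tprod k l A B" unfolding tprod_def by blast
qed

lemma tprod_tuples: "tprod k l A B \<subseteq> tuples (k + l)"
  by (auto simp: tprod_def)

lemma definably_compact_tprod:
  fixes F :: "('a::{linordered_field, linorder_topology}, 'f, 'r) expansion"
  assumes A: "definable F k A" "clo k (tuples k) A" "bounded_tuples k A"
    and B: "definable F l B" "clo l (tuples l) B" "bounded_tuples l B"
  shows "definably_compact F (k + l) (tprod k l A B)"
  unfolding definably_compact_def closedin_tuple_iff
proof (intro conjI)
  note At = definable_tuples[OF A(1)] and Bt = definable_tuples[OF B(1)]
  have "dpred F (k + l) (\<lambda>z. tfst k z \<in> A \<and> tsnd k l z \<in> B)"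
    by (rule dpred_conj dpred_mem[OF A(1)] dpred_mem[OF B(1)] dvec_tfst dvec_tsnd dvec_self)+
  then have "dpred F (k + l) (\<lambda>z. z \<in> tprod k l A B)"
    by (rule iffD1[OF dpred_cong, rotated]) (simp add: tprod_iff[OF At Bt])
  then show "definable F (k + l) (tprod k l A B)"
    using tprod_tuples by (simp add: definable_iff_dpred)
  show "clo (k + l) (tuples (k + l)) (tprod k l A B)"
  proof (rule cloI[OF tprod_tuples])
    fix z assume z: "z \<in> tuples (k + l)" "z \<notin> tprod k l A B"
    have nr: "near k (tfst k z) (tfst k w) r \<and> near l (tsnd k l z) (tsnd k l w) r"
      if w: "w \<in> tprod k l A B" "near (k + l) z w r" for w r
    proof -
      have "w \<in> tuples (k + l)" using w(1) tprod_tuples by blast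
      then show ?thesis
        using near_tjoin[of k l "tfst k z" "tsnd k l z" "tfst k w" "tsnd k l w" r] z(1) w(2)
        by simp
    qed
    have mem: "tfst k w \<in> A \<and> tsnd k l w \<in> B" if "w \<in> tprod k l A B" for w
      using tprod_iff[OF At Bt] that tprod_tuples by blast
    consider "tfst k z \<notin> A" | "tsnd k l z \<notin> B" using tprod_iff[OF At Bt z(1)] z(2) by blast
    then show "\<exists>r>0. \<forall>w\<in>tprod k l A B. \<not> near (k + l) z w r"
    proof cases
      case 1
      obtain r where "r > 0" "\<forall>x\<in>A. \<not> near k (tfst k z) x r" using cloD[OF A(2) tfst_tuples 1] by blast
      then show ?thesis using nr mem by blast
    next
      case 2
      obtain r where "r > 0" "\<forall>x\<in>B. \<not> near l (tsnd k l z) x r" using cloD[OF B(2) tsnd_tuples 2] by blast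
      then show ?thesis using nr mem by blast
    qed
  qed
  obtain a b where ab: "\<forall>x\<in>A. \<forall>i<k. a i \<le> x i \<and> x i \<le> b i" using A(3) by (auto simp: bounded_tuples_def)
  obtain c d where cd: "\<forall>x\<in>B. \<forall>i<l. c i \<le> x i \<and> x i \<le> d i" using B(3) by (auto simp: bounded_tuples_def)
  have "tjoin k l a c i \<le> z i \<and> z i \<le> tjoin k l b d i" if "z \<in> tprod k l A B" "i < k + l" for z i
    using ab cd that by (auto simp: tprod_def tjoin_def)
  then show "bounded_tuples (k + l) (tprod k l A B)" unfolding bounded_tuples_def by blast
qed

lemma contn_vec:
  assumes "\<And>i. i < l \<Longrightarrow> contn n Z (\<lambda>x. f x i)" "x \<in> Z" "e > 0"
  shows "\<exists>r>0. \<forall>y\<in>Z. near n x y r \<longrightarrow> near l (f x) (f y) e"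
proof -
  have "\<exists>r>0. \<forall>i<l. \<forall>y\<in>Z. near n x y r \<longrightarrow> \<bar>f y i - f x i\<bar> < e"
  proof (rule ex_pos_ball_less)
    show "\<exists>r>0. \<forall>y\<in>Z. near n x y r \<longrightarrow> \<bar>f y i - f x i\<bar> < e" if "i < l" for i
      using contnD[OF assms(1)[OF that] assms(2,3)] .
  qed (use near_mono in blast)
  then show ?thesis by (auto simp: near_def[of l] abs_minus_commute)
qed

text \<open>Near a point of \<open>X\<close> the saturation of \<open>K\<close> is the image under
  the action of the pairs that join \<open>K\<close> to a definably compact neighbourhood.
  Properness makes this set of pairs definably compact, so \<open>clo_image\<close> applies.\<close>

lemma orbit_space_proper_action:
  fixes F :: "('a::{linordered_field, linorder_topology}, 'f, 'r) expansion"
  assumes complete: "definably_complete F"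
    and group: "definable_group F k G"
    and action: "definable_G_set F k G m X \<phi>"
    and lc: "locally_closed_in (tuple_topology m) X"
    and proper: "definably_proper_action F k G m X \<phi>"
  shows "orbit_space F m X (orbit_relation G X \<phi>)"
proof -
  let ?E = "orbit_relation G X \<phi>" and ?C = "carrier G"
  let ?P = "tprod k m ?C X"
  define act where "act z = \<phi> (tfst k z) (tsnd k m z)" for z
  have C: "definable F k ?C" using group by (simp add: definable_group_def)
  have X: "definable F m X" using action by (simp add: definable_G_set_def)
  note Ct = definable_tuples[OF C] and Xt = definable_tuples[OF X]
  interpret group_action G X \<phi> using action by (simp add: definable_G_set_def)
  interpret G: group G using group by (simp add: definable_group_def)
  have P: "z \<in> ?P \<longleftrightarrow> tfst k z \<in> ?C \<and> tsnd k m z \<in> X" if "z \<in> tuples (k + m)" for z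
    using tprod_iff[OF Ct Xt that] .
  have "definable_continuous_map F (k + m) m ?P X act"
    using action unfolding definable_G_set_def act_def[abs_def] by blast
  then have act_map: "definable_map F (k + m) m ?P X act"
    and act_cont: "\<And>i. i < m \<Longrightarrow> contn (k + m) ?P (\<lambda>z. act z i)"
    using continuous_map_rel_rel_iff[OF tprod_tuples Xt] by (auto simp: definable_continuous_map_def)
  have act_X: "act \<in> ?P \<rightarrow> X" using act_map by (simp add: definable_map_def)
  have E_iff: "(x, y) \<in> ?E \<longleftrightarrow> (\<exists>g\<in>?C. x \<in> X \<and> y = \<phi> g x)" for x y
    by (auto simp: orbit_relation_def)
  have inv_act: "\<phi> (inv\<^bsub>G\<^esub> g) (\<phi> g x) = x" if "g \<in> ?C" "x \<in> X" for g x
    using orbit_sym_aux[OF that refl] .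
  have E_sym: "(y, x) \<in> ?E" if xy: "(x, y) \<in> ?E" for x y
  proof -
    obtain g where g: "g \<in> ?C" "x \<in> X" "y = \<phi> g x" using xy unfolding E_iff by blast
    then have "x = \<phi> (inv\<^bsub>G\<^esub> g) y" using inv_act by simp
    moreover have "y \<in> X" using g element_image by blast
    ultimately show ?thesis unfolding E_iff using g(1) G.inv_closed by blast
  qed
  have equiv: "equiv X ?E"
  proof (rule equivI)
    show "?E \<subseteq> X \<times> X" unfolding E_iff using element_image by (auto simp: E_iff)
    have "x = \<phi> \<one>\<^bsub>G\<^esub> x" if "x \<in> X" for x using that id_eq_one by (metis restrict_apply')
    then show "refl_on X ?E" unfolding refl_on_def E_iff using G.one_closed by blast
    show "sym ?E" using E_sym by (rule symI)
    show "trans ?E"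
    proof (rule transI)
      fix x y z assume "(x, y) \<in> ?E" "(y, z) \<in> ?E"
      then obtain g h where "g \<in> ?C" "x \<in> X" "y = \<phi> g x" "h \<in> ?C" "z = \<phi> h y" unfolding E_iff by blast
      then have "z = \<phi> (h \<otimes>\<^bsub>G\<^esub> g) x" "h \<otimes>\<^bsub>G\<^esub> g \<in> ?C" using composition_rule by auto
      then show "(x, z) \<in> ?E" unfolding E_iff using \<open>x \<in> X\<close> by blast
    qed
  qed
  have EX: "x \<in> X \<and> y \<in> X" if "(x, y) \<in> ?E" for x y using that equiv by (auto simp: equiv_def)
  \<comment> \<open>Membership in the group and in \<open>X\<close> belongs to the predicate because
    only the graph of the action over \<open>?P\<close> is definable, not an extension of
    \<open>\<phi>\<close> to all tuples.\<close>
  have dpred_act: "dpred F N (\<lambda>z. u z \<in> ?C \<and> v z \<in> X \<and> w z = \<phi> (u z) (v z))"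
    if uvw: "dvec F N k u" "dvec F N m v" "dvec F N m w" for N u v w
  proof -
    have t: "u z \<in> tuples k" "v z \<in> tuples m" "w z \<in> tuples m" if "z \<in> tuples N" for z
      using uvw that by (auto simp: dvec_def)
    have "dvec F N (k + m + m) (\<lambda>z. tjoin (k + m) m (tjoin k m (u z) (v z)) (w z))"
      by (intro dvec_tjoin uvw)
    from dpred_subst[OF definable_map_graph[OF act_map] this] show ?thesis
      by (rule iffD1[OF dpred_cong, rotated]) (simp add: t P act_def)
  qed
  have definable_E: "dpred F (m + m) (\<lambda>z. (tfst m z, tsnd m m z) \<in> ?E)"
  proof -
    have "dpred F (m + m) (\<lambda>z. \<exists>g\<in>?C. g \<in> ?C \<and> tfst m z \<in> X \<and> tsnd m m z = \<phi> g (tfst m z))"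
      by (rule dpred_bex[OF C]) (rule dpred_act dvec_tfst dvec_tsnd dvec_self)+
    then show ?thesis by (rule iffD1[OF dpred_cong, rotated]) (auto simp: E_iff)
  qed
  interpret locally_closed_set F m X
  proof
    fix x assume x: "x \<in> X"
    obtain U D where UD: "openin (tuple_topology m) U" "closedin (tuple_topology m) D" "X = U \<inter> D"
      using lc by (auto simp: locally_closed_in_def)
    obtain r where r: "r > 0" "\<forall>y\<in>tuples m. near m x y r \<longrightarrow> y \<in> U"
      using UD(1,3) x opnD unfolding openin_tuple_iff by blast
    have "y \<in> D" if "y \<in> tuples m" "\<forall>s>0. \<exists>z\<in>X. near m y z s" for y
      using cloD[of m "tuples m" D y] UD(2,3) that unfolding closedin_tuple_iff by blast
    then show "\<exists>r>0. \<forall>y\<in>tuples m. near m x y r \<longrightarrow> (\<forall>s>0. \<exists>z\<in>X. near m y z s) \<longrightarrow> y \<in> X"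
      using r UD(3) by blast
  qed (fact complete X)+
  show ?thesis
  proof (unfold_locales, fact equiv, fact definable_E)
    fix K assume K: "definable F m K" "K \<subseteq> X" "clo m (tuples m) K" "bounded_tuples m K"
    show "clo m X (?E `` K)"
    proof (rule cloI)
      show "?E `` K \<subseteq> X" using EX by blast
      fix x assume x: "x \<in> X" "x \<notin> ?E `` K"
      obtain c where c: "c > 0" "x \<in> Kc c" using Kc_cover[OF x(1)] by blast
      \<comment> \<open>Enlarging the index by 1 turns \<open>Kc c\<close> into a definably compact
        neighbourhood of \<open>x\<close> in \<open>X\<close>.\<close>
      define K' where "K' = Kc (c + 1)"
      obtain d where d: "d > 0" "\<And>y. y \<in> X \<Longrightarrow> near m x y d \<Longrightarrow> y \<in> K'"
        using Kc_interior[OF c(1), of "c + 1"] c(2) by (auto simp: K'_def)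
      have c1: "c + 1 > 0" using c(1) by (simp add: add_pos_pos)
      have "definably_compact F (m + m) (tprod m m K K')"
        unfolding K'_def by (intro definably_compact_tprod K definable_Kc clo_Kc[OF c1] bounded_Kc)
      moreover have "tprod m m K K' \<subseteq> tprod m m X X"
        using K(2) Kc_subset[of "c + 1"] unfolding tprod_def K'_def by blast
      ultimately have Q: "definably_compact F (k + m)
          {z \<in> ?P. tjoin m m (tsnd k m z) (\<phi> (tfst k z) (tsnd k m z)) \<in> tprod m m K K'}"
        using proper unfolding definably_proper_action_def definably_proper_map_def by blast
      \<comment> \<open>The preimage of \<open>K\<close> times \<open>K'\<close> under the map that
        properness is about, with the two conditions separated.\<close>
      define Q where "Q = {z \<in> ?P. tsnd k m z \<in> K \<and> act z \<in> K'}"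
      have "tjoin m m (tsnd k m z) (act z) \<in> tprod m m K K' \<longleftrightarrow> tsnd k m z \<in> K \<and> act z \<in> K'"
        if "z \<in> ?P" for z
      proof -
        have "act z \<in> tuples m" using that act_X Xt by blast
        then show ?thesis
          using tprod_iff[of K m K' m "tjoin m m (tsnd k m z) (act z)"] K(2) Kc_subset[of "c + 1"] Xt
          by (auto simp: K'_def)
      qed
      then have Q: "definably_compact F (k + m) Q"
        using Q unfolding Q_def act_def by (metis (no_types, lifting) Collect_cong)
      have defQ: "definable F (k + m) Q" using Q by (simp add: definably_compact_def)
      note Qt = definable_tuples[OF defQ]
      have QP: "Q \<subseteq> ?P" by (auto simp: Q_def)
      have "clo m (tuples m) (act ` Q)"
      proof (rule clo_image[OF complete Qt])
        show "clo (k + m) (tuples (k + m)) Q" "bounded_tuples (k + m) Q"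
          using Q by (simp_all add: definably_compact_def closedin_tuple_iff)
        show "act \<in> Q \<rightarrow> tuples m" using act_X QP Xt by blast
        show "contn (k + m) Q (\<lambda>z. act z i)" if "i < m" for i
          using contn_subset[OF act_cont[OF that] QP] .
        have "dpred F (m + (k + m)) (\<lambda>z. tsnd m (k + m) z \<in> Q \<and>
            (tfst k (tsnd m (k + m) z) \<in> ?C \<and> tsnd k m (tsnd m (k + m) z) \<in> X \<and>
              tfst m z = \<phi> (tfst k (tsnd m (k + m) z)) (tsnd k m (tsnd m (k + m) z))))"
          by (rule dpred_conj[OF _ dpred_act] dpred_mem[OF defQ] dvec_tfst dvec_tsnd dvec_self)+
        then show "dpred F (m + (k + m)) (\<lambda>z. tsnd m (k + m) z \<in> Q \<and> tfst m z = act (tsnd m (k + m) z))"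
          by (rule iffD1[OF dpred_cong, rotated]) (use QP P in \<open>auto simp: act_def\<close>)
      qed
      moreover have img: "act ` Q = ?E `` K \<inter> K'"
      proof
        show "act ` Q \<subseteq> ?E `` K \<inter> K'"
        proof
          fix y assume "y \<in> act ` Q"
          then obtain z where z: "z \<in> ?P" "tsnd k m z \<in> K" "act z \<in> K'" "y = act z" by (auto simp: Q_def)
          have "tfst k z \<in> ?C" "tsnd k m z \<in> X" using P z(1) tprod_tuples by blast+
          then have "(tsnd k m z, y) \<in> ?E" unfolding E_iff using z(4) by (auto simp: act_def)
          then show "y \<in> ?E `` K \<inter> K'" using z by blast
        qed
        show "?E `` K \<inter> K' \<subseteq> act ` Q"
        proof
          fix y assume "y \<in> ?E `` K \<inter> K'"
          then obtain w g where w: "w \<in> K" "g \<in> ?C" "y = \<phi> g w" "y \<in> K'" unfolding Image_iff Int_iff E_iff by blast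
          then have t: "g \<in> tuples k" "w \<in> tuples m" using Ct Xt K(2) by blast+
          then have "act (tjoin k m g w) = y" using w by (simp add: act_def)
          moreover have "tjoin k m g w \<in> Q" using w t K(2) calculation by (auto simp: Q_def P)
          ultimately show "y \<in> act ` Q" by (metis imageI)
        qed
      qed
      ultimately have "clo m (tuples m) (?E `` K \<inter> K')" by simp
      then obtain r where r: "r > 0" "\<And>y. y \<in> ?E `` K \<inter> K' \<Longrightarrow> \<not> near m x y r"
        using cloD[of m "tuples m" "?E `` K \<inter> K'" x] x Xt by blast
      have "\<not> near m x y (min r d)" if y: "y \<in> ?E `` K" for y
      proof
        assume *: "near m x y (min r d)"
        have "y \<in> X" using y EX by blast
        then have "y \<in> K'" using d(2) near_mono[OF *, of d] by simp
        then show False using r(2)[of y] y near_mono[OF *, of r] by simp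
      qed
      then show "\<exists>r>0. \<forall>y\<in>?E `` K. \<not> near m x y r"
        using r(1) d(1) by (intro exI[of _ "min r d"]) auto
    qed
  next
    fix V assume V: "definable F m V" "opn m X V"
    have VX: "V \<subseteq> X" using V(2) by (simp add: opn_def)
    show "opn m X (?E `` V)"
      unfolding opn_def
    proof (intro conjI ballI)
      show "?E `` V \<subseteq> X" using EX by blast
      fix y assume "y \<in> ?E `` V"
      then obtain v g where v: "v \<in> V" "g \<in> ?C" "y = \<phi> g v" unfolding Image_iff E_iff by blast
      \<comment> \<open>Translation by the inverse carries \<open>y\<close> back to
        \<open>v\<close>. By continuity it maps a neighbourhood of \<open>y\<close> into
        \<open>V\<close>, so this neighbourhood lies in the saturation.\<close>
      define g' where "g' = inv\<^bsub>G\<^esub> g"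
      have g': "g' \<in> ?C" "g' \<in> tuples k" using v(2) Ct by (auto simp: g'_def)
      have y: "y \<in> X" using v VX element_image by blast
      have v': "v = \<phi> g' y" using inv_act v VX by (auto simp: g'_def)
      obtain e where e: "e > 0" "\<forall>w\<in>X. near m v w e \<longrightarrow> w \<in> V" using opnD[OF V(2) v(1)] by blast
      have inP: "tjoin k m g' w \<in> ?P" if "w \<in> X" for w
        using g'(1) that by (auto simp: tprod_def)
      have act: "act (tjoin k m g' w) = \<phi> g' w" if "w \<in> X" for w
        using g'(2) that Xt by (auto simp: act_def)
      obtain r where r: "r > 0"
        "\<And>z. z \<in> ?P \<Longrightarrow> near (k + m) (tjoin k m g' y) z r \<Longrightarrow> near m (act (tjoin k m g' y)) (act z) e"
        using contn_vec[of m "k + m" ?P act, OF act_cont inP[OF y] e(1)] by blast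
      have "w \<in> ?E `` V" if w: "w \<in> X" "near m y w r" for w
      proof -
        have "near (k + m) (tjoin k m g' y) (tjoin k m g' w) r"
          using w(2) r(1) by (simp add: near_tjoin near_refl)
        then have "near m v (\<phi> g' w) e" using r(2)[OF inP[OF w(1)]] act w(1) y v' by simp
        moreover have "\<phi> g' w \<in> X" using g'(1) w(1) element_image by blast
        ultimately have "\<phi> g' w \<in> V" using e(2) by blast
        moreover have "(w, \<phi> g' w) \<in> ?E" unfolding E_iff using g'(1) w(1) by blast
        ultimately show ?thesis using E_sym by blast
      qed
      then show "\<exists>r>0. \<forall>w\<in>X. near m y w r \<longrightarrow> w \<in> ?E `` V" using r(1) by blast
    qed
  qed
qed

theorem theorem6p4:
  fixes F :: "('a::{linordered_field, linorder_topology}, 'f, 'r) expansion"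
    and \<DD> :: "'a set set"
    and \<E> :: "nat \<Rightarrow> 'e::linorder set"
    and eRank :: "nat \<Rightarrow> (nat \<Rightarrow> 'a) set \<Rightarrow> 'e option"
    and k m :: nat
    and G :: "(nat \<Rightarrow> 'a) monoid"
    and X :: "(nat \<Rightarrow> 'a) set"
    and \<phi> :: "(nat \<Rightarrow> 'a) \<Rightarrow> (nat \<Rightarrow> 'a) \<Rightarrow> nat \<Rightarrow> 'a"
  assumes "definably_complete F"
    and "definable_choice F"
    and "good_pseudo_filter F \<DD>"
    and "good_extended_rank F \<E> eRank"
    and "definable_group F k G"
    and "definable_G_set F k G m X \<phi>"
    and "locally_closed_in (tuple_topology m) X"
    and "definably_proper_action F k G m X \<phi>"
  shows "\<exists>n Y f. definable_quotient F m X (orbit_relation G X \<phi>) n Y f"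
  using orbit_space_quotient[OF orbit_space_proper_action[OF assms(1,5-8)] assms(2,4)] .

end
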